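(* For each of the strategy classes of pure finite-state, finite-state, pure, and unrestricted strategies, TR-NCRSP$_{>}$ is undecidable. That is, there is no algorithm that, given a stochastic multiplayer game $\mathcal{G}$ in which every player has a terminal reachability objective and a rational number $\mu\in[0,1]$, decides whether there exists a strategy $\sigma_0$ of the system such that for every tuple $\bar\sigma_{-0}$ of environment strategies for which $(\sigma_0,\bar\sigma_{-0})$ is a 0-fixed Nash equilibrium, $\mathit{Pay}_0(\sigma_0,\bar\sigma_{-0})>\mu$ (all strategies ranging over the given class).
   Context: Game arena: a tuple $\mathcal{A}=\langle \Omega, V,(V_i)_{i\in\Omega\cup\{\mathit{nature}\}},\Delta,v_0\rangle$ where $\Omega=\{0,1,\dots,k\}$ is the set of players (player $0$ is the system, players $1,\dots,k$ are the environment players), $V$ is a finite set of vertices partitioned into sets $V_i$, $i\in\Omega\cup\{\mathit{nature}\}$, and $v_0$ is the initial vertex. $\Delta\subseteq (V_{\mathit{nature}}\times[0,1]\times V)\cup((\bigcup_{i\in\Omega}V_i)\times\{\bot\}\times V)$; for each $v\in V_{\mathit{nature}}$, $w\in V$ there is exactly one rational $p$ with $(v,p,w)\in\Delta$, forming a probability distribution over $V$. $\mathit{next}(v)=\{w\mid\exists p\in(0,1]\cup\{\bot\},(v,p,w)\in\Delta\}$, nonempty. A vertex $v$ is terminal if $\mathit{next}(v)=\{v\}$. Plays are infinite paths $\pi(0)\pi(1)\dots$ from $v_0$. For a set $F$ of terminal vertices, $\mathit{TR}(F)=\{\pi\mid\exists n.\ \pi(n)\in F\}$ is a terminal reachability objective;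 each player $i$ has such an objective $O_i$. Strategies: $\sigma_i:V^*V_i\to D(V)$ (distributions over successors). Pure: every value is a Dirac distribution. Finite-state: implementable by a Mealy machine with finitely many memory states (reading the history and outputting the distribution). A strategy profile $\bar\sigma$ determines a probability measure $\mathit{Pr}^{\bar\sigma}$ on plays; $\mathit{Pay}_i(\bar\sigma)=\mathit{Pr}^{\bar\sigma}(O_i)$. $\bar\sigma$ is a 0-fixed Nash equilibrium if for every environment player $i\ne0$ and every strategy $\tau$ of player $i$ in the class under consideration, $\mathit{Pay}_i(\bar\sigma_{-i},\tau)\le\mathit{Pay}_i(\bar\sigma)$, where $(\bar\sigma_{-i},\tau)$ replaces player $i$'s strategy by $\tau$. *)

theory Defs
  imports "HOL-Probability.Probability_Mass_Function" "HOL-Library.Nat_Bijection"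
begin

datatype recf = Z | S | Id nat | Cn recf "recf list" | Pr recf recf | Mn recf

inductive eval :: "recf \<Rightarrow> nat list \<Rightarrow> nat \<Rightarrow> bool" where
  eval_Z: "eval Z xs 0"
| eval_S: "eval S (x # xs) (Suc x)"
| eval_Id: "i < length xs \<Longrightarrow> eval (Id i) xs (xs ! i)"
| eval_Cn: "list_all2 (\<lambda>g y. eval g xs y) gs ys \<Longrightarrow> eval f ys z \<Longrightarrow> eval (Cn f gs) xs z"
| eval_Pr0: "eval f xs z \<Longrightarrow> eval (Pr f g) (0 # xs) z"
| eval_PrS: "eval (Pr f g) (n # xs) r \<Longrightarrow> eval g (r # n # xs) z \<Longrightarrow> eval (Pr f g) (Suc n # xs) z"
| eval_Mn: "eval f (y # xs) 0 \<Longrightarrow> (\<forall>k<y. \<exists>m. m > 0 \<and> eval f (k # xs) m) \<Longrightarrow> eval (Mn f) xs y"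

text \<open>Vertices are 0..nv-1. Players are 0..np (player 0 = system).
  own ! v = 0 means v is a nature vertex, own ! v = Suc i means v belongs to player i.
  pedges: edges (v,w) out of player vertices; nedges: (v,w,a,b) means nature vertex v moves
  to w with rational probability a/b. targ ! i lists the target set F_i of player i.
  The threshold is mu = mu_num / mu_den.\<close>

datatype inst = Inst (nv: nat) (np: nat) (own: "nat list") (pedges: "(nat \<times> nat) list")
  (nedges: "(nat \<times> nat \<times> nat \<times> nat) list") (v0: nat) (targ: "nat list list")
  (mu_num: nat) (mu_den: nat)

definition enc_inst :: "inst \<Rightarrow> nat" where
  "enc_inst x = list_encode [nv x, np x, list_encode (own x),
     list_encode (map prod_encode (pedges x)),
     list_encode (map (\<lambda>(a, b, c, d). list_encode [a, b, c, d]) (nedges x)),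
     v0 x, list_encode (map list_encode (targ x)), mu_num x, mu_den x]"

definition nprob :: "inst \<Rightarrow> nat \<Rightarrow> nat \<Rightarrow> real" where
  "nprob x v w = sum_list (map (\<lambda>(v', w', a, b). if v' = v \<and> w' = w then real a / real b else 0) (nedges x))"

definition nxt :: "inst \<Rightarrow> nat \<Rightarrow> nat set" where
  "nxt x v = (if own x ! v = 0 then {w. nprob x v w > 0} else {w. (v, w) \<in> set (pedges x)})"

definition terminal :: "inst \<Rightarrow> nat \<Rightarrow> bool" where
  "terminal x v \<longleftrightarrow> nxt x v = {v}"

definition target :: "inst \<Rightarrow> nat \<Rightarrow> nat set" where
  "target x i = set (targ x ! i)"

definition wf_inst :: "inst \<Rightarrow> bool" where
  "wf_inst x \<longleftrightarrow>
     length (own x) = nv x \<and> v0 x < nv x \<and>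
     (\<forall>v<nv x. own x ! v \<le> Suc (np x)) \<and>
     (\<forall>(v, w)\<in>set (pedges x). v < nv x \<and> w < nv x \<and> own x ! v \<noteq> 0) \<and>
     (\<forall>(v, w, a, b)\<in>set (nedges x). v < nv x \<and> w < nv x \<and> own x ! v = 0 \<and> b > 0) \<and>
     distinct (map (\<lambda>(v, w, a, b). (v, w)) (nedges x)) \<and>
     (\<forall>v<nv x. own x ! v = 0 \<longrightarrow> (\<Sum>w<nv x. nprob x v w) = 1) \<and>
     (\<forall>v<nv x. nxt x v \<noteq> {}) \<and>
     length (targ x) = Suc (np x) \<and>
     (\<forall>i\<le>np x. \<forall>v\<in>target x i. v < nv x \<and> terminal x v) \<and>
     mu_den x > 0 \<and> mu_num x \<le> mu_den x"

text \<open>A strategy maps a history (nonempty vertex list) to a distribution over vertices.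
  A profile assigns a strategy to every player index.\<close>

type_synonym strat = "nat list \<Rightarrow> nat pmf"
type_synonym profile = "nat \<Rightarrow> strat"

definition step :: "inst \<Rightarrow> profile \<Rightarrow> nat list \<Rightarrow> nat \<Rightarrow> real" where
  "step x \<sigma>s h w = (let v = last h in
     if own x ! v = 0 then nprob x v w else pmf (\<sigma>s (own x ! v - 1) h) w)"

definition hist_prob :: "inst \<Rightarrow> profile \<Rightarrow> nat list \<Rightarrow> real" where
  "hist_prob x \<sigma>s h = (\<Prod>j<length h - 1. step x \<sigma>s (take (Suc j) h) (h ! Suc j))"

definition reach_upto :: "inst \<Rightarrow> profile \<Rightarrow> nat set \<Rightarrow> nat \<Rightarrow> real" where
  "reach_upto x \<sigma>s F n = (\<Sum>h\<in>{h. length h = Suc n \<and> set h \<subseteq> {..<nv x} \<and> h ! 0 = v0 x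
        \<and> (\<exists>j\<le>n. h ! j \<in> F)}. hist_prob x \<sigma>s h)"

text \<open>Pay_i = Pr(TR(F_i)) = sup_n Pr(F_i reached within n steps) (continuity of measure).\<close>
definition Pay :: "inst \<Rightarrow> profile \<Rightarrow> nat \<Rightarrow> real" where
  "Pay x \<sigma>s i = (SUP n. reach_upto x \<sigma>s (target x i) n)"

definition at_player :: "inst \<Rightarrow> nat \<Rightarrow> nat list \<Rightarrow> bool" where
  "at_player x i h \<longleftrightarrow> h \<noteq> [] \<and> last h < nv x \<and> own x ! last h = Suc i"

definition valid_strat :: "inst \<Rightarrow> nat \<Rightarrow> strat \<Rightarrow> bool" where
  "valid_strat x i \<sigma> \<longleftrightarrow> (\<forall>h. at_player x i h \<longrightarrow> set_pmf (\<sigma> h) \<subseteq> nxt x (last h))"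

datatype sclass = PureFinState | FinState | Pure | Unrestricted

definition is_pure :: "inst \<Rightarrow> nat \<Rightarrow> strat \<Rightarrow> bool" where
  "is_pure x i \<sigma> \<longleftrightarrow> (\<forall>h. at_player x i h \<longrightarrow> (\<exists>w. \<sigma> h = return_pmf w))"

definition is_finstate :: "inst \<Rightarrow> nat \<Rightarrow> strat \<Rightarrow> bool" where
  "is_finstate x i \<sigma> \<longleftrightarrow> (\<exists>(M :: nat set) m0 (upd :: nat \<Rightarrow> nat \<Rightarrow> nat) (out :: nat \<Rightarrow> nat \<Rightarrow> nat pmf).
     finite M \<and> m0 \<in> M \<and> (\<forall>m\<in>M. \<forall>v. upd m v \<in> M) \<and>
     (\<forall>h. at_player x i h \<longrightarrow> \<sigma> h = out (foldl upd m0 (butlast h)) (last h)))"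

fun in_class :: "inst \<Rightarrow> nat \<Rightarrow> sclass \<Rightarrow> strat \<Rightarrow> bool" where
  "in_class x i PureFinState \<sigma> \<longleftrightarrow> is_pure x i \<sigma> \<and> is_finstate x i \<sigma>"
| "in_class x i FinState \<sigma> \<longleftrightarrow> is_finstate x i \<sigma>"
| "in_class x i Pure \<sigma> \<longleftrightarrow> is_pure x i \<sigma>"
| "in_class x i Unrestricted \<sigma> \<longleftrightarrow> True"

definition is_0NE :: "inst \<Rightarrow> sclass \<Rightarrow> profile \<Rightarrow> bool" where
  "is_0NE x c \<sigma>s \<longleftrightarrow> (\<forall>i\<in>{1..np x}. \<forall>\<tau>. valid_strat x i \<tau> \<and> in_class x i c \<tau> \<longrightarrow>
      Pay x (\<sigma>s(i := \<tau>)) i \<le> Pay x \<sigma>s i)"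

definition ncrsp :: "inst \<Rightarrow> sclass \<Rightarrow> bool" where
  "ncrsp x c \<longleftrightarrow> (\<exists>\<sigma>0. valid_strat x 0 \<sigma>0 \<and> in_class x 0 c \<sigma>0 \<and>
     (\<forall>\<sigma>s. \<sigma>s 0 = \<sigma>0 \<and> (\<forall>i\<in>{1..np x}. valid_strat x i (\<sigma>s i) \<and> in_class x i c (\<sigma>s i))
        \<and> is_0NE x c \<sigma>s \<longrightarrow> Pay x \<sigma>s 0 > real (mu_num x) / real (mu_den x)))"

definition decides :: "recf \<Rightarrow> (inst \<Rightarrow> bool) \<Rightarrow> bool" where
  "decides f P \<longleftrightarrow> (\<forall>x. wf_inst x \<longrightarrow> (\<exists>y. eval f [enc_inst x] y) \<and> (eval f [enc_inst x] 0 \<longleftrightarrow> P x))"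

end

theory Submission
  imports Defs
begin

text \<open>
  Suppose that \<open>f\<close> decides the problem. By diagonalisation it suffices to attach to every program a game
  with an input \<open>t\<close>, computable from \<open>t\<close>, which has an equilibrium of system payoff \<open>0\<close> (in any strategy
  class) if and only if the program, started on \<open>t\<close>, computes the value \<open>0\<close>: run on its own game, the program
  \<open>f\<close> then contradicts itself. Since \<open>f\<close> is total, only halting computations have to be simulated, and this
  is why one game serves all four classes.

  The system owns no vertex, and its target is reached exactly when some environment player exits. The contents
  \<open>n\<close> of a register is represented by the probability \<open>2^-n\<close> with which an indifferent player produces
  the result 1 in a gadget. For each register and each parity of the step number there are two players with
  complementary payoffs, who may exit at every second step for a fixed reward. If nobody exits, then both
  of them get exactly their rewards, which is a linear equation between the values of the gadgets at consecutive
  steps; the equations are chosen such that they are the instructions of the machine. Zero tests are decided by one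
  of these players: as her payoffs after the two outcomes differ whenever both satisfy the equations, she
  cannot randomise. A failed assertion leads to an equation without a solution in \<open>[0, 1]\<close>. Conversely, playing the
  true run, with an immediate exit after any deviation, is a pure finite-state equilibrium.
\<close>

section \<open>Reachability values and one-point deviations\<close>

text \<open>Exits at every second step only are what makes an equation between two steps possible: a
  value pinned at two consecutive nodes would fix the gadget payoff of a single step. Between her
  exits a player is paid first for the operation applied to the old contents and then, with half the
  weight, for the new contents. The rewards \<open>2 / (3 * R)\<close> and
  \<open>1 / (3 * R)\<close> add up to \<open>1 / R\<close>, the fixed point of V = V / 2 + 1 / (2 *
  R) for the joint value of a complementary pair; hence two lower bounds become equations. All
  classes are treated at once because the two directions use opposite extremes: equilibria are
  analysed by deviations at a single history, which stay inside every class, whereas the constructed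
  pure finite-state profile is stable against arbitrary strategies. The player at a branch is not
  rewarded for the correct choice. The instruction at each target tests the register again, and a
  wrong choice leaves no solution. The input enters through one probability, hence through two
  edges, so that the encoding of the game is an easy function of the input.\<close>

definition valid_profile :: "inst \<Rightarrow> profile \<Rightarrow> bool" where
  "valid_profile x \<sigma>s \<longleftrightarrow> wf_inst x \<and> (\<forall>i\<le>np x. valid_strat x i (\<sigma>s i))"

primrec reach_within :: "inst \<Rightarrow> profile \<Rightarrow> nat set \<Rightarrow> nat \<Rightarrow> nat list \<Rightarrow> real" where
  "reach_within x \<sigma>s F 0 h = (if last h \<in> F then 1 else 0)"
| "reach_within x \<sigma>s F (Suc n) h =
     (if last h \<in> F then 1 else \<Sum>w<nv x. step x \<sigma>s h w * reach_within x \<sigma>s F n (h @ [w]))"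

definition reach_val :: "inst \<Rightarrow> profile \<Rightarrow> nat set \<Rightarrow> nat list \<Rightarrow> real" where
  "reach_val x \<sigma>s F h = (SUP n. reach_within x \<sigma>s F n h)"

primrec path_prob :: "inst \<Rightarrow> profile \<Rightarrow> nat list \<Rightarrow> nat list \<Rightarrow> real" where
  "path_prob x \<sigma>s h [] = 1"
| "path_prob x \<sigma>s h (w # l) = step x \<sigma>s h w * path_prob x \<sigma>s (h @ [w]) l"

lemma hist_prob_snoc:
  assumes "h \<noteq> []"
  shows "hist_prob x \<sigma>s (h @ [w]) = hist_prob x \<sigma>s h * step x \<sigma>s h w"
proof -
  obtain n where n: "length h = Suc n" using assms by (cases h) auto
  have "hist_prob x \<sigma>s (h @ [w]) = (\<Prod>j<Suc n. step x \<sigma>s (take (Suc j) (h @ [w])) ((h @ [w]) ! Suc j))"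
    by (simp add: hist_prob_def n)
  also have "\<dots> = (\<Prod>j<n. step x \<sigma>s (take (Suc j) h) (h ! Suc j)) * step x \<sigma>s h w"
    by (simp add: n nth_append)
  finally show ?thesis by (simp add: hist_prob_def n)
qed

lemma hist_prob_append:
  "h \<noteq> [] \<Longrightarrow> hist_prob x \<sigma>s (h @ l) = hist_prob x \<sigma>s h * path_prob x \<sigma>s h l"
proof (induction l arbitrary: h)
  case (Cons w l)
  have "hist_prob x \<sigma>s ((h @ [w]) @ l) = hist_prob x \<sigma>s (h @ [w]) * path_prob x \<sigma>s (h @ [w]) l"
    using Cons.IH by blast
  then show ?case using Cons.prems by (simp add: hist_prob_snoc)
qed simp

lemma step_nonneg: "0 \<le> step x \<sigma>s h w"
proof -
  have "0 \<le> nprob x v w" for v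
    unfolding nprob_def by (rule sum_list_nonneg) auto
  then show ?thesis by (simp add: step_def Let_def)
qed

lemma nxt_player_subset:
  assumes "wf_inst x" "own x ! v \<noteq> 0"
  shows "nxt x v \<subseteq> {..<nv x}"
  using assms unfolding wf_inst_def nxt_def by auto

lemma step_sum:
  assumes vp: "valid_profile x \<sigma>s" and h: "h \<noteq> []" "last h < nv x"
  shows "(\<Sum>w<nv x. step x \<sigma>s h w) = 1"
proof (cases "own x ! last h = 0")
  case True
  then show ?thesis using vp h by (simp add: valid_profile_def wf_inst_def step_def Let_def)
next
  case False
  define i where "i = own x ! last h - 1"
  have i: "own x ! last h = Suc i" using False i_def by simp
  have wf: "wf_inst x" using vp by (simp add: valid_profile_def)
  have "own x ! last h \<le> Suc (np x)" using wf h unfolding wf_inst_def by blast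
  then have "i \<le> np x" using i by simp
  then have "set_pmf (\<sigma>s i h) \<subseteq> nxt x (last h)"
    using vp h i unfolding valid_profile_def valid_strat_def at_player_def by blast
  then have "set_pmf (\<sigma>s i h) \<subseteq> {..<nv x}" using nxt_player_subset[OF wf False] by blast
  then have "(\<Sum>w<nv x. pmf (\<sigma>s i h) w) = 1" by (intro sum_pmf_eq_1) auto
  then show ?thesis using i by (simp add: step_def Let_def)
qed

lemma reach_within_nonneg: "0 \<le> reach_within x \<sigma>s F n h"
  by (induction n arbitrary: h) (auto intro!: sum_nonneg mult_nonneg_nonneg step_nonneg)

lemma reach_within_le_1:
  assumes vp: "valid_profile x \<sigma>s"
  shows "h \<noteq> [] \<Longrightarrow> last h < nv x \<Longrightarrow> reach_within x \<sigma>s F n h \<le> 1"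
proof (induction n arbitrary: h)
  case (Suc n)
  have "(\<Sum>w<nv x. step x \<sigma>s h w * reach_within x \<sigma>s F n (h @ [w])) \<le> (\<Sum>w<nv x. step x \<sigma>s h w * 1)"
    by (intro sum_mono mult_left_mono Suc.IH) (auto simp: step_nonneg)
  then show ?case using step_sum[OF vp Suc.prems] by simp
qed simp

lemma reach_within_Suc_ge:
  assumes vp: "valid_profile x \<sigma>s"
  shows "reach_within x \<sigma>s F n h \<le> reach_within x \<sigma>s F (Suc n) h"
proof (induction n arbitrary: h)
  case 0
  then show ?case by (auto intro!: sum_nonneg mult_nonneg_nonneg step_nonneg)
next
  case (Suc n)
  have "(\<Sum>w<nv x. step x \<sigma>s h w * reach_within x \<sigma>s F n (h @ [w]))
      \<le> (\<Sum>w<nv x. step x \<sigma>s h w * reach_within x \<sigma>s F (Suc n) (h @ [w]))"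
    by (intro sum_mono mult_left_mono Suc.IH) (auto simp: step_nonneg)
  then show ?case by simp
qed

lemma reach_within_limit:
  assumes vp: "valid_profile x \<sigma>s" and h: "h \<noteq> []" "last h < nv x"
  shows "(\<lambda>n. reach_within x \<sigma>s F n h) \<longlonglongrightarrow> reach_val x \<sigma>s F h"
  unfolding reach_val_def
proof (rule LIMSEQ_incseq_SUP)
  show "bdd_above (range (\<lambda>n. reach_within x \<sigma>s F n h))"
    using reach_within_le_1[OF vp h] by (intro bdd_aboveI[of _ 1]) auto
  show "incseq (\<lambda>n. reach_within x \<sigma>s F n h)"
    using reach_within_Suc_ge[OF vp] by (intro incseq_SucI)
qed

lemma reach_val_nonneg:
  assumes "valid_profile x \<sigma>s" "h \<noteq> []" "last h < nv x"
  shows "0 \<le> reach_val x \<sigma>s F h"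
  using reach_within_limit[OF assms] by (rule LIMSEQ_le_const) (auto simp: reach_within_nonneg)

lemma reach_val_le_1:
  assumes "valid_profile x \<sigma>s" "h \<noteq> []" "last h < nv x"
  shows "reach_val x \<sigma>s F h \<le> 1"
  using reach_within_limit[OF assms] by (rule LIMSEQ_le_const2) (use reach_within_le_1[OF assms] in auto)

lemma reach_val_in:
  assumes "last h \<in> F"
  shows "reach_val x \<sigma>s F h = 1"
proof -
  have "reach_within x \<sigma>s F n h = 1" for n using assms by (cases n) auto
  then show ?thesis by (simp add: reach_val_def)
qed

lemma reach_val_unfold:
  assumes vp: "valid_profile x \<sigma>s" and h: "h \<noteq> []" "last h < nv x" and F: "last h \<notin> F"
  shows "reach_val x \<sigma>s F h = (\<Sum>w<nv x. step x \<sigma>s h w * reach_val x \<sigma>s F (h @ [w]))"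
proof -
  have "(\<lambda>n. reach_within x \<sigma>s F (Suc n) h) \<longlonglongrightarrow> reach_val x \<sigma>s F h"
    using reach_within_limit[OF vp h] by (rule LIMSEQ_Suc)
  moreover have "(\<lambda>n. reach_within x \<sigma>s F (Suc n) h)
      \<longlonglongrightarrow> (\<Sum>w<nv x. step x \<sigma>s h w * reach_val x \<sigma>s F (h @ [w]))"
    using F by (auto intro!: tendsto_sum tendsto_mult reach_within_limit[OF vp])
  ultimately show ?thesis by (rule LIMSEQ_unique)
qed

lemma reach_within_cong:
  assumes "\<And>l. step x \<sigma>s (h @ l) = step x \<sigma>s' (h @ l)"
  shows "reach_within x \<sigma>s F n h = reach_within x \<sigma>s' F n h"
  using assms
proof (induction n arbitrary: h)
  case (Suc n)
  have "reach_within x \<sigma>s F n (h @ [w]) = reach_within x \<sigma>s' F n (h @ [w])" for w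
    using Suc.prems by (intro Suc.IH) (metis append_assoc)
  then show ?case using Suc.prems[of "[]"] by simp
qed simp

lemma reach_val_cong:
  assumes "\<And>l. step x \<sigma>s (h @ l) = step x \<sigma>s' (h @ l)"
  shows "reach_val x \<sigma>s F h = reach_val x \<sigma>s' F h"
  unfolding reach_val_def using reach_within_cong[OF assms] by simp

lemma lists_Suc_image:
  "{l. length l = Suc n \<and> set l \<subseteq> A} = (\<Union>w\<in>A. (#) w ` {l. length l = n \<and> set l \<subseteq> A})"
  by (auto simp: length_Suc_conv)

lemma sum_lists_Suc:
  fixes f :: "nat list \<Rightarrow> real"
  shows "(\<Sum>l\<in>{l. length l = Suc n \<and> set l \<subseteq> {..<m}}. f l)
    = (\<Sum>w<m. \<Sum>l\<in>{l. length l = n \<and> set l \<subseteq> {..<m}}. f (w # l))"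
proof -
  have fin: "finite {l. length l = n \<and> set l \<subseteq> {..<m}}"
    using finite_lists_length_eq[of "{..<m}" n] by (simp add: conj_commute)
  have "(\<Sum>l\<in>{l. length l = Suc n \<and> set l \<subseteq> {..<m}}. f l)
    = (\<Sum>w<m. \<Sum>l\<in>(#) w ` {l. length l = n \<and> set l \<subseteq> {..<m}}. f l)"
    unfolding lists_Suc_image by (intro sum.UNION_disjoint) (use fin in auto)
  also have "\<dots> = (\<Sum>w<m. \<Sum>l\<in>{l. length l = n \<and> set l \<subseteq> {..<m}}. f (w # l))"
    by (rule sum.cong) (simp_all add: sum.reindex)
  finally show ?thesis .
qed

lemma path_prob_total:
  assumes vp: "valid_profile x \<sigma>s"
  shows "h \<noteq> [] \<Longrightarrow> last h < nv x \<Longrightarrow>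
    (\<Sum>l\<in>{l. length l = n \<and> set l \<subseteq> {..<nv x}}. path_prob x \<sigma>s h l) = 1"
proof (induction n arbitrary: h)
  case 0
  have "{l. length l = 0 \<and> set l \<subseteq> {..<nv x}} = {[]}" by auto
  then show ?case by simp
next
  case (Suc n)
  have "(\<Sum>l\<in>{l. length l = Suc n \<and> set l \<subseteq> {..<nv x}}. path_prob x \<sigma>s h l)
     = (\<Sum>w<nv x. step x \<sigma>s h w * (\<Sum>l\<in>{l. length l = n \<and> set l \<subseteq> {..<nv x}}. path_prob x \<sigma>s (h @ [w]) l))"
    by (simp add: sum_lists_Suc sum_distrib_left)
  also have "\<dots> = (\<Sum>w<nv x. step x \<sigma>s h w * 1)"
    by (intro sum.cong refl arg_cong2[where f = "(*)"] Suc.IH) auto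
  finally show ?case using step_sum[OF vp Suc.prems] by simp
qed

text \<open>\<open>reach_upto\<close> sums over complete histories of a fixed length, while
  \<open>reach_within\<close> stops at the first visit to \<open>F\<close>. The two agree because
  the continuations after that visit have total probability 1
  (\<open>path_prob_total\<close>).\<close>

lemma reach_within_sum:
  assumes vp: "valid_profile x \<sigma>s"
  shows "h \<noteq> [] \<Longrightarrow> last h < nv x \<Longrightarrow> reach_within x \<sigma>s F n h =
    (\<Sum>l\<in>{l. length l = n \<and> set l \<subseteq> {..<nv x}}.
       if \<exists>v\<in>set (last h # l). v \<in> F then path_prob x \<sigma>s h l else 0)"
proof (induction n arbitrary: h)
  case 0
  have "{l. length l = 0 \<and> set l \<subseteq> {..<nv x}} = {[]}" by auto
  then show ?case by simp
next
  case (Suc n)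
  show ?case
  proof (cases "last h \<in> F")
    case True
    then show ?thesis using path_prob_total[OF vp Suc.prems, of "Suc n"] by simp
  next
    case False
    have "(\<Sum>l\<in>{l. length l = Suc n \<and> set l \<subseteq> {..<nv x}}.
       if \<exists>v\<in>set (last h # l). v \<in> F then path_prob x \<sigma>s h l else 0)
      = (\<Sum>w<nv x. step x \<sigma>s h w * (\<Sum>l\<in>{l. length l = n \<and> set l \<subseteq> {..<nv x}}.
         if \<exists>v\<in>set (last (h @ [w]) # l). v \<in> F then path_prob x \<sigma>s (h @ [w]) l else 0))"
      unfolding sum_lists_Suc sum_distrib_left
      by (intro sum.cong refl) (use False in auto)
    also have "\<dots> = (\<Sum>w<nv x. step x \<sigma>s h w * reach_within x \<sigma>s F n (h @ [w]))"
      by (intro sum.cong refl arg_cong2[where f = "(*)"] Suc.IH[symmetric]) auto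
    finally show ?thesis using False by simp
  qed
qed

lemma reach_upto_eq:
  assumes vp: "valid_profile x \<sigma>s"
  shows "reach_upto x \<sigma>s F n = reach_within x \<sigma>s F n [v0 x]"
proof -
  let ?L = "{l. length l = n \<and> set l \<subseteq> {..<nv x}}"
  have v: "v0 x < nv x" using vp by (simp add: valid_profile_def wf_inst_def)
  have fin: "finite ?L"
    using finite_lists_length_eq[of "{..<nv x}" n] by (simp add: conj_commute)
  have "{h. length h = Suc n \<and> set h \<subseteq> {..<nv x} \<and> h ! 0 = v0 x \<and> (\<exists>j\<le>n. h ! j \<in> F)}
      = (#) (v0 x) ` {l \<in> ?L. \<exists>v\<in>set (v0 x # l). v \<in> F}" (is "?A = ?B")
  proof (intro set_eqI iffI)
    fix h assume h: "h \<in> ?A"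
    then obtain l where "h = v0 x # l" "length l = n" by (cases h) auto
    moreover have "\<exists>v\<in>set h. v \<in> F" using h by (auto simp: less_Suc_eq_le intro!: bexI[OF _ nth_mem])
    ultimately show "h \<in> ?B" using h by auto
  next
    fix h assume h: "h \<in> ?B"
    then obtain l where l: "h = v0 x # l" "length l = n" "set l \<subseteq> {..<nv x}" "\<exists>v\<in>set h. v \<in> F" by auto
    then have "\<exists>j\<le>n. h ! j \<in> F" by (metis in_set_conv_nth length_Cons less_Suc_eq_le)
    then show "h \<in> ?A" using l v by auto
  qed
  then have "reach_upto x \<sigma>s F n = (\<Sum>l\<in>{l \<in> ?L. \<exists>v\<in>set (v0 x # l). v \<in> F}. hist_prob x \<sigma>s ([v0 x] @ l))"
    unfolding reach_upto_def by (simp add: sum.reindex)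
  also have "\<dots> = (\<Sum>l\<in>{l \<in> ?L. \<exists>v\<in>set (v0 x # l). v \<in> F}. path_prob x \<sigma>s [v0 x] l)"
    by (subst hist_prob_append) (auto simp: hist_prob_def)
  also have "\<dots> = reach_within x \<sigma>s F n [v0 x]"
    unfolding sum.inter_filter[OF fin] using reach_within_sum[OF vp, of "[v0 x]" F n] v by simp
  finally show ?thesis .
qed

lemma Pay_eq_reach_val:
  "valid_profile x \<sigma>s \<Longrightarrow> Pay x \<sigma>s i = reach_val x \<sigma>s (target x i) [v0 x]"
  by (simp add: Pay_def reach_val_def reach_upto_eq)

text \<open>The path may itself run through \<open>F\<close>; there the value is 1 and dominates.
  For the system this turns payoff 0 into the absence of exits along every path of positive
  probability.\<close>

lemma reach_val_ge_path:
  assumes vp: "valid_profile x \<sigma>s"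
  shows "h \<noteq> [] \<Longrightarrow> last h < nv x \<Longrightarrow> set l \<subseteq> {..<nv x} \<Longrightarrow>
    path_prob x \<sigma>s h l * reach_val x \<sigma>s F (h @ l) \<le> reach_val x \<sigma>s F h"
proof (induction l arbitrary: h)
  case (Cons w l)
  have IH: "path_prob x \<sigma>s (h @ [w]) l * reach_val x \<sigma>s F ((h @ [w]) @ l) \<le> reach_val x \<sigma>s F (h @ [w])"
    using Cons by (intro Cons.IH) auto
  have nn: "0 \<le> step x \<sigma>s h u * reach_val x \<sigma>s F (h @ [u])" if "u < nv x" for u
    using that by (intro mult_nonneg_nonneg step_nonneg reach_val_nonneg[OF vp]) auto
  have "step x \<sigma>s h w * reach_val x \<sigma>s F (h @ [w]) \<le> reach_val x \<sigma>s F h"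
  proof (cases "last h \<in> F")
    case True
    have "(\<Sum>u\<in>{w}. step x \<sigma>s h u) \<le> (\<Sum>u<nv x. step x \<sigma>s h u)"
      using Cons.prems by (intro sum_mono2) (auto simp: step_nonneg)
    then have "step x \<sigma>s h w \<le> 1" using step_sum[OF vp Cons.prems(1,2)] by simp
    then have "step x \<sigma>s h w * reach_val x \<sigma>s F (h @ [w]) \<le> 1 * 1"
      using Cons.prems by (intro mult_mono reach_val_le_1[OF vp] reach_val_nonneg[OF vp]) (auto simp: step_nonneg)
    then show ?thesis using True by (simp add: reach_val_in)
  next
    case False
    have "(\<Sum>u\<in>{w}. step x \<sigma>s h u * reach_val x \<sigma>s F (h @ [u]))
       \<le> (\<Sum>u<nv x. step x \<sigma>s h u * reach_val x \<sigma>s F (h @ [u]))"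
      using Cons.prems nn by (intro sum_mono2) auto
    then show ?thesis using reach_val_unfold[OF vp Cons.prems(1,2) False] by simp
  qed
  moreover have "step x \<sigma>s h w * (path_prob x \<sigma>s (h @ [w]) l * reach_val x \<sigma>s F (h @ w # l))
     \<le> step x \<sigma>s h w * reach_val x \<sigma>s F (h @ [w])"
    using IH by (intro mult_left_mono) (auto simp: step_nonneg)
  ultimately show ?case by (simp add: mult.assoc)
qed simp

section \<open>Deviations at a single history and the strategy classes\<close>

definition deviate :: "profile \<Rightarrow> nat \<Rightarrow> nat list \<Rightarrow> nat \<Rightarrow> profile" where
  "deviate \<sigma>s i h w = \<sigma>s(i := (\<sigma>s i)(h := return_pmf w))"

lemma step_deviate_other: "h' \<noteq> h \<Longrightarrow> step x (deviate \<sigma>s i h w) h' = step x \<sigma>s h'"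
  by (auto simp: step_def deviate_def fun_eq_iff Let_def)

lemma reach_val_deviate_incomparable:
  "\<nexists>l. h' @ l = h \<Longrightarrow> reach_val x (deviate \<sigma>s i h w) F h' = reach_val x \<sigma>s F h'"
  by (intro reach_val_cong step_deviate_other) blast

text \<open>Changing a strategy at the single history \<open>h @ l\<close> changes the value at \<open>h\<close> by the
  change at \<open>h @ l\<close>, weighted with the probability of \<open>l\<close>.\<close>

lemma reach_val_deviate_diff:
  assumes vp: "valid_profile x \<sigma>s" and vp': "valid_profile x (deviate \<sigma>s i (h @ l) w)"
    and "h \<noteq> []" "last h < nv x" "set l \<subseteq> {..<nv x}"
    and "\<forall>v\<in>set (last h # l). v \<notin> F"
  shows "reach_val x (deviate \<sigma>s i (h @ l) w) F h - reach_val x \<sigma>s F h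
    = path_prob x \<sigma>s h l *
      (reach_val x (deviate \<sigma>s i (h @ l) w) F (h @ l) - reach_val x \<sigma>s F (h @ l))"
  using assms(2-)
proof (induction l arbitrary: h)
  case (Cons u l)
  let ?\<sigma> = "deviate \<sigma>s i (h @ u # l) w"
  have eq: "h @ u # l = (h @ [u]) @ l" by simp
  have IH: "reach_val x ?\<sigma> F (h @ [u]) - reach_val x \<sigma>s F (h @ [u])
    = path_prob x \<sigma>s (h @ [u]) l * (reach_val x ?\<sigma> F (h @ u # l) - reach_val x \<sigma>s F (h @ u # l))"
    unfolding eq using Cons.prems by (intro Cons.IH) auto
  have other: "reach_val x ?\<sigma> F (h @ [v]) = reach_val x \<sigma>s F (h @ [v])" if "v \<noteq> u" for v
    using that by (intro reach_val_deviate_incomparable) auto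
  have "reach_val x ?\<sigma> F h - reach_val x \<sigma>s F h
     = (\<Sum>v<nv x. step x \<sigma>s h v * (reach_val x ?\<sigma> F (h @ [v]) - reach_val x \<sigma>s F (h @ [v])))"
    using Cons.prems reach_val_unfold[OF vp, of h F] reach_val_unfold[OF Cons.prems(1), of h F]
    by (simp add: step_deviate_other right_diff_distrib sum_subtractf)
  also have "\<dots> = (\<Sum>v<nv x. if v = u then step x \<sigma>s h u * (reach_val x ?\<sigma> F (h @ [u]) - reach_val x \<sigma>s F (h @ [u])) else 0)"
    using other by (intro sum.cong) auto
  also have "\<dots> = step x \<sigma>s h u * (reach_val x ?\<sigma> F (h @ [u]) - reach_val x \<sigma>s F (h @ [u]))"
    using Cons.prems by simp
  finally show ?case using IH by simp
qed simp

text \<open>Product of the given automaton with one that follows the fixed word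
  \<open>butlast h0\<close>; the output is overridden only when exactly this word has been read. So
  a deviation at one history never leaves the finite-state classes.\<close>

lemma is_finstate_fun_upd:
  assumes "is_finstate x i \<sigma>"
  shows "is_finstate x i (\<sigma>(h0 := d))"
proof (cases "h0 = []")
  case True
  then have "at_player x i h \<Longrightarrow> (\<sigma>(h0 := d)) h = \<sigma> h" for h by (auto simp: at_player_def)
  then show ?thesis using assms unfolding is_finstate_def by (simp cong: imp_cong)
next
  case False
  define g where "g = butlast h0"
  define a where "a = last h0"
  have h0: "h0 = g @ [a]" using False by (simp add: g_def a_def)
  define n where "n = length g"
  from assms obtain M :: "nat set" and m0 upd out where M: "finite M" "m0 \<in> M" "\<forall>m\<in>M. \<forall>v. upd m v \<in> M"
    "\<forall>h. at_player x i h \<longrightarrow> \<sigma> h = out (foldl upd m0 (butlast h)) (last h)"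
    unfolding is_finstate_def by blast
  \<comment> \<open>The second memory component is the length of the part of \<open>g\<close> read so far,
     or \<open>Suc n\<close> once the history has left \<open>g\<close>.\<close>
  define nx where "nx = (\<lambda>k v. if k < n \<and> g ! k = v then Suc k else Suc n)"
  define upd' where "upd' = (\<lambda>m v. prod_encode (upd (fst (prod_decode m)) v, nx (snd (prod_decode m)) v))"
  define out' where "out' = (\<lambda>m v. if snd (prod_decode m) = n \<and> v = a then d else out (fst (prod_decode m)) v)"
  define M' where "M' = prod_encode ` (M \<times> {..Suc n})"
  have fold: "foldl upd' (prod_encode (m0, 0)) h
      = prod_encode (foldl upd m0 h, if \<exists>l. g = h @ l then length h else Suc n)" for h
  proof (induction h rule: rev_induct)
    case (snoc v h)
    have "nx (if \<exists>l. g = h @ l then length h else Suc n) v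
       = (if \<exists>l. g = (h @ [v]) @ l then length (h @ [v]) else Suc n)"
    proof (cases "\<exists>l. g = h @ l")
      case True
      then obtain l where l: "g = h @ l" by blast
      then show ?thesis
        by (cases l) (auto simp: nx_def n_def nth_append)
    next
      case False
      then have "\<nexists>l. g = (h @ [v]) @ l" by auto
      then show ?thesis using False by (simp add: nx_def)
    qed
    moreover have "foldl upd' (prod_encode (m0, 0)) (h @ [v]) = upd' (foldl upd' (prod_encode (m0, 0)) h) v"
      by simp
    ultimately show ?case by (simp only: snoc) (simp add: upd'_def)
  qed simp
  have key: "(if \<exists>l. g = h @ l then length h else Suc n) = n \<longleftrightarrow> h = g" for h
    by (auto simp: n_def)
  have "(\<sigma>(h0 := d)) h = out' (foldl upd' (prod_encode (m0, 0)) (butlast h)) (last h)"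
    if h: "at_player x i h" for h
  proof -
    have "h \<noteq> []" using h by (simp add: at_player_def)
    then have "h = h0 \<longleftrightarrow> butlast h = g \<and> last h = a"
      unfolding h0 by (metis append_butlast_last_id butlast_snoc last_snoc)
    then show ?thesis using M(4) h key[of "butlast h"] by (simp add: fold out'_def)
  qed
  moreover have "finite M'" "prod_encode (m0, 0) \<in> M'" "\<forall>m\<in>M'. \<forall>v. upd' m v \<in> M'"
    using M by (auto simp: M'_def upd'_def nx_def)
  ultimately show ?thesis unfolding is_finstate_def
    by (intro exI[of _ M'] exI[of _ "prod_encode (m0, 0)"] exI[of _ upd'] exI[of _ out']) simp
qed

text \<open>Induction over the exceptional histories, starting from the memoryless strategy
  \<open>d\<close>. In this way the constructed equilibrium strategy is finite-state without an
  explicit automaton.\<close>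

lemma is_finstate_if_finite_diff:
  assumes "finite {h. \<sigma> h \<noteq> d (last h)}"
  shows "is_finstate x i \<sigma>"
proof -
  have "is_finstate x i \<sigma>" if "finite A" "{h. \<sigma> h \<noteq> d (last h)} \<subseteq> A" for A
    using that
  proof (induction A arbitrary: \<sigma> rule: finite_induct)
    case empty
    then have "\<sigma> h = d (last h)" for h by blast
    then show ?case unfolding is_finstate_def
      by (intro exI[of _ "{0}"] exI[of _ 0] exI[of _ "\<lambda>_ _. 0"] exI[of _ "\<lambda>_. d"]) auto
  next
    case (insert h0 A)
    have "is_finstate x i ((\<sigma>(h0 := d (last h0)))(h0 := \<sigma> h0))"
      using insert.prems by (intro is_finstate_fun_upd insert.IH) auto
    then show ?case by simp
  qed
  then show ?thesis using assms by blast
qed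

lemma in_class_fun_upd:
  assumes "in_class x i c \<sigma>"
  shows "in_class x i c (\<sigma>(h := return_pmf w))"
  using assms by (cases c) (auto simp: is_finstate_fun_upd is_pure_def)

lemma valid_profile_deviate:
  assumes "valid_profile x \<sigma>s" "w \<in> nxt x (last h)"
  shows "valid_profile x (deviate \<sigma>s i h w)"
  using assms unfolding valid_profile_def valid_strat_def deviate_def by auto

text \<open>A history of positive probability passes a positive share of any local gain on to the
  payoff, so a better move at \<open>h\<close> would be a profitable deviation, available in each of
  the four classes. After the move the deviating profile acts like the original one, which is why
  the conclusion speaks about \<open>\<sigma>s\<close> alone.\<close>

lemma NE_no_gain:
  assumes vp: "valid_profile x \<sigma>s" and ne: "is_0NE x c \<sigma>s"
    and cls: "in_class x i c (\<sigma>s i)"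
    and i: "i \<in> {1..np x}" and h: "h = v0 x # l" "set h \<subseteq> {..<nv x}" "0 < hist_prob x \<sigma>s h"
    and F: "\<forall>v\<in>set h. v \<notin> target x i"
    and own: "own x ! last h = Suc i" and w: "w \<in> nxt x (last h)"
  shows "reach_val x \<sigma>s (target x i) (h @ [w]) \<le> reach_val x \<sigma>s (target x i) h"
proof -
  let ?F = "target x i" and ?\<sigma> = "deviate \<sigma>s i h w"
  have vp': "valid_profile x ?\<sigma>" using valid_profile_deviate[OF vp w] .
  have h0: "h \<noteq> []" "last h < nv x" using h by (auto simp: subset_iff split: if_splits)
  have wn: "w < nv x" using nxt_player_subset[of x "last h"] vp w own by (auto simp: valid_profile_def)
  have "valid_strat x i (?\<sigma> i)" using vp' i by (simp add: valid_profile_def)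
  moreover have "in_class x i c (?\<sigma> i)"
    using in_class_fun_upd[OF cls] by (simp add: deviate_def)
  ultimately have "Pay x (\<sigma>s(i := ?\<sigma> i)) i \<le> Pay x \<sigma>s i"
    using ne i unfolding is_0NE_def by blast
  then have "reach_val x ?\<sigma> ?F [v0 x] - reach_val x \<sigma>s ?F [v0 x] \<le> 0"
    using Pay_eq_reach_val[OF vp] Pay_eq_reach_val[OF vp'] by (simp add: deviate_def)
  then have "path_prob x \<sigma>s [v0 x] l * (reach_val x ?\<sigma> ?F h - reach_val x \<sigma>s ?F h) \<le> 0"
    using reach_val_deviate_diff[OF vp, of i "[v0 x]" l w ?F] vp' h F by simp
  moreover have "0 < path_prob x \<sigma>s [v0 x] l"
    using h(3) hist_prob_append[of "[v0 x]" x \<sigma>s l] h(1) by (simp add: hist_prob_def)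
  ultimately have le: "reach_val x ?\<sigma> ?F h \<le> reach_val x \<sigma>s ?F h"
    by (simp add: mult_le_0_iff)
  have st: "step x ?\<sigma> h u = (if u = w then 1 else 0)" for u
    using own by (simp add: step_def deviate_def)
  have "reach_val x ?\<sigma> ?F h = (\<Sum>u<nv x. (if u = w then 1 else 0) * reach_val x ?\<sigma> ?F (h @ [u]))"
    using reach_val_unfold[OF vp' h0, of ?F] F h0 by (simp add: st)
  also have "\<dots> = reach_val x ?\<sigma> ?F (h @ [w])"
    using wn by (simp add: if_distrib[of "\<lambda>b. b * _"] cong: if_cong)
  also have "\<dots> = reach_val x \<sigma>s ?F (h @ [w])"
    by (intro reach_val_deviate_incomparable) auto
  finally show ?thesis using le by simp
qed

section \<open>Recursive functions\<close>

definition computable1 :: "(nat \<Rightarrow> nat) \<Rightarrow> bool" where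
  "computable1 F \<longleftrightarrow> (\<exists>f. \<forall>a. eval f [a] (F a))"

definition computable2 :: "(nat \<Rightarrow> nat \<Rightarrow> nat) \<Rightarrow> bool" where
  "computable2 F \<longleftrightarrow> (\<exists>f. \<forall>a b. eval f [a, b] (F a b))"

lemma computable1_id: "computable1 (\<lambda>a. a)"
proof -
  have "eval (Id 0) [a] a" for a using eval_Id[of 0 "[a]"] by simp
  then show ?thesis unfolding computable1_def by blast
qed

lemma computable2_fst: "computable2 (\<lambda>a b. a)"
proof -
  have "eval (Id 0) [a, b] a" for a b using eval_Id[of 0 "[a, b]"] by simp
  then show ?thesis unfolding computable2_def by blast
qed

lemma computable2_snd: "computable2 (\<lambda>a b. b)"
proof -
  have "eval (Id 1) [a, b] b" for a b using eval_Id[of 1 "[a, b]"] by simp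
  then show ?thesis unfolding computable2_def by blast
qed

lemma computable1_0: "computable1 (\<lambda>a. 0)"
  unfolding computable1_def using eval_Z by blast

lemma computable1_Suc: "computable1 Suc"
  unfolding computable1_def using eval_S by blast

lemma computable1_comp:
  assumes "computable1 F" "computable1 G"
  shows "computable1 (\<lambda>a. F (G a))"
proof -
  from assms obtain f g where "\<forall>a. eval f [a] (F a)" "\<forall>a. eval g [a] (G a)"
    unfolding computable1_def by blast
  then have "eval (Cn f [g]) [a] (F (G a))" for a
    by (intro eval_Cn[of _ _ "[G a]"]) auto
  then show ?thesis unfolding computable1_def by blast
qed

lemma computable1_comp2:
  assumes "computable2 F" "computable1 G" "computable1 H"
  shows "computable1 (\<lambda>a. F (G a) (H a))"
proof -
  from assms obtain f g h where "\<forall>a b. eval f [a, b] (F a b)" "\<forall>a. eval g [a] (G a)" "\<forall>a. eval h [a] (H a)"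
    unfolding computable1_def computable2_def by blast
  then have "eval (Cn f [g, h]) [a] (F (G a) (H a))" for a
    by (intro eval_Cn[of _ _ "[G a, H a]"]) auto
  then show ?thesis unfolding computable1_def by blast
qed

lemma computable2_comp1:
  assumes "computable1 F" "computable2 G"
  shows "computable2 (\<lambda>a b. F (G a b))"
proof -
  from assms obtain f g where "\<forall>a. eval f [a] (F a)" "\<forall>a b. eval g [a, b] (G a b)"
    unfolding computable1_def computable2_def by blast
  then have "eval (Cn f [g]) [a, b] (F (G a b))" for a b
    by (intro eval_Cn[of _ _ "[G a b]"]) auto
  then show ?thesis unfolding computable2_def by blast
qed

lemma computable2_comp:
  assumes "computable2 F" "computable2 G" "computable2 H"
  shows "computable2 (\<lambda>a b. F (G a b) (H a b))"
proof -
  from assms obtain f g h where "\<forall>a b. eval f [a, b] (F a b)" "\<forall>a b. eval g [a, b] (G a b)"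
    "\<forall>a b. eval h [a, b] (H a b)"
    unfolding computable2_def by blast
  then have "eval (Cn f [g, h]) [a, b] (F (G a b) (H a b))" for a b
    by (intro eval_Cn[of _ _ "[G a b, H a b]"]) auto
  then show ?thesis unfolding computable2_def by blast
qed

lemma computable1_rec:
  assumes "computable2 G" "F 0 = c" "\<And>n. F (Suc n) = G (F n) n" "computable1 (\<lambda>_. c)"
  shows "computable1 F"
proof -
  from assms(1) obtain g where g: "\<forall>a b. eval g [a, b] (G a b)" unfolding computable2_def by blast
  from assms(4) obtain k where k: "\<forall>a. eval k [a] c" unfolding computable1_def by blast
  have pr: "eval (Pr (Cn k [Z]) g) [n] (F n)" for n
  proof (induction n)
    case 0
    \<comment> \<open>Without parameters, the base case of \<open>Pr\<close> is evaluated on the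
      empty list, while \<open>k\<close> is only known on lists of length one; \<open>Z\<close>
      supplies the argument.\<close>
    have "eval (Cn k [Z]) [] c" using k by (intro eval_Cn[of _ _ "[0]"]) (auto intro: eval_Z)
    then show ?case using assms(2) by (simp add: eval_Pr0)
  next
    case (Suc n)
    then show ?case unfolding assms(3) using g by (intro eval_PrS[of _ _ n "[]" "F n"]) auto
  qed
  then show ?thesis unfolding computable1_def by blast
qed

lemma computable2_rec:
  assumes "computable1 G" "computable1 H" "\<And>b. F 0 b = H b" "\<And>n b. F (Suc n) b = G (F n b)"
  shows "computable2 F"
proof -
  from assms(1,2) obtain g h where g: "\<forall>a. eval g [a] (G a)" and h: "\<forall>a. eval h [a] (H a)"
    unfolding computable1_def by blast
  have pr: "eval (Pr h (Cn g [Id 0])) [n, b] (F n b)" for n b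
  proof (induction n)
    case 0
    then show ?case using assms(3) h by (simp add: eval_Pr0)
  next
    case (Suc n)
    have "eval (Cn g [Id 0]) [F n b, n, b] (F (Suc n) b)"
      using g eval_Id[of 0 "[F n b, n, b]"] assms(4) by (intro eval_Cn[of _ _ "[F n b]"]) auto
    then show ?case using Suc by (rule eval_PrS[rotated])
  qed
  then show ?thesis unfolding computable2_def by blast
qed

lemma computable1_least:
  assumes "computable2 F" "\<And>a. \<exists>k. F k a = 0"
  shows "computable1 (\<lambda>a. LEAST k. F k a = 0)"
proof -
  from assms(1) obtain f where f: "\<forall>a b. eval f [a, b] (F a b)" unfolding computable2_def by blast
  have "eval (Mn f) [a] (LEAST k. F k a = 0)" for a
  proof (rule eval_Mn)
    have "F (LEAST k. F k a = 0) a = 0" using assms(2) by (rule LeastI_ex)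
    then show "eval f [LEAST k. F k a = 0, a] 0" using f by metis
    show "\<forall>k<LEAST k. F k a = 0. \<exists>m>0. eval f [k, a] m"
      using f not_less_Least by (metis (mono_tags, lifting) neq0_conv)
  qed
  then show ?thesis unfolding computable1_def by blast
qed

lemma computable2_add: "computable2 (+)"
  by (rule computable2_rec[OF computable1_Suc computable1_id]) auto

lemma computable1_pred: "computable1 (\<lambda>n. n - 1)"
  by (rule computable1_rec[OF computable2_snd _ _ computable1_0]) auto

lemma computable2_sub: "computable2 (\<lambda>a b. a - b)"
proof -
  \<comment> \<open>Recursion runs on the first argument, so the subtrahend comes first
    here.\<close>
  have "computable2 (\<lambda>a b. b - a)"
    by (rule computable2_rec[OF computable1_pred computable1_id]) auto
  from computable2_comp[OF this computable2_snd computable2_fst] show ?thesis .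
qed

lemma computable1_pow2: "computable1 (\<lambda>n. 2 ^ n)"
proof (rule computable1_rec)
  show "computable2 (\<lambda>r n. r + r)"
    by (rule computable2_comp[OF computable2_add computable2_fst computable2_fst])
  show "computable1 (\<lambda>_. Suc 0)" by (rule computable1_comp[OF computable1_Suc computable1_0])
qed auto

section \<open>The pairing function and its inverse\<close>

lemma computable1_triangle: "computable1 triangle"
proof (rule computable1_rec)
  show "computable2 (\<lambda>r n. r + Suc n)"
    by (rule computable2_comp[OF computable2_add computable2_fst computable2_comp1[OF computable1_Suc computable2_snd]])
qed (auto intro: computable1_0)

lemma computable2_prod_encode: "computable2 (\<lambda>a b. prod_encode (a, b))"
  unfolding prod_encode_def prod.case
  by (rule computable2_comp[OF computable2_add
        computable2_comp1[OF computable1_triangle computable2_add] computable2_fst])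

text \<open>Since \<open>prod_encode (a, b)\<close> is \<open>triangle (a + b) + a\<close>, the
  largest triangular number not above a code determines \<open>a + b\<close>. The truncated
  difference is 0 exactly if \<open>z < triangle (Suc k)\<close>.\<close>

definition triangle_root :: "nat \<Rightarrow> nat" where
  "triangle_root z = (LEAST k. Suc z - triangle (Suc k) = 0)"

lemma triangle_mono: "m \<le> n \<Longrightarrow> triangle m \<le> triangle n"
  by (induction n) (auto simp: le_Suc_eq)

lemma le_triangle: "n \<le> triangle n"
  by (induction n) auto

lemma triangle_root_prod_encode: "triangle_root (prod_encode (a, b)) = a + b"
  unfolding triangle_root_def
proof (rule Least_equality)
  show "Suc (prod_encode (a, b)) - triangle (Suc (a + b)) = 0" by (simp add: prod_encode_def)
next
  fix k assume k: "Suc (prod_encode (a, b)) - triangle (Suc k) = 0"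
  show "a + b \<le> k"
  proof (rule ccontr)
    assume "\<not> a + b \<le> k"
    then have "triangle (Suc k) \<le> triangle (a + b)" by (intro triangle_mono) simp
    then show False using k unfolding prod_encode_def by simp
  qed
qed

lemma computable1_triangle_root: "computable1 triangle_root"
  unfolding triangle_root_def
proof (rule computable1_least)
  show "computable2 (\<lambda>k z. Suc z - triangle (Suc k))"
    by (rule computable2_comp[OF computable2_sub computable2_comp1[OF computable1_Suc computable2_snd]
          computable2_comp1[OF computable1_triangle computable2_comp1[OF computable1_Suc computable2_fst]]])
  show "\<exists>k. Suc z - triangle (Suc k) = 0" for z
    using le_triangle[of "Suc z"] by (intro exI[of _ z]) simp
qed

lemma computable1_prod_decode_fst: "computable1 (\<lambda>z. fst (prod_decode z))"
proof -
  have "fst (prod_decode z) = z - triangle (triangle_root z)" for z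
  proof -
    obtain a b where "z = prod_encode (a, b)" by (metis prod.exhaust prod_decode_inverse)
    then show ?thesis by (simp add: triangle_root_prod_encode) (simp add: prod_encode_def)
  qed
  then show ?thesis
    using computable1_comp2[OF computable2_sub computable1_id
        computable1_comp[OF computable1_triangle computable1_triangle_root]] by simp
qed

lemma computable1_prod_decode_snd: "computable1 (\<lambda>z. snd (prod_decode z))"
proof -
  have "snd (prod_decode z) = triangle_root z - fst (prod_decode z)" for z
  proof -
    obtain a b where "z = prod_encode (a, b)" by (metis prod.exhaust prod_decode_inverse)
    then show ?thesis by (simp add: triangle_root_prod_encode)
  qed
  then show ?thesis
    using computable1_comp2[OF computable2_sub computable1_triangle_root computable1_prod_decode_fst] by simp
qed

text \<open>No \<open>Suc\<close> as in \<open>list_encode\<close>: the number of entries is fixed,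
  so the end never has to be recognised and \<open>prod_decode\<close> alone finds the
  components.\<close>

definition template_code :: "nat list \<Rightarrow> nat" where
  "template_code zs = foldr (\<lambda>a b. prod_encode (a, b)) zs 0"

lemma computable1_template_nth:
  assumes "i < n"
  shows "\<exists>G. computable1 G \<and> (\<forall>zs. length zs = n \<longrightarrow> G (template_code zs) = zs ! i)"
  using assms
proof (induction n arbitrary: i)
  case (Suc n)
  show ?case
  proof (cases i)
    case 0
    have "fst (prod_decode (template_code zs)) = zs ! i" if "length zs = Suc n" for zs
      using that 0 by (cases zs) (auto simp: template_code_def)
    then show ?thesis using computable1_prod_decode_fst by blast
  next
    case (Suc k)
    then obtain G where G: "computable1 G" "\<forall>zs. length zs = n \<longrightarrow> G (template_code zs) = zs ! k"
      using Suc.IH Suc.prems by (metis Suc_less_SucD)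
    have "G (snd (prod_decode (template_code zs))) = zs ! i" if "length zs = Suc n" for zs
      using that Suc G(2) by (cases zs) (auto simp: template_code_def)
    then show ?thesis using computable1_comp[OF G(1) computable1_prod_decode_snd] by blast
  qed
qed simp

lemma computable1_cons:
  assumes "computable1 F" "computable1 G"
  shows "computable1 (\<lambda>a. Suc (prod_encode (F a, G a)))"
  by (rule computable1_comp[OF computable1_Suc computable1_comp2[OF computable2_prod_encode assms]])

lemma computable1_const: "computable1 (\<lambda>_. c)"
proof (induction c)
  case (Suc c)
  then show ?case by (rule computable1_comp[OF computable1_Suc])
qed (rule computable1_0)

text \<open>The instance obtained by putting the two nature edges \<open>(0, 1, 1, 2^t)\<close> and
  \<open>(0, 2, 2^t - 1, 2^t)\<close> in front of the nature edges of a template.\<close>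

definition enc_inst_with :: "nat list \<Rightarrow> nat \<Rightarrow> nat" where
  "enc_inst_with zs t = Suc (prod_encode (zs ! 0, Suc (prod_encode (zs ! 1, Suc (prod_encode (zs ! 2,
     Suc (prod_encode (zs ! 3, Suc (prod_encode (
       Suc (prod_encode (list_encode [0, 1, 1, 2 ^ t],
         Suc (prod_encode (list_encode [0, 2, 2 ^ t - 1, 2 ^ t], zs ! 4)))), zs ! 5))))))))))"

text \<open>The diagonal step: \<open>zs\<close> serves as the template and, through its code, as
  the input inserted into it. Composed with \<open>D\<close>, the supposed decision procedure asks
  about the game whose template and whose input are both given by its own argument.\<close>

lemma self_application_computable:
  "\<exists>D. \<forall>zs. length zs = 6 \<longrightarrow>
    eval D [template_code zs] (enc_inst_with zs (template_code zs))"
proof -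
  have "\<forall>i. \<exists>G. i < 6 \<longrightarrow> computable1 G \<and> (\<forall>zs. length zs = 6 \<longrightarrow> G (template_code zs) = zs ! i)"
    using computable1_template_nth by blast
  then obtain G where G: "\<And>i. i < 6 \<Longrightarrow> computable1 (G i)"
    "\<And>i zs. i < 6 \<Longrightarrow> length zs = 6 \<Longrightarrow> G i (template_code zs) = zs ! i"
    by metis
  let ?H = "\<lambda>t. Suc (prod_encode (G 0 t, Suc (prod_encode (G 1 t, Suc (prod_encode (G 2 t,
     Suc (prod_encode (G 3 t, Suc (prod_encode (
       Suc (prod_encode (list_encode [0, 1, 1, 2 ^ t],
         Suc (prod_encode (list_encode [0, 2, 2 ^ t - 1, 2 ^ t], G 4 t)))), G 5 t))))))))))"
  have "computable1 (\<lambda>t. (2 ^ t) - (1::nat))"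
    by (rule computable1_comp[OF computable1_pred computable1_pow2])
  then have "computable1 ?H"
    by (simp only: list_encode.simps,
        intro computable1_cons G computable1_const computable1_pow2 computable1_0) simp_all
  then obtain D where "\<forall>t. eval D [t] (?H t)" unfolding computable1_def by blast
  moreover have "?H (template_code zs) = enc_inst_with zs (template_code zs)" if "length zs = 6" for zs
    using G(2)[of _ zs] that by (simp add: enc_inst_with_def)
  ultimately show ?thesis by metis
qed

section \<open>A register machine\<close>

datatype op = Keep | Inc | Dec | Zero | AssertZ

text \<open>\<open>Instr d s o b l l'\<close> assigns \<open>o\<close> of register \<open>s\<close> to register \<open>d\<close> and then jumps
  to \<open>l\<close> if register \<open>b\<close> is zero and to \<open>l'\<close> otherwise.\<close>

datatype instr = Instr (idst: nat) (isrc: nat) (iop: op) (ibr: nat) (ilz: nat) (ilnz: nat)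

fun app_op :: "op \<Rightarrow> nat \<Rightarrow> nat" where
  "app_op Keep n = n"
| "app_op Inc n = Suc n"
| "app_op Dec n = n - 1"
| "app_op Zero n = 0"
| "app_op AssertZ n = n"

type_synonym config = "nat \<times> (nat \<Rightarrow> nat)"

definition exec1 :: "instr list \<Rightarrow> config \<Rightarrow> config" where
  "exec1 P c = (let I = P ! fst c; \<rho> = (snd c)(idst I := app_op (iop I) (snd c (isrc I)))
     in (if \<rho> (ibr I) = 0 then ilz I else ilnz I, \<rho>))"

text \<open>The side conditions say when the encoded new value stays in the unit interval: for
  \<open>x = 1 / 2 ^ n\<close>, the values \<open>2 * x\<close> of \<open>Dec\<close> and
  \<open>2 - x\<close> of \<open>AssertZ\<close> are at most 1 exactly if \<open>n > 0\<close> and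
  \<open>n = 0\<close>, respectively.\<close>

definition legal :: "instr list \<Rightarrow> config \<Rightarrow> bool" where
  "legal P c \<longleftrightarrow> fst c < length P \<and>
     (iop (P ! fst c) = Dec \<longrightarrow> snd c (isrc (P ! fst c)) \<noteq> 0) \<and>
     (iop (P ! fst c) = AssertZ \<longrightarrow> snd c (isrc (P ! fst c)) = 0)"

abbreviation leads :: "instr list \<Rightarrow> config \<Rightarrow> config \<Rightarrow> bool" where
  "leads P \<equiv> (\<lambda>c c'. legal P c \<and> c' = exec1 P c)\<^sup>*\<^sup>*"

lemma leads_step: "legal P c \<Longrightarrow> leads P (exec1 P c) c' \<Longrightarrow> leads P c c'"
  by (rule converse_rtranclp_into_rtranclp) auto

lemma leads_iterate:
  assumes "leads P c c'"
  shows "\<exists>k. (exec1 P ^^ k) c = c' \<and> (\<forall>i<k. legal P ((exec1 P ^^ i) c))"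
  using assms
proof (induction rule: rtranclp_induct)
  case base
  then show ?case by (intro exI[of _ 0]) simp
next
  case (step c1 c2)
  then obtain k where "(exec1 P ^^ k) c = c1" "\<forall>i<k. legal P ((exec1 P ^^ i) c)" by blast
  then show ?case using step by (intro exI[of _ "Suc k"]) (auto simp: less_Suc_eq)
qed

section \<open>Program fragments and their execution\<close>

definition placed :: "instr list \<Rightarrow> nat \<Rightarrow> instr list \<Rightarrow> bool" where
  "placed P off C \<longleftrightarrow> (\<forall>k<length C. off + k < length P \<and> P ! (off + k) = C ! k)"

lemma placed_append: "placed P off (C @ C') \<longleftrightarrow> placed P off C \<and> placed P (off + length C) C'"
proof
  assume pl: "placed P off (C @ C')"
  have "off + k < length P \<and> P ! (off + k) = C ! k" if "k < length C" for k
    using pl[unfolded placed_def, rule_format, of k] that by (simp add: nth_append)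
  moreover have "off + length C + k < length P \<and> P ! (off + length C + k) = C' ! k" if "k < length C'" for k
    using pl[unfolded placed_def, rule_format, of "length C + k"] that by (simp add: add.assoc)
  ultimately show "placed P off C \<and> placed P (off + length C) C'" by (simp add: placed_def)
next
  assume pl: "placed P off C \<and> placed P (off + length C) C'"
  show "placed P off (C @ C')" unfolding placed_def
  proof (intro allI impI)
    fix k assume k: "k < length (C @ C')"
    show "off + k < length P \<and> P ! (off + k) = (C @ C') ! k"
    proof (cases "k < length C")
      case True
      then show ?thesis using pl by (simp add: placed_def nth_append)
    next
      case False
      define m where "m = k - length C"
      have m: "k = length C + m" using False m_def by simp
      have "m < length C'" using k m by simp
      then show ?thesis using pl[THEN conjunct2, unfolded placed_def, rule_format, of m]
        by (simp add: m add.assoc)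
    qed
  qed
qed

lemma placed_Cons: "placed P off (I # C) \<longleftrightarrow> off < length P \<and> P ! off = I \<and> placed P (Suc off) C"
  using placed_append[of P off "[I]" C] by (simp add: placed_def)

lemma placed_Nil: "placed P off []"
  by (simp add: placed_def)

abbreviation mov :: "nat \<Rightarrow> nat \<Rightarrow> op \<Rightarrow> nat \<Rightarrow> instr" where
  "mov d s o' l \<equiv> Instr d s o' 0 l l"

text \<open>A branch is trusted only because its targets check it: the zero side asserts zero, the
  other side decrements. In an equilibrium neither instruction can be performed on the wrong
  contents, and this is what decides the branch.\<close>

definition branch_code :: "nat \<Rightarrow> nat \<Rightarrow> nat \<Rightarrow> nat \<Rightarrow> instr list" where
  "branch_code r off l l' = [Instr r r Keep r (Suc off) (Suc (Suc off)), mov r r AssertZ l, mov r r Dec l']"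

lemma length_branch_code [simp]: "length (branch_code r off l l') = 3"
  by (simp add: branch_code_def)

lemma leads_mov:
  assumes "placed P pc (mov d s o' l # C)" "o' \<noteq> Dec" "o' \<noteq> AssertZ"
    and "leads P (l, \<rho>(d := app_op o' (\<rho> s))) c"
  shows "leads P (pc, \<rho>) c"
proof (rule leads_step)
  show "legal P (pc, \<rho>)" using assms by (simp add: legal_def placed_Cons)
  show "leads P (exec1 P (pc, \<rho>)) c" using assms by (simp add: exec1_def placed_Cons Let_def)
qed

lemma leads_test_zero:
  assumes "placed P off (branch_code r off l l' @ C)" "\<rho> r = 0" "leads P (l, \<rho>) c"
  shows "leads P (off, \<rho>) c"
proof (rule leads_step)
  have pl: "off < length P" "P ! off = Instr r r Keep r (Suc off) (Suc (Suc off))"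
    "Suc off < length P" "P ! Suc off = mov r r AssertZ l"
    using assms(1) by (auto simp: placed_Cons branch_code_def)
  show "legal P (off, \<rho>)" using pl by (simp add: legal_def)
  have e: "exec1 P (off, \<rho>) = (Suc off, \<rho>)" using pl assms(2) by (simp add: exec1_def Let_def fun_upd_idem)
  have e': "exec1 P (Suc off, \<rho>) = (l, \<rho>)" using pl assms(2) by (simp add: exec1_def Let_def fun_upd_idem)
  have "legal P (Suc off, \<rho>)" using pl assms(2) by (simp add: legal_def)
  then show "leads P (exec1 P (off, \<rho>)) c" unfolding e
    by (rule leads_step) (simp only: e' assms)
qed

lemma leads_test_nonzero:
  assumes "placed P off (branch_code r off l l' @ C)" "\<rho> r \<noteq> 0" "leads P (l', \<rho>(r := \<rho> r - 1)) c"
  shows "leads P (off, \<rho>) c"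
proof (rule leads_step)
  have pl: "off < length P" "P ! off = Instr r r Keep r (Suc off) (Suc (Suc off))"
    "Suc (Suc off) < length P" "P ! Suc (Suc off) = mov r r Dec l'"
    using assms(1) by (auto simp: placed_Cons branch_code_def)
  show "legal P (off, \<rho>)" using pl by (simp add: legal_def)
  have e: "exec1 P (off, \<rho>) = (Suc (Suc off), \<rho>)" using pl assms(2) by (simp add: exec1_def Let_def fun_upd_idem)
  have e': "exec1 P (Suc (Suc off), \<rho>) = (l', \<rho>(r := \<rho> r - 1))" using pl by (simp add: exec1_def Let_def)
  have "legal P (Suc (Suc off), \<rho>)" using pl assms(2) by (simp add: legal_def)
  then show "leads P (exec1 P (off, \<rho>)) c" unfolding e
    by (rule leads_step) (simp only: e' assms)
qed

text \<open>\<open>code f as out base off\<close> reads its arguments from the registers \<open>as\<close>, writes the result to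
  \<open>out\<close>, uses registers from \<open>base\<close> on as scratch space and is meant to be placed at \<open>off\<close>.\<close>

fun code :: "recf \<Rightarrow> nat list \<Rightarrow> nat \<Rightarrow> nat \<Rightarrow> nat \<Rightarrow> instr list"
and codes :: "recf list \<Rightarrow> nat list \<Rightarrow> nat \<Rightarrow> nat \<Rightarrow> nat \<Rightarrow> instr list" where
  "code Z as out base off = [mov out out Zero (Suc off)]"
| "code S as out base off = [mov out (hd as) Inc (Suc off)]"
| "code (Id i) as out base off = [mov out (as ! i) Keep (Suc off)]"
| "code (Cn f gs) as out base off =
    (let n = length gs; C = codes gs as base (base + n) off
     in C @ code f [base..<base + n] out (base + n) (off + length C))"
| "code (Pr f g) as out base off =
    (let C = code f (tl as) (base + 1) (base + 4) (off + 2);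
         L = off + 2 + length C;
         C' = code g ((base + 1) # base # tl as) (base + 3) (base + 4) (L + 3);
         E = L + 3 + length C'
     in [mov (base + 2) (hd as) Keep (off + 1), mov base base Zero (off + 2)] @ C
        @ branch_code (base + 2) L (E + 2) (L + 3) @ C'
        @ [mov (base + 1) (base + 3) Keep (E + 1), mov base base Inc L, mov out (base + 1) Keep (E + 3)])"
| "code (Mn f) as out base off =
    (let L = off + 1;
         C = code f (base # as) (base + 1) (base + 2) L;
         T = L + length C
     in [mov base base Zero L] @ C @ branch_code (base + 1) T (T + 4) (T + 3)
        @ [mov base base Inc L, mov out base Keep (T + 5)])"
| "codes [] as out base off = []"
| "codes (g # gs) as out base off =
    (let C = code g as out base off in C @ codes gs as (Suc out) base (off + length C))"

text \<open>Registers below \<open>base\<close> other than \<open>out\<close> form the frame that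
  survives. Nothing is assumed about the scratch registers on entry, so a fragment may be entered
  again inside a loop.\<close>

definition compiled :: "recf \<Rightarrow> bool" where
  "compiled f \<longleftrightarrow> (\<forall>as out base off P \<rho> z. eval f (map \<rho> as) z \<longrightarrow> (\<forall>a\<in>set as. a < base) \<longrightarrow> out < base \<longrightarrow>
     placed P off (code f as out base off) \<longrightarrow>
     (\<exists>\<rho>'. leads P (off, \<rho>) (off + length (code f as out base off), \<rho>') \<and> \<rho>' out = z \<and>
       (\<forall>r<base. r \<noteq> out \<longrightarrow> \<rho>' r = \<rho> r)))"

lemma compiledI:
  assumes "\<And>as out base off P \<rho> z. eval f (map \<rho> as) z \<Longrightarrow> \<forall>a\<in>set as. a < base \<Longrightarrow> out < base \<Longrightarrow>
     placed P off (code f as out base off) \<Longrightarrow>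
     \<exists>\<rho>'. leads P (off, \<rho>) (off + length (code f as out base off), \<rho>') \<and> \<rho>' out = z \<and>
       (\<forall>r<base. r \<noteq> out \<longrightarrow> \<rho>' r = \<rho> r)"
  shows "compiled f"
  using assms unfolding compiled_def by blast

lemma compiledD:
  assumes "compiled f" "eval f (map \<rho> as) z" "\<forall>a\<in>set as. a < base" "out < base"
    "C = code f as out base off" "placed P off C" "e = off + length C"
  shows "\<exists>\<rho>'. leads P (off, \<rho>) (e, \<rho>') \<and> \<rho>' out = z \<and> (\<forall>r<base. r \<noteq> out \<longrightarrow> \<rho>' r = \<rho> r)"
  using assms unfolding compiled_def by blast

lemma codes_leads:
  assumes "\<forall>g\<in>set gs. compiled g" "list_all2 (eval' xs) gs ys" "eval' = (\<lambda>xs g y. eval g xs y)"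
    "map \<rho> as = xs" "\<forall>a\<in>set as. a < b" "b + length gs \<le> base" "placed P off (codes gs as b base off)"
  shows "\<exists>\<rho>'. leads P (off, \<rho>) (off + length (codes gs as b base off), \<rho>') \<and>
    map \<rho>' [b..<b + length gs] = ys \<and> (\<forall>r<b. \<rho>' r = \<rho> r)"
  using assms
proof (induction gs arbitrary: ys b off \<rho>)
  case Nil
  then show ?case by (intro exI[of _ \<rho>]) auto
next
  case (Cons g gs)
  obtain y ys' where ys: "ys = y # ys'" "eval g xs y" "list_all2 (eval' xs) gs ys'"
    using Cons.prems by (auto simp: list_all2_Cons1)
  let ?C = "code g as b base off"
  have pl: "placed P off ?C" "placed P (off + length ?C) (codes gs as (Suc b) base (off + length ?C))"
    using Cons.prems by (auto simp: Let_def placed_append)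
  have g: "compiled g" "eval g (map \<rho> as) y" "\<forall>a\<in>set as. a < base" "b < base"
    using Cons.prems ys by force+
  obtain \<rho>1 where r1: "leads P (off, \<rho>) (off + length ?C, \<rho>1)" "\<rho>1 b = y"
    "\<forall>r<base. r \<noteq> b \<longrightarrow> \<rho>1 r = \<rho> r"
    using compiledD[OF g refl pl(1) refl] by blast
  have "map \<rho>1 as = map \<rho> as" using Cons.prems(5,6) r1(3) by (auto intro!: map_cong)
  then have "map \<rho>1 as = xs" using Cons.prems by simp
  moreover have "\<forall>a\<in>set as. a < Suc b" using Cons.prems by auto
  moreover have "Suc b + length gs \<le> base" using Cons.prems by simp
  moreover have "\<forall>g\<in>set gs. compiled g" using Cons.prems by simp
  ultimately obtain \<rho>2 where r2:
    "leads P (off + length ?C, \<rho>1) (off + length ?C + length (codes gs as (Suc b) base (off + length ?C)), \<rho>2)"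
    "map \<rho>2 [Suc b..<Suc b + length gs] = ys'" "\<forall>r<Suc b. \<rho>2 r = \<rho>1 r"
    using Cons.IH[of ys' \<rho>1 "Suc b" "off + length ?C"] ys(3) Cons.prems(3) pl(2) by blast
  have "leads P (off, \<rho>) (off + length (codes (g # gs) as b base off), \<rho>2)"
    using rtranclp_trans[OF r1(1) r2(1)] by (simp add: Let_def add.assoc)
  moreover have "map \<rho>2 [b..<b + length (g # gs)] = ys"
  proof -
    have "[b..<b + length (g # gs)] = b # [Suc b..<Suc b + length gs]" by (simp add: upt_conv_Cons del: upt_Suc)
    then show ?thesis using r2(2,3) r1(2) ys(1) by (simp del: upt_Suc)
  qed
  moreover have "\<forall>r<b. \<rho>2 r = \<rho> r" using r2(3) r1(3) g(4) by simp
  ultimately show ?case by blast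
qed

lemma compiled_Cn:
  assumes f: "compiled f" and gs: "\<forall>g\<in>set gs. compiled g"
  shows "compiled (Cn f gs)"
proof (rule compiledI, goal_cases)
  case (1 as out base off P \<rho> z)
  note ev = 1(1) and as = 1(2) and out = 1(3) and pl = 1(4)
  let ?n = "length gs"
  let ?C = "codes gs as base (base + ?n) off"
  let ?D = "code f [base..<base + ?n] out (base + ?n) (off + length ?C)"
  from ev obtain ys where ys: "list_all2 (\<lambda>g y. eval g (map \<rho> as) y) gs ys" "eval f ys z"
    by (cases rule: eval.cases) auto
  have pl': "placed P off ?C" "placed P (off + length ?C) ?D"
    using pl by (auto simp: Let_def placed_append)
  obtain \<rho>1 where r1: "leads P (off, \<rho>) (off + length ?C, \<rho>1)"
    "map \<rho>1 [base..<base + ?n] = ys" "\<forall>r<base. \<rho>1 r = \<rho> r"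
    using codes_leads[OF gs, of "\<lambda>xs g y. eval g xs y" "map \<rho> as" ys \<rho> as base "base + ?n" P off]
      ys(1) as pl'(1) by auto
  have "eval f (map \<rho>1 [base..<base + ?n]) z" using r1(2) ys(2) by simp
  moreover have "\<forall>a\<in>set [base..<base + ?n]. a < base + ?n" "out < base + ?n" using out by auto
  ultimately obtain \<rho>2 where r2: "leads P (off + length ?C, \<rho>1) (off + length ?C + length ?D, \<rho>2)"
    "\<rho>2 out = z" "\<forall>r<base + ?n. r \<noteq> out \<longrightarrow> \<rho>2 r = \<rho>1 r"
    using compiledD[OF f _ _ _ refl pl'(2) refl] by blast
  have "leads P (off, \<rho>) (off + length (code (Cn f gs) as out base off), \<rho>2)"
    using rtranclp_trans[OF r1(1) r2(1)] by (simp add: Let_def add.assoc)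
  moreover have "\<forall>r<base. r \<noteq> out \<longrightarrow> \<rho>2 r = \<rho> r" using r1(3) r2(3) by simp
  ultimately show ?case using r2(2) by blast
qed

text \<open>\<open>eval_PrS\<close> descends from \<open>n\<close> while the compiled loop counts
  upward; the sequence \<open>r\<close> of intermediate results mediates between the two.\<close>

lemma eval_Pr_sequence:
  assumes "eval (Pr f g) (n # xs) z"
  shows "\<exists>r. eval f xs (r 0) \<and> (\<forall>i<n. eval g (r i # i # xs) (r (Suc i))) \<and> r n = z"
  using assms
proof (induction n arbitrary: z)
  case 0
  then have "eval f xs z" by (cases rule: eval.cases) auto
  then show ?case by (intro exI[of _ "\<lambda>_. z"]) simp
next
  case (Suc n)
  from Suc.prems obtain y where y: "eval (Pr f g) (n # xs) y" "eval g (y # n # xs) z"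
    by (cases rule: eval.cases) auto
  from Suc.IH[OF y(1)] obtain r where "eval f xs (r 0)" "\<forall>i<n. eval g (r i # i # xs) (r (Suc i))" "r n = y"
    by blast
  then show ?case using y(2) by (intro exI[of _ "r(Suc n := z)"]) (auto simp: less_Suc_eq)
qed

text \<open>Scratch layout: \<open>base\<close> counts completed rounds, \<open>base + 1\<close>
  holds the current value \<open>r i\<close>, \<open>base + 2\<close> the number of rounds left, and
  \<open>base + 3\<close> the result of \<open>g\<close>.\<close>

lemma compiled_Pr:
  assumes f: "compiled f" and g: "compiled g"
  shows "compiled (Pr f g)"
proof (rule compiledI, goal_cases)
  case (1 as out base off P \<rho> z)
  note ev = 1(1) and as = 1(2) and out = 1(3) and pl = 1(4)
  from ev have "as \<noteq> []" by (cases rule: eval.cases) auto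
  then obtain a as' where as': "as = a # as'" by (cases as) auto
  define n where "n = \<rho> a"
  define xs where "xs = map \<rho> as'"
  obtain r where r: "eval f xs (r 0)" "\<And>i. i < n \<Longrightarrow> eval g (r i # i # xs) (r (Suc i))" "r n = z"
    using eval_Pr_sequence[of f g n xs z] ev by (auto simp: as' n_def xs_def)
  define C where "C = code f as' (base + 1) (base + 4) (off + 2)"
  define L where "L = off + 2 + length C"
  define C' where "C' = code g ((base + 1) # base # as') (base + 3) (base + 4) (L + 3)"
  define E where "E = L + 3 + length C'"
  have code: "code (Pr f g) as out base off = [mov (base + 2) a Keep (off + 1), mov base base Zero (off + 2)] @ C
        @ branch_code (base + 2) L (E + 2) (L + 3) @ C'
        @ [mov (base + 1) (base + 3) Keep (E + 1), mov base base Inc L, mov out (base + 1) Keep (E + 3)]"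
    by (simp add: as' C_def L_def C'_def E_def Let_def)
  have pl1: "placed P off [mov (base + 2) a Keep (off + 1)]" "placed P (off + 1) [mov base base Zero (off + 2)]"
    "placed P (off + 2) C" "placed P L (branch_code (base + 2) L (E + 2) (L + 3) @ [])"
    "placed P (L + 3) C'" "placed P E [mov (base + 1) (base + 3) Keep (E + 1)]"
    "placed P (E + 1) [mov base base Inc L]" "placed P (E + 2) [mov out (base + 1) Keep (E + 3)]"
    using pl unfolding code
    by (simp_all add: placed_append placed_Cons placed_Nil L_def E_def ac_simps numeral_eq_Suc)
  have len: "off + length (code (Pr f g) as out base off) = E + 3"
    unfolding code by (simp add: L_def E_def)
  have as'_lt: "\<forall>b\<in>set as'. b < base" and a_lt: "a < base" using as as' by auto
  define \<rho>1 where "\<rho>1 = (\<rho>(base + 2 := n))(base := 0)"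
  have xs1: "map \<rho>1 as' = xs" unfolding xs_def \<rho>1_def using as'_lt by (auto intro!: map_cong)
  obtain \<rho>2 where r2: "leads P (off + 2, \<rho>1) (L, \<rho>2)" "\<rho>2 (base + 1) = r 0"
    "\<And>q. q < base + 4 \<Longrightarrow> q \<noteq> base + 1 \<Longrightarrow> \<rho>2 q = \<rho>1 q"
  proof -
    have "\<exists>\<rho>2. leads P (off + 2, \<rho>1) (L, \<rho>2) \<and> \<rho>2 (base + 1) = r 0 \<and>
        (\<forall>q<base + 4. q \<noteq> base + 1 \<longrightarrow> \<rho>2 q = \<rho>1 q)"
      by (rule compiledD[OF f _ _ _ C_def pl1(3) L_def]) (use r(1) xs1 as'_lt in auto)
    then show ?thesis using that by blast
  qed
  have start: "leads P (off, \<rho>) c" if "leads P (L, \<rho>2) c" for c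
  proof (rule leads_mov[OF pl1(1)])
    have "leads P (off + 1, \<rho>(base + 2 := n)) c"
    proof (rule leads_mov[OF pl1(2)])
      show "leads P (off + 2, (\<rho>(base + 2 := n))(base := app_op Zero ((\<rho>(base + 2 := n)) base))) c"
        using rtranclp_trans[OF r2(1) that] by (simp add: \<rho>1_def)
    qed auto
    then show "leads P (off + 1, \<rho>(base + 2 := app_op Keep (\<rho> a))) c" by (simp add: n_def)
  qed auto
  have loop: "\<exists>\<tau>'. leads P (L, \<tau>) (L, \<tau>') \<and> \<tau>' (base + 1) = r n \<and> \<tau>' (base + 2) = 0 \<and> (\<forall>q<base. \<tau>' q = \<tau> q)"
    if "\<tau> (base + 1) = r i" "\<tau> base = i" "\<tau> (base + 2) = n - i" "i \<le> n" "\<forall>q<base. \<tau> q = \<rho> q" for \<tau> i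
    using that
  proof (induction "n - i" arbitrary: i \<tau>)
    case 0
    then show ?case by (intro exI[of _ \<tau>]) auto
  next
    case (Suc k)
    define \<tau>1 where "\<tau>1 = \<tau>(base + 2 := \<tau> (base + 2) - 1)"
    have "map \<tau>1 as' = xs" unfolding xs_def \<tau>1_def using as'_lt Suc.prems(5) by (auto intro!: map_cong)
    then have args: "map \<tau>1 ((base + 1) # base # as') = r i # i # xs"
      using Suc.prems by (simp add: \<tau>1_def)
    have "eval g (map \<tau>1 ((base + 1) # base # as')) (r (Suc i))"
      unfolding args using r(2) Suc by simp
    then obtain \<tau>2 where t2: "leads P (L + 3, \<tau>1) (E, \<tau>2)" "\<tau>2 (base + 3) = r (Suc i)"
      "\<And>q. q < base + 4 \<Longrightarrow> q \<noteq> base + 3 \<Longrightarrow> \<tau>2 q = \<tau>1 q"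
    proof -
      assume ev: "eval g (map \<tau>1 ((base + 1) # base # as')) (r (Suc i))"
      have "\<exists>\<tau>2. leads P (L + 3, \<tau>1) (E, \<tau>2) \<and> \<tau>2 (base + 3) = r (Suc i) \<and>
          (\<forall>q<base + 4. q \<noteq> base + 3 \<longrightarrow> \<tau>2 q = \<tau>1 q)"
        by (rule compiledD[OF g ev _ _ C'_def pl1(5) E_def]) (use as'_lt in auto)
      then show ?thesis using that by blast
    qed
    define \<tau>3 where "\<tau>3 = (\<tau>2(base + 1 := r (Suc i)))(base := Suc i)"
    have "\<tau>3 (base + 1) = r (Suc i)" "\<tau>3 base = Suc i" "\<tau>3 (base + 2) = n - Suc i" "Suc i \<le> n"
      "\<forall>q<base. \<tau>3 q = \<rho> q" "k = n - Suc i"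
      using Suc t2(3) by (auto simp: \<tau>3_def \<tau>1_def)
    then obtain \<tau>' where t': "leads P (L, \<tau>3) (L, \<tau>')" "\<tau>' (base + 1) = r n" "\<tau>' (base + 2) = 0"
      "\<forall>q<base. \<tau>' q = \<tau>3 q" using Suc.hyps(1)[of "Suc i" \<tau>3] by blast
    have "leads P (E + 1, \<tau>2(base + 1 := r (Suc i))) (L, \<tau>')"
    proof (rule leads_mov[OF pl1(7)])
      have "(\<tau>2(base + 1 := r (Suc i))) base = i" using t2(3)[of base] Suc.prems by (simp add: \<tau>1_def)
      then show "leads P (L, (\<tau>2(base + 1 := r (Suc i)))(base := app_op Inc ((\<tau>2(base + 1 := r (Suc i))) base))) (L, \<tau>')"
        using t'(1) by (simp add: \<tau>3_def)
    qed auto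
    then have "leads P (E, \<tau>2) (L, \<tau>')" using t2(2) by (intro leads_mov[OF pl1(6)]) auto
    then have "leads P (L + 3, \<tau>1) (L, \<tau>')" using t2(1) by (rule rtranclp_trans[rotated])
    then have "leads P (L, \<tau>) (L, \<tau>')"
      using Suc.prems Suc.hyps(2) by (intro leads_test_nonzero[OF pl1(4)]) (auto simp: \<tau>1_def)
    moreover have "\<forall>q<base. \<tau>' q = \<tau> q"
      using t'(4) t2(3) by (simp add: \<tau>3_def \<tau>1_def)
    ultimately show ?case using t' by blast
  qed
  have "\<rho>2 (base + 1) = r 0" "\<rho>2 base = 0" "\<rho>2 (base + 2) = n - 0" "0 \<le> n" "\<forall>q<base. \<rho>2 q = \<rho> q"
    using r2 by (auto simp: \<rho>1_def)
  from loop[OF this] obtain \<rho>3 where r3: "leads P (L, \<rho>2) (L, \<rho>3)" "\<rho>3 (base + 1) = z" "\<rho>3 (base + 2) = 0"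
    "\<forall>q<base. \<rho>3 q = \<rho>2 q" using r(3) by blast
  have "leads P (E + 2, \<rho>3) (E + 3, \<rho>3(out := z))"
    using r3(2) by (intro leads_mov[OF pl1(8)]) auto
  then have "leads P (L, \<rho>3) (E + 3, \<rho>3(out := z))"
    using r3(3) by (intro leads_test_zero[OF pl1(4)]) auto
  then have "leads P (off, \<rho>) (E + 3, \<rho>3(out := z))"
    using start rtranclp_trans[OF r3(1)] by blast
  moreover have "\<forall>q<base. q \<noteq> out \<longrightarrow> (\<rho>3(out := z)) q = \<rho> q"
    using r3(4) r2(3) by (simp add: \<rho>1_def)
  ultimately show ?case
    unfolding len by (intro exI[of _ "\<rho>3(out := z)"]) simp
qed

lemma compiled_Mn:
  assumes f: "compiled f"
  shows "compiled (Mn f)"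
proof (rule compiledI, goal_cases)
  case (1 as out base off P \<rho> z)
  note ev = 1(1) and as = 1(2) and out = 1(3) and pl = 1(4)
  define xs where "xs = map \<rho> as"
  from ev have ez: "eval f (z # xs) 0" and ek: "\<forall>k<z. \<exists>m>0. eval f (k # xs) m"
    unfolding xs_def by (cases rule: eval.cases; simp)+
  define L where "L = off + 1"
  define C where "C = code f (base # as) (base + 1) (base + 2) L"
  define T where "T = L + length C"
  have code: "code (Mn f) as out base off = [mov base base Zero L] @ C @ branch_code (base + 1) T (T + 4) (T + 3)
        @ [mov base base Inc L, mov out base Keep (T + 5)]"
    by (simp add: C_def L_def T_def Let_def)
  have pl1: "placed P off [mov base base Zero L]" "placed P L C"
    "placed P T (branch_code (base + 1) T (T + 4) (T + 3) @ [])"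
    "placed P (T + 3) [mov base base Inc L]" "placed P (T + 4) [mov out base Keep (T + 5)]"
    using pl unfolding code
    by (simp_all add: placed_append placed_Cons placed_Nil L_def T_def ac_simps numeral_eq_Suc)
  have len: "off + length (code (Mn f) as out base off) = T + 5"
    unfolding code by (simp add: L_def T_def)
  have body: "\<exists>\<tau>'. leads P (L, \<tau>) (T, \<tau>') \<and> \<tau>' (base + 1) = m \<and> \<tau>' base = k \<and> (\<forall>q<base. \<tau>' q = \<rho> q)"
    if "\<tau> base = k" "\<forall>q<base. \<tau> q = \<rho> q" "eval f (k # xs) m" for \<tau> k m
  proof -
    have "map \<tau> as = xs" unfolding xs_def using as that(2) by (auto intro!: map_cong)
    then have "eval f (map \<tau> (base # as)) m" using that by simp
    then obtain \<tau>' where "leads P (L, \<tau>) (T, \<tau>')" "\<tau>' (base + 1) = m"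
      "\<And>q. q < base + 2 \<Longrightarrow> q \<noteq> base + 1 \<Longrightarrow> \<tau>' q = \<tau> q"
    proof -
      assume ev: "eval f (map \<tau> (base # as)) m"
      have "\<exists>\<tau>'. leads P (L, \<tau>) (T, \<tau>') \<and> \<tau>' (base + 1) = m \<and>
          (\<forall>q<base + 2. q \<noteq> base + 1 \<longrightarrow> \<tau>' q = \<tau> q)"
        by (rule compiledD[OF f ev _ _ C_def pl1(2) T_def]) (use as in auto)
      then show ?thesis using that by blast
    qed
    then show ?thesis using that by (intro exI[of _ \<tau>']) auto
  qed
  have loop: "\<exists>\<tau>'. leads P (L, \<tau>) (T, \<tau>') \<and> \<tau>' (base + 1) = 0 \<and> \<tau>' base = z \<and> (\<forall>q<base. \<tau>' q = \<rho> q)"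
    if "\<tau> base = k" "k \<le> z" "\<forall>q<base. \<tau> q = \<rho> q" for \<tau> k
    using that
  proof (induction "z - k" arbitrary: k \<tau>)
    case 0
    then show ?case using body[of \<tau> z 0] ez by simp
  next
    case (Suc j)
    then obtain m where m: "m > 0" "eval f (k # xs) m" using ek by (metis zero_less_diff zero_less_Suc)
    from body[OF Suc.prems(1,3) m(2)] obtain \<tau>1 where t1: "leads P (L, \<tau>) (T, \<tau>1)" "\<tau>1 (base + 1) = m"
      "\<tau>1 base = k" "\<forall>q<base. \<tau>1 q = \<rho> q" by blast
    \<comment> \<open>The test leaves the tested register decremented; the next run of
      \<open>f\<close> overwrites it.\<close>
    define \<tau>2 where "\<tau>2 = (\<tau>1(base + 1 := m - 1))(base := Suc k)"
    have "\<tau>2 base = Suc k" "Suc k \<le> z" "\<forall>q<base. \<tau>2 q = \<rho> q" "j = z - Suc k"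
      using Suc.hyps(2) t1 by (auto simp: \<tau>2_def)
    then obtain \<tau>' where t': "leads P (L, \<tau>2) (T, \<tau>')" "\<tau>' (base + 1) = 0" "\<tau>' base = z" "\<forall>q<base. \<tau>' q = \<rho> q"
      using Suc.hyps(1)[of "Suc k" \<tau>2] by blast
    have "leads P (T + 3, \<tau>1(base + 1 := m - 1)) (T, \<tau>')"
      using t'(1) t1 by (intro leads_mov[OF pl1(4)]) (auto simp: \<tau>2_def)
    then have "leads P (T, \<tau>1) (T, \<tau>')"
      using t1 m by (intro leads_test_nonzero[OF pl1(3)]) auto
    then show ?case using rtranclp_trans[OF t1(1)] t' by blast
  qed
  have "(\<rho>(base := 0)) base = 0" "0 \<le> z" "\<forall>q<base. (\<rho>(base := 0)) q = \<rho> q" by auto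
  from loop[OF this] obtain \<rho>3 where r3: "leads P (L, \<rho>(base := 0)) (T, \<rho>3)" "\<rho>3 (base + 1) = 0" "\<rho>3 base = z"
    "\<forall>q<base. \<rho>3 q = \<rho> q" by blast
  have "leads P (T + 4, \<rho>3) (T + 5, \<rho>3(out := z))"
    using r3(3) by (intro leads_mov[OF pl1(5)]) auto
  then have "leads P (T, \<rho>3) (T + 5, \<rho>3(out := z))"
    using r3(2) by (intro leads_test_zero[OF pl1(3)]) auto
  then have "leads P (L, \<rho>(base := 0)) (T + 5, \<rho>3(out := z))" using rtranclp_trans[OF r3(1)] by blast
  then have "leads P (off, \<rho>) (T + 5, \<rho>3(out := z))" by (intro leads_mov[OF pl1(1)]) auto
  then show ?case
    unfolding len using r3(4) by (intro exI[of _ "\<rho>3(out := z)"]) auto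
qed

lemma compiled_mov:
  assumes "\<And>as out base off. code f as out base off = [mov out (src as out) o' (Suc off)]"
    and "o' \<noteq> Dec" "o' \<noteq> AssertZ"
    and "\<And>\<rho> as out z. eval f (map \<rho> as) z \<Longrightarrow> z = app_op o' (\<rho> (src as out))"
  shows "compiled f"
proof (rule compiledI, goal_cases)
  case (1 as out base off P \<rho> z)
  have "leads P (off, \<rho>) (Suc off, \<rho>(out := z))"
    using 1(4) assms(2,3) assms(4)[OF 1(1)] unfolding assms(1)
    by (intro leads_mov[of P off out "src as out" o' "Suc off" "[]"]) auto
  then show ?case unfolding assms(1) by (intro exI[of _ "\<rho>(out := z)"]) auto
qed

lemma compiled: "compiled f"
proof (induction f)
  case Z
  show ?case by (rule compiled_mov[of _ "\<lambda>as out. out" Zero]) (auto elim: eval.cases)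
next
  case S
  show ?case
  proof (rule compiled_mov[of _ "\<lambda>as out. hd as" Inc])
    show "z = app_op Inc (\<rho> (hd as))" if "eval S (map \<rho> as) z" for \<rho> as out z
      using that by (cases rule: eval.cases) auto
  qed auto
next
  case (Id i)
  show ?case
  proof (rule compiled_mov[of _ "\<lambda>as out. as ! i" Keep])
    show "z = app_op Keep (\<rho> (as ! i))" if "eval (Id i) (map \<rho> as) z" for \<rho> as out z
      using that by (cases rule: eval.cases) auto
  qed auto
next
  case (Cn f gs)
  then show ?case by (intro compiled_Cn) auto
qed (auto intro: compiled_Pr compiled_Mn)

section \<open>Syntactic control of jumps\<close>

definition tests :: "instr \<Rightarrow> op \<Rightarrow> nat \<Rightarrow> bool" where
  "tests I o' r \<longleftrightarrow> iop I = o' \<and> idst I = r \<and> isrc I = r"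

text \<open>For compiled code \<open>hi\<close> is one past the end, the common exit. Proper
  branches must land on tests inside the same fragment, which keeps the property stable under
  concatenation.\<close>

definition segment :: "nat \<Rightarrow> nat \<Rightarrow> nat \<Rightarrow> instr list \<Rightarrow> bool" where
  "segment lo hi off C \<longleftrightarrow> (\<forall>I\<in>set C. lo \<le> ilz I \<and> ilz I \<le> hi \<and> lo \<le> ilnz I \<and> ilnz I \<le> hi \<and>
     (ilz I \<noteq> ilnz I \<longrightarrow>
       (\<exists>a<length C. ilz I = off + a \<and> tests (C ! a) AssertZ (ibr I)) \<and>
       (\<exists>a<length C. ilnz I = off + a \<and> tests (C ! a) Dec (ibr I))))"

lemma segment_append:
  assumes "segment lo hi off C" "segment lo hi (off + length C) C'"
  shows "segment lo hi off (C @ C')"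
proof -
  have l: "\<exists>a<length (C @ C'). l = off + a \<and> tests ((C @ C') ! a) o' r"
    if "\<exists>a<length C. l = off + a \<and> tests (C ! a) o' r" for l o' r
  proof -
    from that obtain a where "a < length C" "l = off + a" "tests (C ! a) o' r" by blast
    then show ?thesis by (intro exI[of _ a]) (simp add: nth_append)
  qed
  have r: "\<exists>a<length (C @ C'). l = off + a \<and> tests ((C @ C') ! a) o' r"
    if "\<exists>a<length C'. l = off + length C + a \<and> tests (C' ! a) o' r" for l o' r
  proof -
    from that obtain a where "a < length C'" "l = off + length C + a" "tests (C' ! a) o' r" by blast
    then show ?thesis by (intro exI[of _ "length C + a"]) (simp add: add.assoc)
  qed
  show ?thesis unfolding segment_def set_append ball_Un
    using assms l r unfolding segment_def by (intro conjI ballI impI) blast+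
qed

lemma segment_mono: "segment lo hi off C \<Longrightarrow> lo' \<le> lo \<Longrightarrow> hi \<le> hi' \<Longrightarrow> segment lo' hi' off C"
  unfolding segment_def by (meson order_trans)

lemma segment_Nil: "segment lo hi off []"
  by (simp add: segment_def)

lemma segment_Cons_mov:
  assumes "lo \<le> l" "l \<le> hi" "segment lo hi (Suc off) C"
  shows "segment lo hi off (mov d s o' l # C)"
proof -
  have "segment lo hi off [mov d s o' l]" using assms by (simp add: segment_def)
  from segment_append[OF this, of C] assms(3) show ?thesis by simp
qed

lemma segment_test:
  assumes "lo \<le> l" "l \<le> hi" "lo \<le> l'" "l' \<le> hi" "lo \<le> off" "off + 2 \<le> hi"
  shows "segment lo hi off (branch_code r off l l')"
proof -
  have "\<exists>a<3. Suc off = off + a \<and> tests (branch_code r off l l' ! a) AssertZ r"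
    by (intro exI[of _ 1]) (simp add: branch_code_def tests_def)
  moreover have "\<exists>a<3. Suc (Suc off) = off + a \<and> tests (branch_code r off l l' ! a) Dec r"
    by (intro exI[of _ 2]) (simp add: branch_code_def tests_def)
  moreover have "set (branch_code r off l l') =
      {Instr r r Keep r (Suc off) (Suc (Suc off)), mov r r AssertZ l, mov r r Dec l'}"
    by (simp add: branch_code_def)
  ultimately show ?thesis using assms unfolding segment_def length_branch_code by simp
qed

lemma segment_code:
  "segment off (off + length (code f as out base off)) off (code f as out base off)"
  "segment off (off + length (codes gs as out base off)) off (codes gs as out base off)"
proof (induction f as out base off and gs as out base off rule: code_codes.induct)
  case (4 f gs as out base off)
  define C where "C = codes gs as base (base + length gs) off"
  define C' where "C' = code f [base..<base + length gs] out (base + length gs) (off + length C)"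
  have "segment off (off + length (C @ C')) off C"
    by (rule segment_mono[of off "off + length C"]) (use 4(1)[OF refl] in \<open>simp_all add: C_def\<close>)
  moreover have "segment off (off + length (C @ C')) (off + length C) C'"
    by (rule segment_mono[of "off + length C" "off + length C + length C'"])
      (use 4(2)[OF refl refl] in \<open>simp_all add: C_def C'_def\<close>)
  ultimately show ?case unfolding code.simps Let_def C_def[symmetric] C'_def[symmetric]
    by (rule segment_append)
next
  case (5 f g as out base off)
  define C where "C = code f (tl as) (base + 1) (base + 4) (off + 2)"
  define L where "L = off + 2 + length C"
  define C' where "C' = code g ((base + 1) # base # tl as) (base + 3) (base + 4) (L + 3)"
  define E where "E = L + 3 + length C'"
  have code: "code (Pr f g) as out base off = mov (base + 2) (hd as) Keep (off + 1) # mov base base Zero (off + 2) # C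
        @ branch_code (base + 2) L (E + 2) (L + 3) @ C'
        @ [mov (base + 1) (base + 3) Keep (E + 1), mov base base Inc L, mov out (base + 1) Keep (E + 3)]"
    by (simp add: C_def L_def C'_def E_def Let_def)
  have len: "off + length (code (Pr f g) as out base off) = E + 3"
    unfolding code by (simp add: L_def E_def)
  have C: "segment (off + 2) L (off + 2) C" using 5(1) by (simp add: C_def L_def)
  have C': "segment (L + 3) E (L + 3) C'"
    using 5(2)[OF refl refl] by (simp add: C_def L_def C'_def E_def)
  show ?case unfolding len unfolding code
  proof (intro segment_Cons_mov segment_append)
    show "segment off (E + 3) (Suc (Suc off)) C" using segment_mono[OF C, of off "E + 3"] by (simp add: E_def)
    show "segment off (E + 3) (Suc (Suc off) + length C) (branch_code (base + 2) L (E + 2) (L + 3))"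
      using segment_test[of off "E + 2" "E + 3" "L + 3" L "base + 2"] by (simp add: E_def L_def)
    show "segment off (E + 3) (Suc (Suc off) + length C + length (branch_code (base + 2) L (E + 2) (L + 3))) C'"
      using segment_mono[OF C', of off "E + 3"] by (simp add: L_def add.commute add.left_commute numeral_3_eq_3)
  qed (auto simp: E_def L_def segment_Nil)
next
  case (6 f as out base off)
  define L where "L = off + 1"
  define C where "C = code f (base # as) (base + 1) (base + 2) L"
  define T where "T = L + length C"
  have code: "code (Mn f) as out base off = mov base base Zero L # C @ branch_code (base + 1) T (T + 4) (T + 3)
        @ [mov base base Inc L, mov out base Keep (T + 5)]"
    by (simp add: C_def L_def T_def Let_def)
  have len: "off + length (code (Mn f) as out base off) = T + 5"
    unfolding code by (simp add: L_def T_def)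
  have C: "segment L T L C" using 6 by (simp add: C_def L_def T_def)
  show ?case unfolding len unfolding code
  proof (intro segment_Cons_mov segment_append)
    show "segment off (T + 5) (Suc off) C" using segment_mono[OF C, of off "T + 5"] by (simp add: L_def)
    show "segment off (T + 5) (Suc off + length C) (branch_code (base + 1) T (T + 4) (T + 3))"
      using segment_test[of off "T + 4" "T + 5" "T + 3" T "base + 1"] by (simp add: T_def L_def)
  qed (auto simp: T_def L_def segment_Nil)
next
  case (8 g gs as out base off)
  define C where "C = code g as out base off"
  define C' where "C' = codes gs as (Suc out) base (off + length C)"
  have "segment off (off + length (C @ C')) off C"
    by (rule segment_mono[of off "off + length C"]) (use 8(1) in \<open>simp_all add: C_def\<close>)
  moreover have "segment off (off + length (C @ C')) (off + length C) C'"
    by (rule segment_mono[of "off + length C" "off + length C + length C'"])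
      (use 8(2)[OF refl] in \<open>simp_all add: C_def C'_def\<close>)
  ultimately show ?case unfolding codes.simps Let_def C_def[symmetric] C'_def[symmetric]
    by (rule segment_append)
qed (auto intro!: segment_Cons_mov segment_Nil simp: segment_Nil)

text \<open>Jump targets are positive so that instruction 0 is executed in the first step only: its
  gadgets at parity 0 are random vertices that hold the input. The condition on branches is the one
  by which equilibria verify zero tests.\<close>

definition machine_ok :: "instr list \<Rightarrow> nat \<Rightarrow> bool" where
  "machine_ok P R \<longleftrightarrow> 0 < R \<and> P \<noteq> [] \<and>
     (\<forall>I\<in>set P. idst I < R \<and> isrc I < R \<and> ibr I < R \<and>
        0 < ilz I \<and> ilz I < length P \<and> 0 < ilnz I \<and> ilnz I < length P \<and>
        (ilz I \<noteq> ilnz I \<longrightarrow> tests (P ! ilz I) AssertZ (ibr I) \<and> tests (P ! ilnz I) Dec (ibr I)))"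

definition run :: "instr list \<Rightarrow> nat \<Rightarrow> nat \<Rightarrow> config" where
  "run P t k = (exec1 P ^^ k) (0, \<lambda>r. if r = 0 then t else 0)"

lemma run_Suc: "run P t (Suc k) = exec1 P (run P t k)"
  by (simp add: run_def)

text \<open>The compiled \<open>f\<close> is framed by an instruction 0 that is never revisited, an
  assertion that the result is 0, a sweep clearing all registers, and an endless loop. The assertion
  turns the output into legality of the run. The cleared loop makes the run eventually constant with
  all registers zero, which later leaves only finitely many exceptional histories for the
  strategy.\<close>

lemma program_exists:
  "\<exists>P R. machine_ok P R \<and>
    (\<forall>t. eval f [t] 0 \<longrightarrow> (\<forall>k. legal P (run P t k)) \<and>
      (\<exists>K G. P ! G = mov 0 0 Keep G \<and> (\<forall>k\<ge>K. fst (run P t k) = G \<and> (\<forall>r<R. snd (run P t k) r = 0)))) \<and>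
    (\<forall>t y. eval f [t] y \<longrightarrow> y \<noteq> 0 \<longrightarrow> (\<exists>k. \<not> legal P (run P t k)))"
proof -
  define C where "C = code f [0] 1 2 1"
  define A where "A = 1 + length C"
  define core where "core = [mov 0 0 Keep 1] @ C @ [mov 1 1 AssertZ (Suc A)]"
  have lc: "length core = Suc A" by (simp add: core_def A_def)
  define R where "R = Suc (Max (\<Union>I\<in>set core. {idst I, isrc I, ibr I}))"
  define zs where "zs = map (\<lambda>i. mov i i Zero (Suc A + i + 1)) [0..<R]"
  define G where "G = Suc A + R"
  define P where "P = core @ zs @ [mov 0 0 Keep G]"
  have lz: "length zs = R" by (simp add: zs_def)
  have lP: "length P = Suc G" by (simp add: P_def lc lz G_def)
  have fin: "finite (\<Union>I\<in>set core. {idst I, isrc I, ibr I})" by auto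
  have regs: "idst I < R" "isrc I < R" "ibr I < R" if "I \<in> set core" for I
    unfolding R_def less_Suc_eq_le using that fin by (auto intro!: Max_ge)
  have segC: "segment 1 A 1 C"
    using segment_code(1)[of 1 f "[0]" 1 2] by (simp add: C_def A_def)
  have "segment 1 G 0 P"
    unfolding P_def core_def
  proof (intro segment_append)
    show "segment 1 G (0 + length [mov 0 0 Keep 1]) C"
      using segment_mono[OF segC, of 1 G] by (simp add: G_def)
  qed (auto simp: segment_def G_def zs_def)
  then have seg: "\<forall>I\<in>set P. 1 \<le> ilz I \<and> ilz I \<le> G \<and> 1 \<le> ilnz I \<and> ilnz I \<le> G \<and>
    (ilz I \<noteq> ilnz I \<longrightarrow> tests (P ! ilz I) AssertZ (ibr I) \<and> tests (P ! ilnz I) Dec (ibr I))"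
    unfolding segment_def by fastforce
  have Rpos: "0 < R" by (simp add: R_def)
  have regP: "\<forall>I\<in>set P. idst I < R \<and> isrc I < R \<and> ibr I < R"
    using regs Rpos by (auto simp: P_def zs_def)
  have "machine_ok P R"
    unfolding machine_ok_def using seg regP Rpos lP by (fastforce simp: P_def)
  have PG: "P ! G = mov 0 0 Keep G" by (simp add: P_def G_def nth_append lc lz)
  have pl: "placed P 0 [mov 0 0 Keep 1]" "placed P 1 C" "placed P A [mov 1 1 AssertZ (Suc A)]"
    "placed P (Suc A) zs"
  proof -
    have "placed P 0 P" by (simp add: placed_def)
    then have "placed P 0 ([mov 0 0 Keep 1] @ C @ [mov 1 1 AssertZ (Suc A)] @ zs @ [mov 0 0 Keep G])"
      by (simp add: P_def core_def)
    then show "placed P 0 [mov 0 0 Keep 1]" "placed P 1 C" "placed P A [mov 1 1 AssertZ (Suc A)]"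
      "placed P (Suc A) zs"
      by (auto simp: placed_append placed_Cons placed_Nil A_def)
  qed
  have reach: "\<exists>\<rho>. leads P (0, \<lambda>r. if r = 0 then t else 0) (A, \<rho>) \<and> \<rho> 1 = y" if "eval f [t] y" for t y
  proof -
    let ?\<rho> = "\<lambda>r::nat. if r = 0 then t else 0"
    have "eval f (map ?\<rho> [0]) y" using that by simp
    then have "\<exists>\<rho>. leads P (1, ?\<rho>) (A, \<rho>) \<and> \<rho> 1 = y \<and> (\<forall>r<2. r \<noteq> 1 \<longrightarrow> \<rho> r = ?\<rho> r)"
      by (rule compiledD[OF compiled _ _ _ C_def pl(2) A_def]) auto
    then obtain \<rho> where "leads P (1, ?\<rho>) (A, \<rho>)" "\<rho> 1 = y" by blast
    moreover have "leads P (0, ?\<rho>) (A, \<rho>)"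
      by (rule leads_mov[OF pl(1)]) (use calculation in \<open>auto simp: fun_upd_idem\<close>)
    ultimately show ?thesis by blast
  qed
  have PA: "A < length P" "P ! A = mov 1 1 AssertZ (Suc A)" using pl(3) by (auto simp: placed_Cons)
  have good: "(\<forall>k. legal P (run P t k)) \<and>
      (\<exists>K G. P ! G = mov 0 0 Keep G \<and> (\<forall>k\<ge>K. fst (run P t k) = G \<and> (\<forall>r<R. snd (run P t k) r = 0)))"
    if ev: "eval f [t] 0" for t
  proof -
    obtain \<rho> where r: "leads P (0, \<lambda>r. if r = 0 then t else 0) (A, \<rho>)" "\<rho> 1 = 0"
      using reach[OF ev] by blast
    have s: "leads P (A, \<rho>) (Suc A, \<rho>)"
    proof (rule leads_step)
      show "legal P (A, \<rho>)" using PA r(2) by (simp add: legal_def)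
      have "exec1 P (A, \<rho>) = (Suc A, \<rho>)" using PA r(2) by (simp add: exec1_def Let_def fun_upd_idem)
      then show "leads P (exec1 P (A, \<rho>)) (Suc A, \<rho>)" by simp
    qed
    have z: "\<exists>\<tau>. leads P (Suc A, \<rho>) (Suc A + i, \<tau>) \<and> (\<forall>r<i. \<tau> r = 0)" if "i \<le> R" for i
      using that
    proof (induction i)
      case (Suc i)
      then obtain \<tau> where t: "leads P (Suc A, \<rho>) (Suc A + i, \<tau>)" "\<forall>r<i. \<tau> r = 0" by auto
      have "placed P (Suc A + i) [mov i i Zero (Suc A + i + 1)]"
        using pl(4) Suc.prems by (auto simp: placed_def zs_def)
      then have "leads P (Suc A + i, \<tau>) (Suc A + Suc i, \<tau>(i := 0))"
        by (rule leads_mov) auto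
      then have "leads P (Suc A, \<rho>) (Suc A + Suc i, \<tau>(i := 0))" using t(1) by (rule rtranclp_trans[rotated])
      moreover have "\<forall>r<Suc i. (\<tau>(i := 0)) r = 0" using t(2) by (simp add: less_Suc_eq)
      ultimately show ?case by blast
    qed auto
    obtain \<tau> where t: "leads P (Suc A, \<rho>) (G, \<tau>)" "\<forall>r<R. \<tau> r = 0" using z[of R] by (auto simp: G_def)
    have "leads P (0, \<lambda>r. if r = 0 then t else 0) (G, \<tau>)"
      using rtranclp_trans[OF rtranclp_trans[OF r(1) s] t(1)] .
    then obtain K where K: "run P t K = (G, \<tau>)" "\<forall>i<K. legal P (run P t i)"
      using leads_iterate unfolding run_def by blast
    have stay: "run P t (K + k) = (G, \<tau>)" for k
    proof (induction k)
      case (Suc k)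
      then show ?case using t(2) Rpos by (simp add: run_Suc exec1_def PG Let_def fun_upd_idem)
    qed (simp add: K)
    have ge: "run P t k = (G, \<tau>)" if "k \<ge> K" for k using stay[of "k - K"] that by simp
    have "legal P (run P t k)" for k
      using K(2) ge[of k] by (cases "k < K") (auto simp: legal_def lP PG)
    moreover have "\<forall>k\<ge>K. fst (run P t k) = G \<and> (\<forall>r<R. snd (run P t k) r = 0)" using ge t(2) by simp
    ultimately show ?thesis using PG by blast
  qed
  have bad: "\<exists>k. \<not> legal P (run P t k)"
    if ev: "eval f [t] y" "y \<noteq> 0" for t y
  proof -
    obtain \<rho> where r: "leads P (0, \<lambda>r. if r = 0 then t else 0) (A, \<rho>)" "\<rho> 1 = y"
      using reach[OF ev(1)] by blast
    then obtain k where "run P t k = (A, \<rho>)"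
      using leads_iterate unfolding run_def by blast
    then show ?thesis using r(2) ev(2) PA by (intro exI[of _ k]) (simp add: legal_def)
  qed
  show ?thesis using \<open>machine_ok P R\<close> good bad by blast
qed

section \<open>The game of a machine\<close>

text \<open>Vertices of the game; \<open>t\<close> is the parity of the step number and \<open>pc\<close> the program counter.
  At \<open>Ch pc t m\<close> the \<open>m\<close>-th player of parity \<open>t\<close> may exit (to \<open>Ex\<close>, which leads to \<open>Xt\<close> with the
  probability that is her reward, and to \<open>Dd\<close> otherwise). The random vertex \<open>Bd pc t\<close> leads to \<open>Br pc t\<close>,
  where the next instruction is chosen, or to the gadget \<open>Gd pc t j\<close> of register \<open>j\<close>, whose result \<open>b\<close> is
  recorded in \<open>Rs pc t j b\<close>; the terminals \<open>Tm pc t j b u\<close>, with \<open>u < 4\<close> uniformly random, serve to give out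
  payoffs that are multiples of \<open>1 / 4\<close>.\<close>

datatype vert = Ch nat nat nat | Bd nat nat | Br nat nat | Gd nat nat nat | Hf nat nat nat
  | Rs nat nat nat nat | Tm nat nat nat nat nat | Ex nat nat nat | Xt nat nat nat | Dd

text \<open>Registers other than the destination are rewritten by \<open>Keep\<close> from
  themselves, so every register contributes one equation of the same shape at every step.\<close>

definition src_reg :: "instr \<Rightarrow> nat \<Rightarrow> nat" where
  "src_reg I i = (if i = idst I then isrc I else i)"

definition reg_op :: "instr \<Rightarrow> nat \<Rightarrow> op" where
  "reg_op I i = (if i = idst I then iop I else Keep)"

text \<open>In equilibrium the next claim will be y = 2 * (1 - r), where r is the winning
  probability of the player with \<open>s = 0\<close> in the gadget. The entries are thus 4 - 2 * y,
  with y the intended new value for old value 0 (if \<open>b = 0\<close>) or 1 (if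
  \<open>b = 1\<close>). Quarters suffice because y is one of 0, 1/2, 1, 2.\<close>

fun quarters :: "op \<Rightarrow> nat \<Rightarrow> nat" where
  "quarters Keep b = (if b = 1 then 2 else 4)"
| "quarters Inc b = (if b = 1 then 3 else 4)"
| "quarters Dec b = (if b = 1 then 0 else 4)"
| "quarters Zero b = 2"
| "quarters AssertZ b = (if b = 1 then 2 else 0)"

text \<open>Register \<open>i\<close> is guarded by the players with \<open>s = 0\<close> and \<open>s = 1\<close>, who have complementary payoffs.
  Player 1 controls the gadgets.\<close>

definition player :: "nat \<Rightarrow> nat \<Rightarrow> nat \<Rightarrow> nat" where
  "player i s \<tau> = 2 + (4 * i + 2 * s + \<tau>)"

text \<open>At a step of her own parity a player is paid for the operation on the source register,
  at the other steps for the register itself; her value thereby compares prescribed with actual new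
  contents. Choosing \<open>s = 1\<close> exchanges winning and losing outcomes within the relevant
  gadget.\<close>

fun pays :: "instr list \<Rightarrow> nat \<Rightarrow> nat \<Rightarrow> nat \<Rightarrow> vert \<Rightarrow> bool" where
  "pays P i s \<tau> (Tm pc t j b u) =
    (if t = \<tau> then j = src_reg (P ! pc) i \<and> (s = 0 \<longleftrightarrow> u < quarters (reg_op (P ! pc) i) b)
     else j = i \<and> (s = 0 \<longleftrightarrow> b = 1))"
| "pays P i s \<tau> (Xt i' s' \<tau>') = (i' = i \<and> s' = s \<and> \<tau>' = \<tau>)"
| "pays P i s \<tau> v = False"

fun is_exit :: "vert \<Rightarrow> bool" where
  "is_exit (Xt i s \<tau>) = True"
| "is_exit Dd = True"
| "is_exit v = False"

text \<open>A branch belongs to a guard of the tested register: at the following step she is paid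
  for its new claim, hence she is sensitive to the difference between the branches. Gadgets at
  counter 0 and parity 0 are left to nature because they hold the input.\<close>

fun owner :: "instr list \<Rightarrow> vert \<Rightarrow> nat" where
  "owner P (Ch pc t m) = Suc (player (m div 2) (m mod 2) t)"
| "owner P (Br pc t) = Suc (player (ibr (P ! pc)) 0 t)"
| "owner P (Gd pc t j) = (if pc = 0 \<and> t = 0 then 0 else 2)"
| "owner P v = 0"

definition chain :: "nat \<Rightarrow> nat \<Rightarrow> nat \<Rightarrow> nat \<Rightarrow> vert" where
  "chain R pc t m = (if m < 2 * R then Ch pc t m else Bd pc t)"

fun psucc :: "instr list \<Rightarrow> nat \<Rightarrow> vert \<Rightarrow> vert list" where
  "psucc P R (Ch pc t m) = [Ex (m div 2) (m mod 2) t, chain R pc t (Suc m)]"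
| "psucc P R (Br pc t) = [Ch (ilz (P ! pc)) (1 - t) 0, Ch (ilnz (P ! pc)) (1 - t) 0]"
| "psucc P R (Gd pc t j) = (if pc = 0 \<and> t = 0 then [] else [Rs pc t j 1, Hf pc t j])"
| "psucc P R v = []"

text \<open>\<open>Hf\<close> returns to the gadget with probability \<open>1 / 2\<close>, so
  passing it \<open>n\<close> times before taking result 1 produces \<open>1 / 2 ^ n\<close>. The
  exit rewards of the two guards sum to \<open>1 / R\<close>, their joint value if nobody exits; the
  share \<open>2 / (3 * R)\<close> for \<open>s = 0\<close> is the one for which the resulting
  equation becomes r + y / 2 = 1, with r the winning probability for the operation and y the next
  claim.\<close>

fun nsucc :: "nat \<Rightarrow> nat \<Rightarrow> vert \<Rightarrow> (vert \<times> nat \<times> nat) list" where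
  "nsucc R inp (Bd pc t) = (Br pc t, 1, 2) # map (\<lambda>j. (Gd pc t j, 1, 2 * R)) [0..<R]"
| "nsucc R inp (Gd pc t j) = (if pc = 0 \<and> t = 0 then
     if j = 0 then [(Rs 0 0 0 1, 1, 2 ^ inp), (Rs 0 0 0 0, 2 ^ inp - 1, 2 ^ inp)] else [(Rs 0 0 j 1, 1, 1)]
     else [])"
| "nsucc R inp (Hf pc t j) = [(Gd pc t j, 1, 2), (Rs pc t j 0, 1, 2)]"
| "nsucc R inp (Rs pc t j b) = [(Tm pc t j b 0, 1, 4), (Tm pc t j b 1, 1, 4), (Tm pc t j b 2, 1, 4), (Tm pc t j b 3, 1, 4)]"
| "nsucc R inp (Ex i s \<tau>) = [(Xt i s \<tau>, 2 - s, 3 * R), (Dd, 3 * R + s - 2, 3 * R)]"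
| "nsucc R inp (Tm pc t j b u) = [(Tm pc t j b u, 1, 1)]"
| "nsucc R inp (Xt i s \<tau>) = [(Xt i s \<tau>, 1, 1)]"
| "nsucc R inp Dd = [(Dd, 1, 1)]"
| "nsucc R inp v = []"

fun is_vert :: "nat \<Rightarrow> nat \<Rightarrow> vert \<Rightarrow> bool" where
  "is_vert N R (Ch pc t m) = (pc < N \<and> t < 2 \<and> m < 2 * R)"
| "is_vert N R (Bd pc t) = (pc < N \<and> t < 2)"
| "is_vert N R (Br pc t) = (pc < N \<and> t < 2)"
| "is_vert N R (Gd pc t j) = (pc < N \<and> t < 2 \<and> j < R)"
| "is_vert N R (Hf pc t j) = (pc < N \<and> t < 2 \<and> j < R)"
| "is_vert N R (Rs pc t j b) = (pc < N \<and> t < 2 \<and> j < R \<and> b < 2)"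
| "is_vert N R (Tm pc t j b u) = (pc < N \<and> t < 2 \<and> j < R \<and> b < 2 \<and> u < 4)"
| "is_vert N R (Ex i s \<tau>) = (i < R \<and> s < 2 \<and> \<tau> < 2)"
| "is_vert N R (Xt i s \<tau>) = (i < R \<and> s < 2 \<and> \<tau> < 2)"
| "is_vert N R Dd = True"

text \<open>The first three vertices are fixed: they carry the only edges that depend on the input.\<close>

definition init_verts :: "vert list" where
  "init_verts = [Gd 0 0 0, Rs 0 0 0 1, Rs 0 0 0 0]"

text \<open>The order of the remaining vertices is arbitrary but the same for every input, so it
  contributes only constants to the template.\<close>

definition verts :: "nat \<Rightarrow> nat \<Rightarrow> vert list" where
  "verts N R = init_verts @
     (SOME l. distinct l \<and> set l = {v. is_vert N R v} - set init_verts)"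

lemma finite_is_vert: "finite {v. is_vert N R v}"
proof -
  let ?A = "{..<N + 2 * R + 4}"
  have "{v. is_vert N R v} \<subseteq> (\<lambda>(a, b, c). Ch a b c) ` (?A \<times> ?A \<times> ?A) \<union>
    (\<lambda>(a, b). Bd a b) ` (?A \<times> ?A) \<union> (\<lambda>(a, b). Br a b) ` (?A \<times> ?A) \<union>
    (\<lambda>(a, b, c). Gd a b c) ` (?A \<times> ?A \<times> ?A) \<union> (\<lambda>(a, b, c). Hf a b c) ` (?A \<times> ?A \<times> ?A) \<union>
    (\<lambda>(a, b, c, d). Rs a b c d) ` (?A \<times> ?A \<times> ?A \<times> ?A) \<union>
    (\<lambda>(a, b, c, d, e). Tm a b c d e) ` (?A \<times> ?A \<times> ?A \<times> ?A \<times> ?A) \<union>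
    (\<lambda>(a, b, c). Ex a b c) ` (?A \<times> ?A \<times> ?A) \<union> (\<lambda>(a, b, c). Xt a b c) ` (?A \<times> ?A \<times> ?A) \<union> {Dd}"
    (is "_ \<subseteq> ?B")
  proof
    fix v assume "v \<in> {v. is_vert N R v}"
    then show "v \<in> ?B" by (cases v) (simp_all add: image_iff)
  qed
  then show ?thesis by (rule finite_subset) (intro finite_UnI finite_imageI finite_cartesian_product, simp_all)
qed

definition vidx :: "nat \<Rightarrow> nat \<Rightarrow> vert \<Rightarrow> nat" where
  "vidx N R v = length (takeWhile (\<lambda>u. u \<noteq> v) (verts N R))"

text \<open>Listing edges vertex by vertex puts the two input-dependent ones at the head of
  \<open>nedges\<close>, where \<open>enc_inst_with\<close> expects them. The empty target list is
  the one of player 1.\<close>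

definition game :: "instr list \<Rightarrow> nat \<Rightarrow> nat \<Rightarrow> inst" where
  "game P R inp = (let N = length P; ix = vidx N R; vs = verts N R in
     Inst (length vs) (4 * R + 1) (map (owner P) vs)
       (concat (map (\<lambda>v. map (\<lambda>w. (ix v, ix w)) (psucc P R v)) vs))
       (concat (map (\<lambda>v. map (\<lambda>(w, a, b). (ix v, ix w, a, b)) (nsucc R inp v)) vs))
       (ix (Ch 0 0 0))
       (map ix (filter is_exit vs) # [] #
         map (\<lambda>\<kappa>. map ix (filter (pays P (\<kappa> div 4) (\<kappa> div 2 mod 2) (\<kappa> mod 2)) vs)) [0..<4 * R])
       0 1)"

section \<open>Facts about lists and sums\<close>

lemma sum_list_distinct_delta:
  fixes f :: "'a \<Rightarrow> real"
  shows "distinct xs \<Longrightarrow> v \<in> set xs \<Longrightarrow> sum_list (map (\<lambda>u. if u = v then f u else 0) xs) = f v"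
proof (induction xs)
  case (Cons x xs)
  show ?case
  proof (cases "x = v")
    case True
    then have "map (\<lambda>u. if u = v then f u else 0) xs = map (\<lambda>_. 0) xs" using Cons.prems by auto
    then show ?thesis using True by (simp only: list.map sum_list.Cons) simp
  next
    case False
    then show ?thesis using Cons by simp
  qed
qed simp

lemma takeWhile_less: "v \<in> set xs \<Longrightarrow> length (takeWhile (\<lambda>u. u \<noteq> v) xs) < length xs"
  by (induction xs) auto

lemma sum_list_concat: "sum_list (concat (xss :: real list list)) = sum_list (map sum_list xss)"
  by (induction xss) auto

lemma sum_sum_list:
  fixes f :: "'a \<Rightarrow> 'b \<Rightarrow> real"
  shows "(\<Sum>w\<in>A. sum_list (map (f w) xs)) = sum_list (map (\<lambda>y. \<Sum>w\<in>A. f w y) xs)"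
  by (induction xs) (auto simp: sum.distrib)

lemma distinct_map_concat:
  assumes "distinct vs" "\<And>v. v \<in> set vs \<Longrightarrow> distinct (map g (F v))"
    "\<And>u v e e'. u \<in> set vs \<Longrightarrow> v \<in> set vs \<Longrightarrow> u \<noteq> v \<Longrightarrow> e \<in> set (F u) \<Longrightarrow> e' \<in> set (F v) \<Longrightarrow> g e \<noteq> g e'"
  shows "distinct (map g (concat (map F vs)))"
  using assms
proof (induction vs)
  case (Cons u vs)
  have "distinct (map g (concat (map F vs)))"
    using Cons.prems(1) by (intro Cons.IH Cons.prems(2,3)) auto
  moreover have "g ` set (F u) \<inter> g ` set (concat (map F vs)) = {}"
    using Cons.prems(1) Cons.prems(3)[of u] by fastforce
  ultimately show ?case using Cons.prems(2)[of u] by (simp only: list.map concat.simps map_append distinct_append set_map) simp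
qed simp

section \<open>Well-formedness of the game\<close>

locale arena =
  fixes P :: "instr list" and R inp :: nat
  assumes ok: "machine_ok P R"
begin

abbreviation "N \<equiv> length P"
abbreviation "ix \<equiv> vidx N R"
abbreviation "G \<equiv> game P R inp"
abbreviation "lz pc \<equiv> ilz (P ! pc)"
abbreviation "lnz pc \<equiv> ilnz (P ! pc)"
abbreviation "isv \<equiv> is_vert N R"

lemma R_pos: "0 < R" and N_pos: "0 < N"
  using ok by (auto simp: machine_ok_def)

lemma instr_ok:
  assumes "pc < N"
  shows "idst (P ! pc) < R" "isrc (P ! pc) < R" "ibr (P ! pc) < R"
    "0 < ilz (P ! pc)" "ilz (P ! pc) < N" "0 < ilnz (P ! pc)" "ilnz (P ! pc) < N"
    "ilz (P ! pc) \<noteq> ilnz (P ! pc) \<Longrightarrow>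
      tests (P ! ilz (P ! pc)) AssertZ (ibr (P ! pc)) \<and> tests (P ! ilnz (P ! pc)) Dec (ibr (P ! pc))"
  using ok nth_mem[OF assms] unfolding machine_ok_def by blast+

lemma verts_spec: "set (verts N R) = {v. isv v}" "distinct (verts N R)"
proof -
  let ?l = "SOME l. distinct l \<and> set l = {v. isv v} - set init_verts"
  have "\<exists>l. distinct l \<and> set l = {v. isv v} - set init_verts"
    using finite_distinct_list[of "{v. isv v} - set init_verts"] finite_is_vert by auto
  then have l: "distinct ?l" "set ?l = {v. isv v} - set init_verts" by (metis (mono_tags, lifting) someI_ex)+
  have "set init_verts \<subseteq> {v. isv v}" using R_pos N_pos by (auto simp: init_verts_def)
  then show "set (verts N R) = {v. isv v}" unfolding verts_def set_append l(2) by blast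
  show "distinct (verts N R)" unfolding verts_def distinct_append l(2) using l(1)
    by (auto simp: init_verts_def)
qed

lemmas set_verts = verts_spec(1) and distinct_verts = verts_spec(2)

lemma ix_less: "isv v \<Longrightarrow> ix v < length (verts N R)"
  unfolding vidx_def using set_verts by (intro takeWhile_less) auto

lemma nth_ix: "isv v \<Longrightarrow> verts N R ! ix v = v"
  using nth_length_takeWhile[of "\<lambda>u. u \<noteq> v" "verts N R"] ix_less[of v] by (simp add: vidx_def)

lemma ix_inj: "isv v \<Longrightarrow> isv w \<Longrightarrow> ix v = ix w \<longleftrightarrow> v = w"
  by (metis nth_ix)

lemma less_ix: "n < length (verts N R) \<Longrightarrow> \<exists>v. isv v \<and> n = ix v"
proof -
  assume n: "n < length (verts N R)"
  then have v: "isv (verts N R ! n)" using nth_mem[of n "verts N R"] set_verts by auto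
  then have "ix (verts N R ! n) = n"
    using nth_ix[OF v] ix_less[OF v] n distinct_verts by (simp add: nth_eq_iff_index_eq)
  then show ?thesis using v by metis
qed

lemma game_sel:
  "nv G = length (verts N R)" "np G = 4 * R + 1" "own G = map (owner P) (verts N R)"
  "pedges G = concat (map (\<lambda>v. map (\<lambda>w. (ix v, ix w)) (psucc P R v)) (verts N R))"
  "nedges G = concat (map (\<lambda>v. map (\<lambda>(w, a, b). (ix v, ix w, a, b)) (nsucc R inp v)) (verts N R))"
  "v0 G = ix (Ch 0 0 0)" "mu_num G = 0" "mu_den G = 1"
  "targ G = map ix (filter is_exit (verts N R)) # [] #
     map (\<lambda>\<kappa>. map ix (filter (pays P (\<kappa> div 4) (\<kappa> div 2 mod 2) (\<kappa> mod 2)) (verts N R))) [0..<4 * R]"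
  by (simp_all add: game_def Let_def)

lemma ix_nv: "isv v \<Longrightarrow> ix v < nv G"
  using ix_less by (simp add: game_sel)

lemma own_ix: "isv v \<Longrightarrow> own G ! ix v = owner P v"
  using ix_less nth_ix by (simp add: game_sel)

lemma isv_chain: "pc < N \<Longrightarrow> t < 2 \<Longrightarrow> isv (chain R pc t m)"
  by (simp add: chain_def)

lemma isv_psucc: "isv v \<Longrightarrow> w \<in> set (psucc P R v) \<Longrightarrow> isv w"
  using R_pos by (cases v) (auto simp: isv_chain instr_ok split: if_splits)

lemma isv_nsucc: "isv v \<Longrightarrow> (w, a, b) \<in> set (nsucc R inp v) \<Longrightarrow> isv w"
  using R_pos N_pos by (cases v) (auto split: if_splits)

lemma owner_psucc: "owner P v \<noteq> 0 \<longleftrightarrow> psucc P R v \<noteq> []"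
  by (cases v) auto

lemma owner_nsucc: "owner P v = 0 \<longleftrightarrow> nsucc R inp v \<noteq> []"
  by (cases v) auto

lemma player_less: "i < R \<Longrightarrow> s < 2 \<Longrightarrow> \<tau> < 2 \<Longrightarrow> player i s \<tau> \<le> np G"
  by (simp add: player_def game_sel)

lemma owner_le: "isv v \<Longrightarrow> owner P v \<le> Suc (np G)"
  using R_pos by (cases v) (auto intro!: player_less[unfolded game_sel(2), simplified] instr_ok simp: game_sel(2))

lemma nprob_ix:
  assumes v: "isv v"
  shows "nprob G (ix v) w = sum_list (map (\<lambda>(w', a, b). if ix w' = w then real a / real b else 0) (nsucc R inp v))"
proof -
  let ?g = "\<lambda>(v', w', a, b). if v' = ix v \<and> w' = w then real a / real b else 0"
  have *: "sum_list (map ?g (map (\<lambda>(w, a, b). (ix u, ix w, a, b)) (nsucc R inp u)))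
     = (if u = v then sum_list (map (\<lambda>(w', a, b). if ix w' = w then real a / real b else 0) (nsucc R inp u)) else 0)"
    if "u \<in> set (verts N R)" for u
  proof -
    have u: "ix u = ix v \<longleftrightarrow> u = v" using that v ix_inj set_verts by auto
    show ?thesis
      by (cases "u = v") (auto simp: u o_def case_prod_unfold intro!: arg_cong[where f = sum_list])
  qed
  have "nprob G (ix v) w = sum_list (map (\<lambda>u. sum_list (map ?g (map (\<lambda>(w, a, b). (ix u, ix w, a, b)) (nsucc R inp u)))) (verts N R))"
    unfolding nprob_def game_sel map_concat sum_list_concat by (simp add: o_def)
  also have "\<dots> = sum_list (map (\<lambda>u. if u = v then sum_list (map (\<lambda>(w', a, b). if ix w' = w then real a / real b else 0) (nsucc R inp u)) else 0) (verts N R))"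
    using * by (intro arg_cong[where f = sum_list] map_cong) auto
  also have "\<dots> = sum_list (map (\<lambda>(w', a, b). if ix w' = w then real a / real b else 0) (nsucc R inp v))"
    using v set_verts distinct_verts by (subst sum_list_distinct_delta) auto
  finally show ?thesis .
qed

lemma nature_sum:
  assumes v: "isv v"
  shows "(\<Sum>w<nv G. nprob G (ix v) w * F w) = sum_list (map (\<lambda>(w, a, b). real a / real b * F (ix w)) (nsucc R inp v))"
proof -
  have "(\<Sum>w<nv G. nprob G (ix v) w * F w)
    = (\<Sum>w<nv G. sum_list (map (\<lambda>(w', a, b). if ix w' = w then real a / real b * F w else 0) (nsucc R inp v)))"
    unfolding nprob_ix[OF v] sum_list_mult_const[symmetric]
    by (intro sum.cong refl arg_cong[where f = sum_list] map_cong) auto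
  also have "\<dots> = sum_list (map (\<lambda>y. \<Sum>w<nv G. (case y of (w', a, b) \<Rightarrow> if ix w' = w then real a / real b * F w else 0)) (nsucc R inp v))"
    by (rule sum_sum_list)
  also have "\<dots> = sum_list (map (\<lambda>(w, a, b). real a / real b * F (ix w)) (nsucc R inp v))"
  proof (intro arg_cong[where f = sum_list] map_cong refl)
    fix y assume "y \<in> set (nsucc R inp v)"
    then obtain w' a b where y: "y = (w', a, b)" "isv w'" using isv_nsucc[OF v] by (metis prod_cases3)
    then show "(\<Sum>w<nv G. (case y of (w', a, b) \<Rightarrow> if ix w' = w then real a / real b * F w else 0))
       = (case y of (w, a, b) \<Rightarrow> real a / real b * F (ix w))"
      using ix_nv by simp
  qed
  finally show ?thesis .
qed

lemma nsucc_total: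
  assumes "isv v" "owner P v = 0"
  shows "sum_list (map (\<lambda>(w, a, b). real a / real b) (nsucc R inp v)) = 1"
proof (cases v)
  case (Bd pc t)
  have "sum_list (map (\<lambda>(w, a, b). real a / real b) (map (\<lambda>j. (Gd pc t j, 1, 2 * R)) [0..<R])) = R * (1 / (2 * R))"
    by (simp add: o_def sum_list_triv)
  then show ?thesis using Bd R_pos by simp
next
  case (Ex i s \<tau>)
  \<comment> \<open>As \<open>R\<close> is positive, the truncated subtraction in the weight of
    \<open>Dd\<close> is exact.\<close>
  have "2 - s + (3 * R + s - 2) = 3 * R" using assms Ex R_pos by auto
  then have "real (2 - s) + real (3 * R + s - 2) = 3 * real R" by (metis of_nat_add of_nat_mult of_nat_numeral)
  then show ?thesis using Ex R_pos by (simp add: add_divide_distrib[symmetric])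
next
  case (Gd pc t j)
  have "(1::real) / 2 ^ inp + (2 ^ inp - 1) / 2 ^ inp = 1" by (simp add: add_divide_distrib[symmetric])
  then show ?thesis using Gd assms by (auto simp: of_nat_diff split: if_splits)
qed (use assms in auto)

lemma set_pedges: "isv v \<Longrightarrow> (ix v, w) \<in> set (pedges G) \<longleftrightarrow> w \<in> ix ` set (psucc P R v)"
proof
  assume v: "isv v"
  show "w \<in> ix ` set (psucc P R v)" if e: "(ix v, w) \<in> set (pedges G)"
  proof -
    from e obtain u w' where "isv u" "w' \<in> set (psucc P R u)" "ix u = ix v" "w = ix w'"
      unfolding game_sel using set_verts by auto
    then show ?thesis using v ix_inj by auto
  qed
  show "(ix v, w) \<in> set (pedges G)" if "w \<in> ix ` set (psucc P R v)"
    unfolding game_sel using that v set_verts by auto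
qed

lemma nxt_player: "isv v \<Longrightarrow> owner P v \<noteq> 0 \<Longrightarrow> nxt G (ix v) = ix ` set (psucc P R v)"
  using own_ix set_pedges by (auto simp: nxt_def)

definition sink :: "vert \<Rightarrow> bool" where
  "sink v \<longleftrightarrow> isv v \<and> nsucc R inp v = [(v, 1, 1)]"

lemma sink_simps [simp]:
  "sink (Tm pc t j b u) \<longleftrightarrow> isv (Tm pc t j b u)" "sink (Xt i s \<tau>) \<longleftrightarrow> isv (Xt i s \<tau>)" "sink Dd"
  by (auto simp: sink_def)

lemma nprob_sink: "sink v \<Longrightarrow> nprob G (ix v) w = (if w = ix v then 1 else 0)"
  by (auto simp: nprob_ix sink_def)

lemma owner_sink: "sink v \<Longrightarrow> owner P v = 0"
  using owner_nsucc[of v] by (simp add: sink_def)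

lemma terminal_sink: "sink v \<Longrightarrow> terminal G (ix v)"
  using own_ix[of v] owner_sink[of v] by (auto simp: terminal_def nxt_def nprob_sink) (auto simp: sink_def)

lemma target_0: "target G 0 = ix ` {v. isv v \<and> is_exit v}"
  using set_verts by (simp add: target_def game_sel)

lemma target_1: "target G (Suc 0) = {}"
  by (simp add: target_def game_sel)

lemma target_player:
  assumes "i < R" "s < 2" "\<tau> < 2"
  shows "target G (player i s \<tau>) = ix ` {v. isv v \<and> pays P i s \<tau> v}"
proof -
  let ?\<kappa> = "4 * i + 2 * s + \<tau>"
  have "?\<kappa> = 2 * (2 * i + s) + \<tau>" by simp
  then have "?\<kappa> div 2 = 2 * i + s" "?\<kappa> mod 2 = \<tau>" using assms by presburger+
  moreover have "(2 * i + s) div 2 = i" "(2 * i + s) mod 2 = s" using assms by presburger+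
  moreover have "?\<kappa> div 2 div 2 = ?\<kappa> div 4" by (simp add: div_mult2_eq[symmetric])
  ultimately have k: "?\<kappa> < 4 * R" "?\<kappa> div 4 = i" "?\<kappa> div 2 mod 2 = s" "?\<kappa> mod 2 = \<tau>"
    using assms by auto
  have "targ G ! player i s \<tau> = map ix (filter (pays P i s \<tau>) (verts N R))"
    using k unfolding player_def game_sel by (simp add: k)
  then show ?thesis using set_verts by (simp add: target_def)
qed

lemma player_cases:
  assumes "i \<le> np G"
  obtains "i = 0" | "i = 1" | j s \<tau> where "i = player j s \<tau>" "j < R" "s < 2" "\<tau> < 2"
proof -
  consider "i = 0" | "i = 1" | "i \<ge> 2" by linarith
  then show thesis
  proof cases
    case 3
    define \<kappa> where "\<kappa> = i - 2"
    have "\<kappa> < 4 * R" using assms 3 by (simp add: \<kappa>_def game_sel)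
    then have "\<kappa> div 4 < R" by (simp add: less_mult_imp_div_less mult.commute)
    moreover have "i = player (\<kappa> div 4) (\<kappa> div 2 mod 2) (\<kappa> mod 2)"
    proof -
      have "\<kappa> = 2 * (\<kappa> div 2) + \<kappa> mod 2" "\<kappa> div 2 = 2 * (\<kappa> div 2 div 2) + \<kappa> div 2 mod 2" by simp_all
      moreover have "\<kappa> div 2 div 2 = \<kappa> div 4" by (simp add: div_mult2_eq[symmetric])
      ultimately have "\<kappa> = 4 * (\<kappa> div 4) + 2 * (\<kappa> div 2 mod 2) + \<kappa> mod 2" by linarith
      then show ?thesis using 3 by (simp add: player_def \<kappa>_def)
    qed
    ultimately show thesis by (intro that(3)) auto
  qed (use that in auto)
qed

lemma pays_sink: "isv v \<Longrightarrow> pays P i s \<tau> v \<Longrightarrow> sink v"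
  by (cases v) auto

lemma exit_sink: "isv v \<Longrightarrow> is_exit v \<Longrightarrow> sink v"
  by (cases v) auto

lemma distinct_nsucc: "isv v \<Longrightarrow> distinct (map fst (nsucc R inp v))"
  by (cases v) (auto simp: o_def distinct_map inj_on_def)

lemma wf_game: "wf_inst G"
  unfolding wf_inst_def
proof (intro conjI)
  show "length (own G) = nv G" by (simp add: game_sel)
  show "v0 G < nv G" using ix_less[of "Ch 0 0 0"] R_pos N_pos by (simp add: game_sel)
  show "\<forall>v<nv G. own G ! v \<le> Suc (np G)"
    using less_ix own_ix owner_le by (metis game_sel(1))
  show "\<forall>(v, w)\<in>set (pedges G). v < nv G \<and> w < nv G \<and> own G ! v \<noteq> 0"
  proof clarify
    fix a b assume "(a, b) \<in> set (pedges G)"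
    then obtain v w where v: "isv v" "w \<in> set (psucc P R v)" "a = ix v" "b = ix w"
      unfolding game_sel using set_verts by auto
    then have "isv w" "owner P v \<noteq> 0" using isv_psucc owner_psucc by auto
    then show "a < nv G \<and> b < nv G \<and> own G ! a \<noteq> 0" using v ix_nv own_ix by simp
  qed
  show "\<forall>(v, w, a, b)\<in>set (nedges G). v < nv G \<and> w < nv G \<and> own G ! v = 0 \<and> b > 0"
  proof clarify
    fix x y a b assume "(x, y, a, b) \<in> set (nedges G)"
    then obtain v w where v: "isv v" "(w, a, b) \<in> set (nsucc R inp v)" "x = ix v" "y = ix w"
      unfolding game_sel using set_verts by auto
    then have "isv w" "owner P v = 0" using isv_nsucc owner_nsucc by (auto simp del: nsucc.simps)
    moreover have "b > 0" using v(1,2) R_pos by (cases v) (auto split: if_splits)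
    ultimately show "x < nv G \<and> y < nv G \<and> own G ! x = 0 \<and> b > 0" using v ix_nv own_ix by simp
  qed
  show "distinct (map (\<lambda>(v, w, a, b). (v, w)) (nedges G))"
    unfolding game_sel
  proof (rule distinct_map_concat)
    show "distinct (verts N R)" by (rule distinct_verts)
    fix v assume "v \<in> set (verts N R)"
    then have v: "isv v" using set_verts by auto
    have "inj_on ix (set (map fst (nsucc R inp v)))"
      using isv_nsucc[OF v] ix_inj by (intro inj_onI) auto
    then have "distinct (map ix (map fst (nsucc R inp v)))"
      using distinct_nsucc[OF v] by (simp only: distinct_map)
    then have "distinct (map (Pair (ix v)) (map ix (map fst (nsucc R inp v))))"
      unfolding distinct_map[of "Pair (ix v)"] by (auto simp: inj_on_def)
    then show "distinct (map (\<lambda>(v, w, a, b). (v, w)) (map (\<lambda>(w, a, b). (ix v, ix w, a, b)) (nsucc R inp v)))"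
      by (simp add: o_def case_prod_unfold)
  next
    fix u v e e' assume "u \<in> set (verts N R)" "v \<in> set (verts N R)" "u \<noteq> v"
      "e \<in> set (map (\<lambda>(w, a, b). (ix u, ix w, a, b)) (nsucc R inp u))"
      "e' \<in> set (map (\<lambda>(w, a, b). (ix v, ix w, a, b)) (nsucc R inp v))"
    then show "(case e of (v, w, a, b) \<Rightarrow> (v, w)) \<noteq> (case e' of (v, w, a, b) \<Rightarrow> (v, w))"
      using ix_inj set_verts by auto
  qed
  have sum1: "(\<Sum>w<nv G. nprob G (ix v) w) = 1" if "isv v" "owner P v = 0" for v
    using nature_sum[OF that(1), of "\<lambda>_. 1"] nsucc_total[OF that] by simp
  then show "\<forall>v<nv G. own G ! v = 0 \<longrightarrow> (\<Sum>w<nv G. nprob G v w) = 1"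
    using less_ix own_ix by (metis game_sel(1))
  show "\<forall>v<nv G. nxt G v \<noteq> {}"
  proof (intro allI impI)
    fix n assume "n < nv G"
    then obtain v where v: "isv v" "n = ix v" using less_ix by (auto simp: game_sel)
    show "nxt G n \<noteq> {}"
    proof (cases "owner P v = 0")
      case True
      then have "\<exists>w. nprob G (ix v) w > 0"
        using sum1[OF v(1)] by (metis sum_nonpos not_le zero_neq_one zero_less_one)
      then show ?thesis using True v own_ix by (auto simp: nxt_def)
    next
      case False
      then show ?thesis using v nxt_player owner_psucc by auto
    qed
  qed
  show "length (targ G) = Suc (np G)" by (simp add: game_sel)
  show "\<forall>i\<le>np G. \<forall>v\<in>target G i. v < nv G \<and> terminal G v"
  proof (intro allI impI)
    fix i assume "i \<le> np G"
    then show "\<forall>v\<in>target G i. v < nv G \<and> terminal G v"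
    proof (cases rule: player_cases)
      case 1
      then show ?thesis using target_0 ix_nv terminal_sink exit_sink by auto
    next
      case 2
      then show ?thesis using target_1 by simp
    next
      case (3 j s \<tau>)
      then show ?thesis using target_player ix_nv terminal_sink pays_sink by auto
    qed
  qed
qed (simp_all add: game_sel)

lemma ix_init: "ix (Gd 0 0 0) = 0" "ix (Rs 0 0 0 1) = 1" "ix (Rs 0 0 0 0) = 2"
  by (simp_all add: vidx_def verts_def init_verts_def)

end

text \<open>Only the edges of \<open>Gd 0 0 0\<close> mention the input, and these are the two that
  \<open>enc_inst_with\<close> supplies. Everything else is frozen by reading it off the game with
  input 0.\<close>

lemma enc_game:
  assumes "machine_ok P R"
  shows "\<exists>zs. length zs = 6 \<and> (\<forall>inp. enc_inst (game P R inp) = enc_inst_with zs inp)"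
proof -
  interpret arena P R 0 by unfold_locales (rule assms)
  define L where "L = tl (verts N R)"
  have vs: "verts N R = Gd 0 0 0 # L" by (simp add: L_def verts_def init_verts_def)
  have notin: "Gd 0 0 0 \<notin> set L" using distinct_verts by (simp add: vs)
  define f where "f = (\<lambda>inp v. map (\<lambda>(w, a, b). (ix v, ix w, a, b)) (nsucc R inp v))"
  have nsucc_eq: "nsucc R inp v = nsucc R 0 v" if "v \<noteq> Gd 0 0 0" for v inp using that by (cases v) auto
  have "f inp v = f 0 v" if "v \<in> set L" for inp v
    unfolding f_def using nsucc_eq[of v inp] that notin by (metis (no_types, lifting))
  then have fL: "concat (map (f inp) L) = concat (map (f 0) L)" for inp
    by (intro arg_cong[where f = concat] map_cong refl)
  have ne: "nedges (game P R inp) = (0, 1, 1, 2 ^ inp) # (0, 2, 2 ^ inp - 1, 2 ^ inp) # concat (map (f 0) L)" for inp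
  proof -
    have "nedges (game P R inp) = f inp (Gd 0 0 0) @ concat (map (f inp) L)"
      by (simp add: game_def Let_def f_def vs)
    then show ?thesis using ix_init unfolding fL[of inp] by (simp add: f_def)
  qed
  let ?e = "\<lambda>(a, b, c, d). list_encode [a, b, c, d]"
  let ?zs = "[nv G, np G, list_encode (own G), list_encode (map prod_encode (pedges G)),
    list_encode (map ?e (concat (map (f 0) L))),
    list_encode [v0 G, list_encode (map list_encode (targ G)), 0, 1]]"
  have same: "nv (game P R inp) = nv G" "np (game P R inp) = np G" "own (game P R inp) = own G"
    "pedges (game P R inp) = pedges G" "v0 (game P R inp) = v0 G" "targ (game P R inp) = targ G"
    "mu_num (game P R inp) = 0" "mu_den (game P R inp) = 1" for inp
    by (simp_all add: game_def Let_def)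
  have "enc_inst (game P R inp) = enc_inst_with ?zs inp" for inp
    unfolding enc_inst_def same[of inp] ne enc_inst_with_def by simp
  then show ?thesis by (intro exI[of _ ?zs]) simp
qed

section \<open>Values in the game\<close>

text \<open>Interpolates \<open>quarters\<close> linearly: the winning probability inside a gadget
  that gives result 1 with probability \<open>x\<close>.\<close>

definition phi :: "nat \<Rightarrow> op \<Rightarrow> real \<Rightarrow> real" where
  "phi s o' x = (let r = (real (quarters o' 0) * (1 - x) + real (quarters o' 1) * x) / 4 in
     if s = 0 then r else 1 - r)"

text \<open>Stands in for uniqueness of fixed points: each step of the game and each round of a
  gadget goes on with probability at most \<open>1 / 2\<close>, so estimates hold up to an error
  that at least halves with every unfolding.\<close>

lemma le_if_le_add_half_power:
  fixes a b c :: real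
  assumes "\<And>n. a \<le> b + c * (1 / 2) ^ n"
  shows "a \<le> b"
proof -
  have "(\<lambda>n. b + c * (1 / 2) ^ n) \<longlonglongrightarrow> b + c * 0"
    by (intro tendsto_intros LIMSEQ_realpow_zero) auto
  then have "a \<le> b + c * 0" using assms by (meson LIMSEQ_le_const)
  then show ?thesis by simp
qed

lemma phi_simps [simp]:
  "phi 0 Keep x = 1 - x / 2" "phi 0 Inc x = 1 - x / 4" "phi 0 Dec x = 1 - x" "phi 0 Zero x = 1 / 2"
  "phi 0 AssertZ x = x / 2"
  by (simp_all add: phi_def field_simps)

text \<open>Encoding \<open>n\<close> as \<open>1 / 2 ^ n\<close>, the map \<open>2 * (1 - phi 0 o x)\<close> is \<open>x\<close>, \<open>x / 2\<close>, \<open>2 * x\<close>, \<open>1\<close>,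
  \<open>2 - x\<close> for the five operations.\<close>

lemma exec1_phi:
  assumes "legal P cf"
  shows "2 * (1 - phi 0 (reg_op (P ! fst cf) i) (1 / 2 ^ snd cf (src_reg (P ! fst cf) i)))
    = 1 / 2 ^ snd (exec1 P cf) i"
proof (cases "i = idst (P ! fst cf)")
  case False
  then show ?thesis by (simp add: reg_op_def src_reg_def exec1_def Let_def)
next
  case True
  let ?n = "snd cf (isrc (P ! fst cf))"
  show ?thesis
  proof (cases "iop (P ! fst cf)")
    case Dec
    then obtain k where "?n = Suc k" using assms by (auto simp: legal_def gr0_conv_Suc)
    then show ?thesis using Dec True by (simp add: reg_op_def src_reg_def exec1_def Let_def)
  next
    case AssertZ
    then have "?n = 0" using assms by (simp add: legal_def)
    then show ?thesis using AssertZ True by (simp add: reg_op_def src_reg_def exec1_def Let_def)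
  qed (use True in \<open>simp_all add: reg_op_def src_reg_def exec1_def Let_def\<close>)
qed

context arena
begin

text \<open>A history that arrives at \<open>Ch pc t 0\<close> is given by the part \<open>g\<close> before that vertex.\<close>

definition before_chain :: "nat list \<Rightarrow> nat \<Rightarrow> nat \<Rightarrow> nat \<Rightarrow> nat list" where
  "before_chain g pc t m = g @ map (\<lambda>k. ix (Ch pc t k)) [0..<m]"

definition before_br :: "nat list \<Rightarrow> nat \<Rightarrow> nat \<Rightarrow> nat list" where
  "before_br g pc t = before_chain g pc t (2 * R) @ [ix (Bd pc t)]"

definition after_br :: "nat list \<Rightarrow> nat \<Rightarrow> nat \<Rightarrow> nat list" where
  "after_br g pc t = before_br g pc t @ [ix (Br pc t)]"

lemma before_chain_Suc: "before_chain g pc t (Suc m) = before_chain g pc t m @ [ix (Ch pc t m)]"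
  by (simp add: before_chain_def)

lemma before_chain_0: "before_chain g pc t 0 = g"
  by (simp add: before_chain_def)

end

locale arena_play = arena +
  fixes \<sigma> :: profile
  assumes vp: "valid_profile G \<sigma>"
begin

definition val :: "nat set \<Rightarrow> nat list \<Rightarrow> vert \<Rightarrow> real" where
  "val F h v = reach_val G \<sigma> F (h @ [ix v])"

lemma val_nonneg: "isv v \<Longrightarrow> 0 \<le> val F h v"
  and val_le_1: "isv v \<Longrightarrow> val F h v \<le> 1"
  unfolding val_def using reach_val_nonneg[OF vp] reach_val_le_1[OF vp] ix_nv by auto

lemma val_in: "ix v \<in> F \<Longrightarrow> val F h v = 1"
  by (simp add: val_def reach_val_in)

lemma val_nature:
  assumes "isv v" "owner P v = 0" "ix v \<notin> F"
  shows "val F h v = sum_list (map (\<lambda>(w, a, b). real a / real b * val F (h @ [ix v]) w) (nsucc R inp v))"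
proof -
  have "step G \<sigma> (h @ [ix v]) w = nprob G (ix v) w" for w
    using own_ix assms by (simp add: step_def)
  then have "val F h v = (\<Sum>w<nv G. nprob G (ix v) w * reach_val G \<sigma> F ((h @ [ix v]) @ [w]))"
    unfolding val_def using assms ix_nv by (subst reach_val_unfold[OF vp]) auto
  then show ?thesis unfolding nature_sum[OF assms(1)] by (simp add: val_def)
qed

lemma val_sink:
  assumes "sink v"
  shows "val F h v = (if ix v \<in> F then 1 else 0)"
proof (cases "ix v \<in> F")
  case True
  then show ?thesis by (simp add: val_in)
next
  case False
  have v: "isv v" using assms by (simp add: sink_def)
  have st: "step G \<sigma> (h @ [ix v]) w = (if w = ix v then 1 else 0)" for h w
    using own_ix[OF v] owner_sink[OF assms] nprob_sink[OF assms] by (simp add: step_def)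
  have "reach_within G \<sigma> F n (h @ [ix v]) = 0" for n
  proof (induction n arbitrary: h)
    case (Suc n)
    have "reach_within G \<sigma> F n ((h @ [ix v]) @ [ix v]) = 0" by (rule Suc)
    then show ?case using False by (auto simp: st intro!: sum.neutral)
  qed (use False in simp)
  then show ?thesis using False by (simp add: val_def reach_val_def)
qed

lemma step_support:
  assumes v: "isv v" and own: "owner P v \<noteq> 0" and w: "w \<notin> ix ` set (psucc P R v)"
  shows "step G \<sigma> (h @ [ix v]) w = 0"
proof -
  define i where "i = owner P v - 1"
  have i: "owner P v = Suc i" "i \<le> np G" using own owner_le[OF v] by (auto simp: i_def)
  have "at_player G i (h @ [ix v])" using i own_ix[OF v] ix_nv[OF v] by (simp add: at_player_def)
  moreover have "valid_strat G i (\<sigma> i)" using vp i by (simp add: valid_profile_def)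
  ultimately have "set_pmf (\<sigma> i (h @ [ix v])) \<subseteq> nxt G (ix v)" unfolding valid_strat_def by force
  then have "w \<notin> set_pmf (\<sigma> i (h @ [ix v]))" using nxt_player[OF v own] w by auto
  then show ?thesis using i own_ix[OF v] by (simp add: step_def set_pmf_iff)
qed

text \<open>The two listed successors may coincide, namely at a jump that does not branch; then
  \<open>q = 1\<close>, and the averaging formula covers both situations.\<close>

lemma val_player:
  fixes h :: "nat list"
  assumes v: "isv v" and ps: "psucc P R v = [w1, w2]" and F: "ix v \<notin> F"
  defines "q \<equiv> step G \<sigma> (h @ [ix v]) (ix w1)"
  shows "val F h v = q * val F (h @ [ix v]) w1 + (1 - q) * val F (h @ [ix v]) w2"
    and "0 \<le> q" "q \<le> 1" "w1 \<noteq> w2 \<Longrightarrow> step G \<sigma> (h @ [ix v]) (ix w2) = 1 - q" "w1 = w2 \<Longrightarrow> q = 1"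
proof -
  let ?h = "h @ [ix v]"
  have own: "owner P v \<noteq> 0" using owner_psucc ps by simp
  have w: "isv w1" "isv w2" using isv_psucc[OF v] ps by auto
  have sub: "{ix w1, ix w2} \<subseteq> {..<nv G}" using w ix_nv by auto
  have zero: "\<forall>u\<in>{..<nv G} - {ix w1, ix w2}. step G \<sigma> ?h u = 0"
    using step_support[OF v own] ps by auto
  have sum: "(\<Sum>u<nv G. step G \<sigma> ?h u * f u) = (\<Sum>u\<in>{ix w1, ix w2}. step G \<sigma> ?h u * f u)" for f
    using sub zero by (intro sum.mono_neutral_right) auto
  have one: "(\<Sum>u\<in>{ix w1, ix w2}. step G \<sigma> ?h u) = 1"
    using sum[of "\<lambda>_. 1"] step_sum[OF vp, of ?h] ix_nv[OF v] by simp
  have eq: "val F h v = (\<Sum>u\<in>{ix w1, ix w2}. step G \<sigma> ?h u * reach_val G \<sigma> F (?h @ [u]))"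
    unfolding sum[symmetric] unfolding val_def using F ix_nv[OF v] by (subst reach_val_unfold[OF vp]) auto
  show "w1 = w2 \<Longrightarrow> q = 1" using one by (simp add: q_def)
  show *: "w1 \<noteq> w2 \<Longrightarrow> step G \<sigma> ?h (ix w2) = 1 - q" using one w ix_inj by (simp add: q_def)
  show "0 \<le> q" by (simp add: q_def step_nonneg)
  show "q \<le> 1" using one * step_nonneg[of G \<sigma> ?h "ix w2"] by (cases "w1 = w2") (auto simp: q_def)
  show "val F h v = q * val F ?h w1 + (1 - q) * val F ?h w2"
  proof (cases "w1 = w2")
    case True
    then show ?thesis using eq one by (simp add: q_def val_def)
  next
    case False
    then show ?thesis using eq * w ix_inj by (simp add: q_def val_def)
  qed
qed

section \<open>Values of gadgets, exits and single steps\<close>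

definition tset :: "(vert \<Rightarrow> bool) \<Rightarrow> nat set" where
  "tset Q = ix ` {v. isv v \<and> Q v}"

lemma in_tset: "isv v \<Longrightarrow> ix v \<in> tset Q \<longleftrightarrow> Q v"
  using ix_inj by (auto simp: tset_def)

definition sinks_only :: "(vert \<Rightarrow> bool) \<Rightarrow> bool" where
  "sinks_only Q \<longleftrightarrow> (\<forall>v. isv v \<longrightarrow> Q v \<longrightarrow> sink v)"

lemma not_sink [simp]:
  "\<not> sink (Ch pc t m)" "\<not> sink (Bd pc t)" "\<not> sink (Br pc t)" "\<not> sink (Gd pc t j)" "\<not> sink (Hf pc t j)"
  "\<not> sink (Rs pc t j b)" "\<not> sink (Ex i s \<tau>)"
  by (auto simp: sink_def)

lemma notin_tset: "sinks_only Q \<Longrightarrow> isv v \<Longrightarrow> \<not> sink v \<Longrightarrow> ix v \<notin> tset Q"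
  using in_tset by (auto simp: sinks_only_def)

definition rate :: "(vert \<Rightarrow> bool) \<Rightarrow> nat \<Rightarrow> nat \<Rightarrow> nat \<Rightarrow> nat \<Rightarrow> real" where
  "rate Q pc t j b = (of_bool (Q (Tm pc t j b 0)) + of_bool (Q (Tm pc t j b 1))
     + of_bool (Q (Tm pc t j b 2)) + of_bool (Q (Tm pc t j b 3))) / 4"

lemma rate_bounds: "0 \<le> rate Q pc t j b" "rate Q pc t j b \<le> 1"
  by (auto simp: rate_def of_bool_def)

lemma val_Rs:
  assumes "sinks_only Q" "isv (Rs pc t j b)"
  shows "val (tset Q) h (Rs pc t j b) = rate Q pc t j b"
proof -
  have "val (tset Q) h' (Tm pc t j b u) = of_bool (Q (Tm pc t j b u))" if "u < 4" for h' u
    using assms(2) that in_tset[of "Tm pc t j b u"] by (simp add: val_sink)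
  then show ?thesis
    using assms notin_tset[OF assms] by (subst val_nature) (simp_all add: rate_def)
qed

text \<open>The probability of result 1 after the given history, expressed as a reachability value.
  The \<open>Rs\<close> vertex is not terminal, so this set is no player's objective; it only
  measures what the gadget does.\<close>

definition claim :: "nat list \<Rightarrow> nat \<Rightarrow> nat \<Rightarrow> nat \<Rightarrow> real" where
  "claim h pc t j = val {ix (Rs pc t j 1)} h (Gd pc t j)"

lemma claim_bounds: "isv (Gd pc t j) \<Longrightarrow> 0 \<le> claim h pc t j" "isv (Gd pc t j) \<Longrightarrow> claim h pc t j \<le> 1"
  unfolding claim_def using val_nonneg val_le_1 by auto

lemma val_Rs0:
  assumes "isv (Gd pc t j)"
  shows "val {ix (Rs pc t j 1)} h (Rs pc t j 0) = 0"
proof -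
  have v: "isv (Rs pc t j 0)" "isv (Rs pc t j 1)" using assms by auto
  have "val {ix (Rs pc t j 1)} h' (Tm pc t j 0 u) = 0" if "u < 4" for h' u
    using assms that v ix_inj[of "Tm pc t j 0 u" "Rs pc t j 1"] by (simp add: val_sink)
  then show ?thesis using v ix_inj[OF v] by (subst val_nature) simp_all
qed

lemma claim_init:
  assumes "j < R"
  shows "claim h 0 0 j = (if j = 0 then 1 / 2 ^ inp else 1)"
proof -
  have v: "isv (Gd 0 0 j)" "isv (Rs 0 0 j 1)" using assms N_pos by auto
  have ne: "ix (Gd 0 0 j) \<notin> {ix (Rs 0 0 j 1)}" using ix_inj[OF v] by simp
  show ?thesis
    unfolding claim_def using v ne val_Rs0[OF v(1)] by (subst val_nature) (auto simp: val_in)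
qed

lemma gadget_unfold:
  fixes h :: "nat list"
  assumes v: "isv (Gd pc t j)" and F: "ix (Gd pc t j) \<notin> F" "ix (Hf pc t j) \<notin> F" and p: "\<not> (pc = 0 \<and> t = 0)"
  defines "q \<equiv> step G \<sigma> (h @ [ix (Gd pc t j)]) (ix (Rs pc t j 1))"
  shows "val F h (Gd pc t j) = q * val F (h @ [ix (Gd pc t j)]) (Rs pc t j 1)
    + (1 - q) / 2 * (val F (h @ [ix (Gd pc t j), ix (Hf pc t j)]) (Gd pc t j)
      + val F (h @ [ix (Gd pc t j), ix (Hf pc t j)]) (Rs pc t j 0))"
    and "0 \<le> q" "q \<le> 1"
proof -
  have ps: "psucc P R (Gd pc t j) = [Rs pc t j 1, Hf pc t j]" using p by auto
  note vpl = val_player[OF v ps F(1), of h, folded q_def]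
  show "0 \<le> q" "q \<le> 1" using vpl by auto
  have "val F (h @ [ix (Gd pc t j)]) (Hf pc t j) = (val F (h @ [ix (Gd pc t j), ix (Hf pc t j)]) (Gd pc t j)
      + val F (h @ [ix (Gd pc t j), ix (Hf pc t j)]) (Rs pc t j 0)) / 2"
    using v F(2) by (subst val_nature) auto
  then show "val F h (Gd pc t j) = q * val F (h @ [ix (Gd pc t j)]) (Rs pc t j 1)
    + (1 - q) / 2 * (val F (h @ [ix (Gd pc t j), ix (Hf pc t j)]) (Gd pc t j)
      + val F (h @ [ix (Gd pc t j), ix (Hf pc t j)]) (Rs pc t j 0))"
    using vpl(1) by simp
qed

text \<open>Player 1 may use any memory and randomisation, but a round through \<open>Hf\<close>
  returns with probability at most \<open>1 / 2\<close>, so some result is reached almost surely.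
  Formally, the defect \<open>D\<close> of the equation is bounded and each round multiplies it by
  \<open>(1 - q) / 2\<close>.\<close>

lemma gadget_value:
  assumes Q: "sinks_only Q" and v: "isv (Gd pc t j)"
  shows "val (tset Q) h (Gd pc t j) = rate Q pc t j 1 * claim h pc t j + rate Q pc t j 0 * (1 - claim h pc t j)"
proof -
  have vs: "isv (Rs pc t j 0)" "isv (Rs pc t j 1)" "isv (Hf pc t j)" using v by auto
  show ?thesis
  proof (cases "pc = 0 \<and> t = 0")
    case True
    then have j: "j < R" using v by simp
    have "val (tset Q) h (Gd 0 0 j) = rate Q 0 0 j 1 * claim h 0 0 j + rate Q 0 0 j 0 * (1 - claim h 0 0 j)"
      using v notin_tset[OF Q v] val_Rs[OF Q vs(1)] val_Rs[OF Q vs(2)] True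
      by (subst val_nature) (auto simp: claim_init[OF j] of_nat_diff field_simps)
    then show ?thesis using True by simp
  next
    case False
    define D where "D = (\<lambda>h. val (tset Q) h (Gd pc t j) - rate Q pc t j 1 * claim h pc t j
      - rate Q pc t j 0 * (1 - claim h pc t j))"
    let ?e = "[ix (Gd pc t j), ix (Hf pc t j)]"
    have half: "\<bar>D h\<bar> \<le> \<bar>D (h @ ?e)\<bar> / 2" for h
    proof -
      define q where "q = step G \<sigma> (h @ [ix (Gd pc t j)]) (ix (Rs pc t j 1))"
      have A: "val (tset Q) h (Gd pc t j) = q * rate Q pc t j 1
        + (1 - q) / 2 * (val (tset Q) (h @ ?e) (Gd pc t j) + rate Q pc t j 0)"
        and q: "0 \<le> q" "q \<le> 1"
        using gadget_unfold[OF v _ _ False, of "tset Q" h] notin_tset[OF Q v] notin_tset[OF Q vs(3)]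
          val_Rs[OF Q vs(1)] val_Rs[OF Q vs(2)] by (simp_all add: q_def)
      have n: "ix (Gd pc t j) \<notin> {ix (Rs pc t j 1)}" "ix (Hf pc t j) \<notin> {ix (Rs pc t j 1)}"
        using ix_inj[OF v vs(2)] ix_inj[OF vs(3,2)] by auto
      have B: "claim h pc t j = q + (1 - q) / 2 * claim (h @ ?e) pc t j"
        unfolding claim_def
        using gadget_unfold(1)[OF v n False, of h] val_Rs0[OF v] by (simp add: val_in q_def)
      have "D h = (1 - q) / 2 * D (h @ ?e)"
        unfolding D_def A B by (simp add: field_simps)
      then have "\<bar>D h\<bar> = (1 - q) / 2 * \<bar>D (h @ ?e)\<bar>" using q by (simp only: abs_mult) simp
      also have "\<dots> \<le> 1 / 2 * \<bar>D (h @ ?e)\<bar>" using q by (intro mult_right_mono) auto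
      finally show ?thesis by simp
    qed
    have bound: "\<bar>D h\<bar> \<le> 3" for h
    proof -
      have "\<bar>rate Q pc t j 1 * claim h pc t j\<bar> \<le> 1" "\<bar>rate Q pc t j 0 * (1 - claim h pc t j)\<bar> \<le> 1"
        using rate_bounds claim_bounds[OF v, of h] by (auto simp: abs_mult intro!: mult_le_one)
      moreover have "\<bar>val (tset Q) h (Gd pc t j)\<bar> \<le> 1" using val_nonneg[OF v] val_le_1[OF v] by simp
      ultimately show ?thesis unfolding D_def by linarith
    qed
    have "\<bar>D h\<bar> \<le> 3 * (1 / 2) ^ n" for n h
    proof (induction n arbitrary: h)
      case (Suc n)
      show ?case using half[of h] Suc[of "h @ ?e"] by simp
    qed (use bound in simp)
    then have "\<bar>D h\<bar> \<le> 0" by (intro le_if_le_add_half_power[of _ 0 3]) simp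
    then show ?thesis by (simp add: D_def)
  qed
qed

lemma exit_value:
  assumes Q: "sinks_only Q" and v: "isv (Ex i s \<tau>)"
  shows "val (tset Q) h (Ex i s \<tau>) = real (2 - s) / (3 * R) * of_bool (Q (Xt i s \<tau>))
    + real (3 * R + s - 2) / (3 * R) * of_bool (Q Dd)"
  using v notin_tset[OF Q v] in_tset[of "Xt i s \<tau>" Q] in_tset[of Dd Q]
  by (subst val_nature) (simp_all add: val_sink)

lemma body_value:
  assumes "isv (Bd pc t)" "ix (Bd pc t) \<notin> F"
  shows "val F h (Bd pc t) = val F (h @ [ix (Bd pc t)]) (Br pc t) / 2
    + (\<Sum>j<R. val F (h @ [ix (Bd pc t)]) (Gd pc t j)) / (2 * R)"
  using assms by (subst val_nature)
    (simp_all add: o_def interv_sum_list_conv_sum_set_nat atLeast0LessThan sum_divide_distrib)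

abbreviation "Tp i s \<tau> \<equiv> tset (pays P i s \<tau>)"

lemma sinks_only_pays: "sinks_only (pays P i s \<tau>)"
  using pays_sink by (auto simp: sinks_only_def)

lemma sinks_only_exit: "sinks_only is_exit"
  using exit_sink by (auto simp: sinks_only_def)

definition gain :: "nat \<Rightarrow> nat \<Rightarrow> nat \<Rightarrow> nat list \<Rightarrow> nat \<Rightarrow> nat \<Rightarrow> real" where
  "gain i s \<tau> h pc t = (if t = \<tau> then phi s (reg_op (P ! pc) i) (claim h pc t (src_reg (P ! pc) i))
     else if s = 0 then claim h pc t i else 1 - claim h pc t i)"

lemma rate_pays:
  "rate (pays P i s \<tau>) pc t j b = (if t = \<tau> then
     if j = src_reg (P ! pc) i then
       if s = 0 then real (quarters (reg_op (P ! pc) i) b) / 4 else 1 - real (quarters (reg_op (P ! pc) i) b) / 4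
     else 0
    else if j = i then of_bool (s = 0 \<longleftrightarrow> b = 1) else 0)"
  by (cases "reg_op (P ! pc) i") (auto simp: rate_def)

lemma src_reg_less: "pc < N \<Longrightarrow> i < R \<Longrightarrow> src_reg (P ! pc) i < R"
  by (simp add: src_reg_def instr_ok)

text \<open>Among the \<open>R\<close> gadgets of a step a player can win in exactly one, that of
  register \<open>j0\<close>; the others give her 0.\<close>

lemma body_player:
  assumes v: "pc < N" "t < 2" and i: "i < R"
  shows "val (Tp i s \<tau>) h (Bd pc t) = val (Tp i s \<tau>) (h @ [ix (Bd pc t)]) (Br pc t) / 2
    + gain i s \<tau> (h @ [ix (Bd pc t)]) pc t / (2 * R)"
proof -
  let ?h = "h @ [ix (Bd pc t)]"
  define j0 where "j0 = (if t = \<tau> then src_reg (P ! pc) i else i)"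
  have j0: "j0 < R" using src_reg_less v i by (simp add: j0_def)
  have "val (Tp i s \<tau>) ?h (Gd pc t j) = (if j = j0 then gain i s \<tau> ?h pc t else 0)" if "j < R" for j
    using v that gadget_value[OF sinks_only_pays, of pc t j i s \<tau> ?h]
    by (auto simp: rate_pays j0_def gain_def phi_def Let_def field_simps)
  then have "(\<Sum>j<R. val (Tp i s \<tau>) ?h (Gd pc t j)) = (\<Sum>j<R. if j = j0 then gain i s \<tau> ?h pc t else 0)"
    by (intro sum.cong) auto
  also have "\<dots> = gain i s \<tau> ?h pc t" using j0 by simp
  finally show ?thesis
    using body_value[of pc t "Tp i s \<tau>" h] v notin_tset[OF sinks_only_pays, of "Bd pc t"] by simp
qed

lemma body_exit:
  assumes v: "pc < N" "t < 2"
  shows "val (tset is_exit) h (Bd pc t) = val (tset is_exit) (h @ [ix (Bd pc t)]) (Br pc t) / 2"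
proof -
  have "val (tset is_exit) h' (Gd pc t j) = 0" if "j < R" for j h'
    using v that gadget_value[OF sinks_only_exit, of pc t j h'] by (simp add: rate_def)
  then show ?thesis
    using body_value[of pc t "tset is_exit" h] v notin_tset[OF sinks_only_exit, of "Bd pc t"] by simp
qed

lemma exit_value_exit: "isv (Ex i s \<tau>) \<Longrightarrow> val (tset is_exit) h (Ex i s \<tau>) = 1"
proof -
  assume v: "isv (Ex i s \<tau>)"
  have "2 - s + (3 * R + s - 2) = 3 * R" using v R_pos by auto
  then have "real (2 - s) + real (3 * R + s - 2) = 3 * real R" by (metis of_nat_add of_nat_mult of_nat_numeral)
  then show ?thesis using exit_value[OF sinks_only_exit v] R_pos by (simp add: add_divide_distrib[symmetric])
qed

lemma exit_value_pays:
  "isv (Ex i s \<tau>) \<Longrightarrow> val (Tp i' s' \<tau>') h (Ex i s \<tau>) = real (2 - s) / (3 * R) * of_bool (i = i' \<and> s = s' \<and> \<tau> = \<tau>')"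
  using exit_value[OF sinks_only_pays, of i s \<tau> i' s' \<tau>' h] by simp

end

section \<open>Equilibria follow the run of the machine\<close>

locale arena_NE = arena_play +
  fixes c :: sclass
  assumes ne: "is_0NE G c \<sigma>"
    and cls: "\<And>i. i \<in> {1..np G} \<Longrightarrow> in_class G i c (\<sigma> i)"
    and pay0: "Pay G \<sigma> 0 \<le> 0"
begin

text \<open>Local optimality is available at these histories: they have positive probability, and no
  terminal has been seen, so no objective is fulfilled yet.\<close>

definition on_path :: "nat list \<Rightarrow> bool" where
  "on_path h \<longleftrightarrow> (\<exists>l. h = v0 G # l) \<and> set h \<subseteq> ix ` {v. isv v \<and> \<not> sink v} \<and> 0 < hist_prob G \<sigma> h"

lemma on_path_nv: "on_path h \<Longrightarrow> set h \<subseteq> {..<nv G}"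
  using ix_nv by (auto simp: on_path_def)

lemma on_path_snoc:
  "on_path h \<Longrightarrow> isv w \<Longrightarrow> \<not> sink w \<Longrightarrow> 0 < step G \<sigma> h (ix w) \<Longrightarrow> on_path (h @ [ix w])"
  unfolding on_path_def using hist_prob_snoc[of h G \<sigma> "ix w"]
  by (intro conjI) (force, force, metis list.distinct(1) mult_pos_pos)

lemma on_path_no_exit:
  assumes h: "on_path h" and w: "isv w" "0 < step G \<sigma> h (ix w)"
  shows "val (tset is_exit) h w = 0"
proof -
  obtain l where l: "h = v0 G # l" using h by (auto simp: on_path_def)
  have pos: "0 < path_prob G \<sigma> [v0 G] (l @ [ix w])"
    using h w hist_prob_append[of "[v0 G]" G \<sigma> "l @ [ix w]"] hist_prob_snoc[of h G \<sigma> "ix w"]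
    by (simp add: l on_path_def hist_prob_def)
  have "path_prob G \<sigma> [v0 G] (l @ [ix w]) * reach_val G \<sigma> (tset is_exit) ([v0 G] @ (l @ [ix w]))
     \<le> reach_val G \<sigma> (tset is_exit) [v0 G]"
    using on_path_nv[OF h] w ix_nv by (intro reach_val_ge_path[OF vp]) (auto simp: l)
  also have "\<dots> \<le> 0" using pay0 Pay_eq_reach_val[OF vp, of 0] target_0 by (simp add: tset_def)
  finally have "val (tset is_exit) h w \<le> 0" using pos by (simp add: val_def l mult_le_0_iff)
  then show ?thesis using val_nonneg[OF w(1)] by (simp add: antisym)
qed

lemma on_path_no_gain:
  assumes h: "on_path (h @ [ix v])" and v: "isv v" "owner P v = Suc (player i s \<tau>)"
    and i: "i < R" "s < 2" "\<tau> < 2" and w: "w \<in> set (psucc P R v)"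
  shows "val (Tp i s \<tau>) (h @ [ix v]) w \<le> val (Tp i s \<tau>) h v"
proof -
  let ?k = "player i s \<tau>"
  have k: "?k \<in> {1..np G}" using player_less[OF i] by (simp add: player_def)
  have T: "target G ?k = Tp i s \<tau>" using target_player[OF i] by (simp add: tset_def)
  obtain l where l: "h @ [ix v] = v0 G # l" using h by (auto simp: on_path_def)
  have "\<forall>u\<in>set (h @ [ix v]). u \<notin> target G ?k"
    unfolding T using h notin_tset[OF sinks_only_pays] by (auto simp: on_path_def)
  then show ?thesis
    using NE_no_gain[OF vp ne cls[OF k] k l on_path_nv[OF h], of "ix w"] h v own_ix[OF v(1)] w
      nxt_player[OF v(1)] by (simp add: val_def T on_path_def)
qed

definition node :: "nat list \<Rightarrow> nat \<Rightarrow> nat \<Rightarrow> bool" where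
  "node g pc t \<longleftrightarrow> pc < N \<and> t < 2 \<and> on_path (g @ [ix (Ch pc t 0)])"

text \<open>An exit ends in \<open>Xt\<close> or \<open>Dd\<close>, and both count for the system.
  Payoff 0 therefore excludes exits on the path, and the chain hands values on unchanged.\<close>

lemma node_chain:
  assumes n: "node g pc t"
  shows "m \<le> 2 * R \<Longrightarrow> on_path (before_chain g pc t m @ [ix (chain R pc t m)]) \<and>
    (\<forall>Q. sinks_only Q \<longrightarrow> val (tset Q) (before_chain g pc t m) (chain R pc t m) = val (tset Q) g (Ch pc t 0))"
proof (induction m)
  case 0
  then show ?case using n R_pos by (simp add: chain_def before_chain_0 node_def)
next
  case (Suc m)
  let ?g = "before_chain g pc t m"
  have m: "m < 2 * R" using Suc.prems by simp
  then have ch: "chain R pc t m = Ch pc t m" by (simp add: chain_def)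
  have v: "isv (Ch pc t m)" using n m by (simp add: node_def)
  have vx: "isv (Ex (m div 2) (m mod 2) t)" using n m by (auto simp: node_def)
  have vc: "isv (chain R pc t (Suc m))" using n isv_chain by (simp add: node_def)
  have IH: "on_path (?g @ [ix (Ch pc t m)])"
    "\<And>Q. sinks_only Q \<Longrightarrow> val (tset Q) ?g (Ch pc t m) = val (tset Q) g (Ch pc t 0)"
    using Suc m ch by auto
  have ps: "psucc P R (Ch pc t m) = [Ex (m div 2) (m mod 2) t, chain R pc t (Suc m)]" by simp
  have ne: "Ex (m div 2) (m mod 2) t \<noteq> chain R pc t (Suc m)" by (simp add: chain_def)
  have q0: "step G \<sigma> (?g @ [ix (Ch pc t m)]) (ix (Ex (m div 2) (m mod 2) t)) = 0"
  proof (rule ccontr)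
    assume "\<not> ?thesis"
    then have "0 < step G \<sigma> (?g @ [ix (Ch pc t m)]) (ix (Ex (m div 2) (m mod 2) t))"
      using step_nonneg[of G \<sigma> "?g @ [ix (Ch pc t m)]"] by (simp add: less_le)
    then show False using on_path_no_exit[OF IH(1) vx] exit_value_exit[OF vx] by simp
  qed
  have "val (tset Q) ?g (Ch pc t m) = val (tset Q) (before_chain g pc t (Suc m)) (chain R pc t (Suc m))"
    if "sinks_only Q" for Q
    using val_player(1)[OF v ps notin_tset[OF that v], of ?g] q0 by (simp add: before_chain_Suc)
  moreover have "step G \<sigma> (?g @ [ix (Ch pc t m)]) (ix (chain R pc t (Suc m))) = 1"
    using val_player(4)[OF v ps _ ne, of "{}" ?g] q0 by simp
  then have "on_path (before_chain g pc t (Suc m) @ [ix (chain R pc t (Suc m))])"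
    using on_path_snoc[OF IH(1) vc] by (simp add: before_chain_Suc chain_def)
  ultimately show ?case using IH(2) by simp
qed

lemma node_lower:
  assumes n: "node g pc t" and i: "i < R" "s < 2"
  shows "real (2 - s) / (3 * R) \<le> val (Tp i s t) g (Ch pc t 0)"
proof -
  define m where "m = 2 * i + s"
  have m: "m < 2 * R" "m div 2 = i" "m mod 2 = s" using i by (auto simp: m_def)
  have t: "t < 2" "pc < N" using n by (auto simp: node_def)
  have nc: "on_path (before_chain g pc t m @ [ix (Ch pc t m)])"
    "val (Tp i s t) (before_chain g pc t m) (Ch pc t m) = val (Tp i s t) g (Ch pc t 0)"
    using node_chain[OF n, of m] m sinks_only_pays by (auto simp: chain_def)
  have "val (Tp i s t) (before_chain g pc t m @ [ix (Ch pc t m)]) (Ex i s t) \<le> val (Tp i s t) (before_chain g pc t m) (Ch pc t m)"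
    using m i t by (intro on_path_no_gain[OF nc(1)]) auto
  then show ?thesis using nc(2) exit_value_pays[of i s t i s t] i t by simp
qed

abbreviation "branch_prob g pc t \<equiv> step G \<sigma> (after_br g pc t) (ix (Ch (lz pc) (1 - t) 0))"

lemma node_branch:
  assumes n: "node g pc t"
  defines "q \<equiv> branch_prob g pc t"
  shows "0 \<le> q" "q \<le> 1"
    and "0 < q \<Longrightarrow> node (after_br g pc t) (lz pc) (1 - t)"
    and "q < 1 \<Longrightarrow> node (after_br g pc t) (lnz pc) (1 - t)"
    and "on_path (after_br g pc t)"
    and "sinks_only Q \<Longrightarrow> val (tset Q) (before_br g pc t) (Br pc t) =
      q * val (tset Q) (after_br g pc t) (Ch (lz pc) (1 - t) 0)
      + (1 - q) * val (tset Q) (after_br g pc t) (Ch (lnz pc) (1 - t) 0)"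
    and "lz pc = lnz pc \<Longrightarrow> q = 1"
proof -
  have t: "t < 2" "pc < N" using n by (auto simp: node_def)
  have pb: "on_path (before_br g pc t)"
    using node_chain[OF n, of "2 * R"] by (simp add: before_br_def chain_def)
  have vB: "isv (Bd pc t)" and vb: "isv (Br pc t)" using t by auto
  have "step G \<sigma> (before_br g pc t) (ix (Br pc t)) = nprob G (ix (Bd pc t)) (ix (Br pc t))"
    using own_ix[OF vB] by (simp add: step_def before_br_def)
  also have "\<dots> \<ge> 1 / 2"
    unfolding nprob_ix[OF vB] by (auto intro!: sum_list_nonneg)
  finally have "0 < step G \<sigma> (before_br g pc t) (ix (Br pc t))" by linarith
  then show pa: "on_path (after_br g pc t)"
    unfolding after_br_def using vb by (intro on_path_snoc[OF pb]) auto
  have ps: "psucc P R (Br pc t) = [Ch (lz pc) (1 - t) 0, Ch (lnz pc) (1 - t) 0]" by simp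
  note v = val_player[OF vb ps, of _ "before_br g pc t", folded after_br_def, folded q_def]
  have vs: "isv (Ch (lz pc) (1 - t) 0)" "isv (Ch (lnz pc) (1 - t) 0)"
    using t instr_ok[OF t(2)] R_pos by auto
  show q: "0 \<le> q" "q \<le> 1" using v[of "{}"] by auto
  show z: "0 < q \<Longrightarrow> node (after_br g pc t) (lz pc) (1 - t)"
    using vs on_path_snoc[OF pa vs(1)] unfolding node_def q_def by auto
  show one: "lz pc = lnz pc \<Longrightarrow> q = 1" using v(5)[of "{}"] by simp
  show "node (after_br g pc t) (lnz pc) (1 - t)" if "q < 1"
  proof -
    have "lz pc \<noteq> lnz pc" using one that by auto
    then have "step G \<sigma> (after_br g pc t) (ix (Ch (lnz pc) (1 - t) 0)) = 1 - q"
      using v(4)[of "{}"] by simp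
    then show ?thesis using vs on_path_snoc[OF pa vs(2)] that unfolding node_def by auto
  qed
  show "val (tset Q) (before_br g pc t) (Br pc t) =
      q * val (tset Q) (after_br g pc t) (Ch (lz pc) (1 - t) 0)
      + (1 - q) * val (tset Q) (after_br g pc t) (Ch (lnz pc) (1 - t) 0)" if "sinks_only Q"
    using v(1)[OF notin_tset[OF that vb]] by simp
qed

lemma node_value:
  assumes n: "node g pc t" and i: "i < R"
  shows "val (Tp i s \<tau>) g (Ch pc t 0) = val (Tp i s \<tau>) (before_br g pc t) (Br pc t) / 2
    + gain i s \<tau> (before_br g pc t) pc t / (2 * R)"
proof -
  have t: "t < 2" "pc < N" using n by (auto simp: node_def)
  have "val (Tp i s \<tau>) g (Ch pc t 0) = val (Tp i s \<tau>) (before_chain g pc t (2 * R)) (Bd pc t)"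
    using node_chain[OF n, of "2 * R"] sinks_only_pays by (simp add: chain_def)
  then show ?thesis using body_player[OF t(2,1) i] by (simp add: before_br_def)
qed

text \<open>The gains of complementary players add up to 1 at steps of either parity, so their joint
  value is half the next joint value plus \<open>1 / (2 * R)\<close>, with fixed point
  \<open>1 / R\<close>.\<close>

lemma node_sum_le:
  assumes "node g pc t" and i: "i < R"
  shows "val (Tp i 0 \<tau>) g (Ch pc t 0) + val (Tp i 1 \<tau>) g (Ch pc t 0) \<le> 1 / R"
proof -
  let ?V = "\<lambda>g pc t. val (Tp i 0 \<tau>) g (Ch pc t 0) + val (Tp i 1 \<tau>) g (Ch pc t 0)"
  have "?V g pc t \<le> 1 / R + 2 * (1 / 2) ^ n" if "node g pc t" for n g pc t
    using that
  proof (induction n arbitrary: g pc t)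
    case 0
    then have v: "isv (Ch pc t 0)" using R_pos by (simp add: node_def)
    have "?V g pc t \<le> 2" using val_le_1[OF v, of "Tp i 0 \<tau>" g] val_le_1[OF v, of "Tp i 1 \<tau>" g] by simp
    then show ?case using R_pos by (simp add: add_increasing)
  next
    case (Suc n)
    define q where "q = branch_prob g pc t"
    note nb = node_branch[OF Suc.prems, folded q_def]
    let ?B = "1 / R + 2 * (1 / 2) ^ n"
    let ?z = "?V (after_br g pc t) (lz pc) (1 - t)" and ?nz = "?V (after_br g pc t) (lnz pc) (1 - t)"
    have "q * ?z \<le> q * ?B" using Suc.IH[OF nb(3)] nb(1) by (cases "q = 0") (auto intro!: mult_left_mono)
    moreover have "(1 - q) * ?nz \<le> (1 - q) * ?B"
      using Suc.IH[OF nb(4)] nb(2) by (cases "q = 1") (auto intro!: mult_left_mono)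
    ultimately have "q * ?z + (1 - q) * ?nz \<le> ?B" by (simp add: left_diff_distrib)
    moreover have "gain i 0 \<tau> h pc t + gain i 1 \<tau> h pc t = 1" for h
      by (simp add: gain_def phi_def Let_def)
    then have "gain i 0 \<tau> h pc t / (2 * R) + gain i 1 \<tau> h pc t / (2 * R) = 1 / (2 * R)" for h
      by (metis add_divide_distrib)
    moreover have "?V g pc t = (q * ?z + (1 - q) * ?nz) / 2
      + (gain i 0 \<tau> (before_br g pc t) pc t / (2 * R) + gain i 1 \<tau> (before_br g pc t) pc t / (2 * R))"
      unfolding node_value[OF Suc.prems i] nb(6)[OF sinks_only_pays] by (simp add: field_simps)
    ultimately have "?V g pc t \<le> ?B / 2 + 1 / (2 * R)" by simp
    then show ?case by (simp add: field_simps)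
  qed
  from this[OF assms(1)] show ?thesis by (rule le_if_le_add_half_power)
qed

text \<open>Both guards secure their exit rewards, and these already exhaust the joint
  bound.\<close>

lemma node_exact:
  assumes n: "node g pc t" and i: "i < R"
  shows "val (Tp i 0 t) g (Ch pc t 0) = 2 / (3 * R)"
proof -
  have "2 / (3 * R) \<le> val (Tp i 0 t) g (Ch pc t 0)" "1 / (3 * R) \<le> val (Tp i 1 t) g (Ch pc t 0)"
    using node_lower[OF n i, of 0] node_lower[OF n i, of 1] by simp_all
  moreover have "1 / real R = 2 / (3 * R) + 1 / (3 * R)" using R_pos by (simp add: field_simps)
  ultimately show ?thesis using node_sum_le[OF n i, of t] by linarith
qed

abbreviation "clm g pc t \<equiv> claim (before_br g pc t) pc t"

text \<open>One step ahead this player stands at a node of her own parity, where her value is her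
  reward. Halved, it gives the summand \<open>1 / (3 * R)\<close>; the other summand is what the
  present gadgets pay.\<close>

lemma node_other:
  assumes n: "node g pc t" and i: "i < R" and \<tau>: "\<tau> = 1 - t"
  shows "val (Tp i 0 \<tau>) g (Ch pc t 0) = clm g pc t i / (2 * R) + 1 / (3 * R)"
proof -
  define q where "q = branch_prob g pc t"
  note nb = node_branch[OF n, folded q_def]
  have t: "t < 2" using n by (simp add: node_def)
  have ex: "val (Tp i 0 \<tau>) h (Ch pc' \<tau> 0) = 2 / (3 * R)" if "node h pc' \<tau>" for h pc'
    using node_exact[OF that i] .
  have "q * val (Tp i 0 \<tau>) (after_br g pc t) (Ch (lz pc) \<tau> 0) = q * (2 / (3 * R))"
    using ex nb(1,3) \<tau> by (cases "q = 0") auto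
  moreover have "(1 - q) * val (Tp i 0 \<tau>) (after_br g pc t) (Ch (lnz pc) \<tau> 0) = (1 - q) * (2 / (3 * R))"
    using ex nb(2,4) \<tau> by (cases "q = 1") auto
  ultimately have "val (Tp i 0 \<tau>) (before_br g pc t) (Br pc t) = q * (2 / (3 * R)) + (1 - q) * (2 / (3 * R))"
    unfolding nb(6)[OF sinks_only_pays] \<tau> by simp
  moreover have "q * y + (1 - q) * y = y" for y by (simp add: algebra_simps)
  ultimately have "val (Tp i 0 \<tau>) (before_br g pc t) (Br pc t) = 2 / (3 * R)" by metis
  moreover have "t \<noteq> \<tau>" using t \<tau> by presburger
  then have "gain i 0 \<tau> (before_br g pc t) pc t = clm g pc t i" by (simp add: gain_def)
  ultimately show ?thesis using node_value[OF n i, of 0 \<tau>] by simp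
qed

text \<open>The value \<open>2 / (3 * R)\<close> is unfolded over two steps and multiplied by
  \<open>4 * R\<close>, giving 8 / 3 = y + 2 / 3 + 2 * r with r the present gain and y the average
  of the next claims. A randomised branch would be constrained only through this average, hence the
  need for \<open>node_pure\<close>.\<close>

lemma node_step:
  assumes n: "node g pc t" and i: "i < R"
  defines "q \<equiv> branch_prob g pc t"
  shows "q * clm (after_br g pc t) (lz pc) (1 - t) i + (1 - q) * clm (after_br g pc t) (lnz pc) (1 - t) i
    = 2 * (1 - phi 0 (reg_op (P ! pc) i) (clm g pc t (src_reg (P ! pc) i)))"
proof -
  note nb = node_branch[OF n, folded q_def]
  let ?h = "after_br g pc t" and ?lz = "lz pc" and ?lnz = "lnz pc"
  have t: "t = 1 - (1 - t)" using n by (simp add: node_def)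
  have ot: "val (Tp i 0 t) h (Ch pc' (1 - t) 0) = clm h pc' (1 - t) i / (2 * R) + 1 / (3 * R)"
    if "node h pc' (1 - t)" for h pc'
    using node_other[OF that i t] .
  have A: "q * val (Tp i 0 t) ?h (Ch ?lz (1 - t) 0) = q * (clm ?h ?lz (1 - t) i / (2 * R) + 1 / (3 * R))"
    using ot nb(1,3) by (cases "q = 0") auto
  have B: "(1 - q) * val (Tp i 0 t) ?h (Ch ?lnz (1 - t) 0) = (1 - q) * (clm ?h ?lnz (1 - t) i / (2 * R) + 1 / (3 * R))"
    using ot nb(2,4) by (cases "q = 1") auto
  have "2 / (3 * R) = (q * (clm ?h ?lz (1 - t) i / (2 * R) + 1 / (3 * R))
      + (1 - q) * (clm ?h ?lnz (1 - t) i / (2 * R) + 1 / (3 * R))) / 2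
      + gain i 0 t (before_br g pc t) pc t / (2 * R)"
    using node_value[OF n i, of 0 t] node_exact[OF n i] unfolding nb(6)[OF sinks_only_pays] A B by simp
  moreover have "gain i 0 t (before_br g pc t) pc t = phi 0 (reg_op (P ! pc) i) (clm g pc t (src_reg (P ! pc) i))"
    by (simp add: gain_def)
  moreover have "q * (x / (2 * R) + 1 / (3 * R)) + (1 - q) * (y / (2 * R) + 1 / (3 * R))
     = (q * x + (1 - q) * y) / (2 * R) + 1 / (3 * R)" for x y
    by (simp add: field_simps add_divide_distrib diff_divide_distrib)
  ultimately have eq: "2 / (3 * R) = ((q * clm ?h ?lz (1 - t) i + (1 - q) * clm ?h ?lnz (1 - t) i) / (2 * R) + 1 / (3 * R)) / 2
      + phi 0 (reg_op (P ! pc) i) (clm g pc t (src_reg (P ! pc) i)) / (2 * R)" by simp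
  have "2 / (3 * real R) * (4 * R) = 8 / 3" using R_pos by simp
  moreover have "((a / (2 * R) + 1 / (3 * R)) / 2 + b / (2 * R)) * (4 * real R) = a + 2 / 3 + 2 * b" for a b :: real
    using R_pos by (simp add: field_simps)
  ultimately have "8 / 3 = (q * clm ?h ?lz (1 - t) i + (1 - q) * clm ?h ?lnz (1 - t) i) + 2 / 3
      + 2 * phi 0 (reg_op (P ! pc) i) (clm g pc t (src_reg (P ! pc) i))"
    using arg_cong[OF eq, of "\<lambda>x. x * (4 * real R)"] by simp
  moreover have "y = 2 * (1 - z)" if "8 / 3 = y + 2 / 3 + 2 * z" for y z :: real using that by simp
  ultimately show ?thesis by blast
qed

text \<open>By \<open>node_step\<close> the expression is an average of probabilities. Machine
  errors are excluded by this bound: for \<open>AssertZ\<close> it reads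
  \<open>2 - x \<le> 1\<close>, for \<open>Dec\<close> it reads
  \<open>2 * x \<le> 1\<close>.\<close>

lemma node_step_le_1:
  assumes n: "node g pc t" and i: "i < R"
  shows "2 * (1 - phi 0 (reg_op (P ! pc) i) (clm g pc t (src_reg (P ! pc) i))) \<le> 1"
proof -
  define q where "q = branch_prob g pc t"
  note nb = node_branch[OF n, folded q_def]
  have pc: "pc < N" "t < 2" using n by (auto simp: node_def)
  have b: "clm h pc' (1 - t) i \<le> 1" if "pc' < N" for h pc'
    using claim_bounds(2)[of pc' "1 - t" i] that i by simp
  have "q * clm (after_br g pc t) (lz pc) (1 - t) i + (1 - q) * clm (after_br g pc t) (lnz pc) (1 - t) i
     \<le> q * 1 + (1 - q) * 1"
    using nb(1,2) b instr_ok[OF pc(1)] by (intro add_mono mult_left_mono) auto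
  then show ?thesis using node_step[OF n i, folded q_def] by simp
qed

lemma node_assert:
  assumes n: "node g pc t" and r: "tests (P ! pc) AssertZ r"
  shows "1 \<le> clm g pc t r"
  using node_step_le_1[OF n, of r] r instr_ok(1)[of pc] n by (simp add: tests_def reg_op_def src_reg_def node_def)

lemma node_dec:
  assumes n: "node g pc t" and r: "tests (P ! pc) Dec r"
  shows "clm g pc t r \<le> 1 / 2"
  using node_step_le_1[OF n, of r] r instr_ok(1)[of pc] n by (simp add: tests_def reg_op_def src_reg_def node_def)

lemma node_pure:
  assumes n: "node g pc t"
  shows "branch_prob g pc t = 0 \<or> branch_prob g pc t = 1"
proof (rule ccontr)
  assume neither: "\<not> (branch_prob g pc t = 0 \<or> branch_prob g pc t = 1)"
  define q where "q = branch_prob g pc t"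
  note nb = node_branch[OF n, folded q_def]
  have q: "0 < q" "q < 1" using neither nb(1,2) by (auto simp: q_def)
  let ?h = "after_br g pc t" and ?lz = "lz pc" and ?lnz = "lnz pc" and ?b = "ibr (P ! pc)"
  have pc: "pc < N" "t < 2" using n by (auto simp: node_def)
  have b: "?b < R" using instr_ok[OF pc(1)] by simp
  have diff: "?lz \<noteq> ?lnz" using nb(7) q by auto
  note t = instr_ok(8)[OF pc(1) diff]
  have nz: "node ?h ?lz (1 - t)" and nnz: "node ?h ?lnz (1 - t)" using nb(3,4) q by auto
  let ?v = "\<lambda>l. val (Tp ?b 0 t) ?h (Ch l (1 - t) 0)"
  have le: "?v l \<le> val (Tp ?b 0 t) (before_br g pc t) (Br pc t)" if "l \<in> {?lz, ?lnz}" for l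
    unfolding after_br_def using nb(5) pc b that by (intro on_path_no_gain) (auto simp: after_br_def)
  \<comment> \<open>The value at the branch is an average of both successor values and at least each
    of them; with \<open>q\<close> strictly between 0 and 1 they must be equal.\<close>
  have "(1 - q) * ?v ?lz \<le> (1 - q) * ?v ?lnz" "q * ?v ?lnz \<le> q * ?v ?lz"
    using le[of ?lz] le[of ?lnz] unfolding nb(6)[OF sinks_only_pays] by (simp_all add: left_diff_distrib)
  then have "?v ?lz = ?v ?lnz" using q by simp
  moreover have tt: "t = 1 - (1 - t)" using pc by simp
  ultimately have "clm ?h ?lz (1 - t) ?b = clm ?h ?lnz (1 - t) ?b"
    using node_other[OF nz b tt] node_other[OF nnz b tt] R_pos by simp
  moreover have "1 \<le> clm ?h ?lz (1 - t) ?b" "clm ?h ?lnz (1 - t) ?b \<le> 1 / 2"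
    using node_assert[OF nz] node_dec[OF nnz] t by blast+
  ultimately show False by linarith
qed

lemma node_init: "node [] 0 0"
  using N_pos R_pos by (auto simp: node_def on_path_def hist_prob_def game_sel)

section \<open>Claims along the path encode the configurations of the run\<close>

definition represents :: "nat list \<Rightarrow> nat \<Rightarrow> config \<Rightarrow> bool" where
  "represents g t cf \<longleftrightarrow> node g (fst cf) t \<and> (\<forall>j<R. clm g (fst cf) t j = 1 / 2 ^ snd cf j)"

lemma represents_legal:
  assumes r: "represents g t cf"
  shows "legal P cf"
proof -
  obtain pc \<rho> where cf: "cf = (pc, \<rho>)" by (cases cf)
  have n: "node g pc t" and cl: "\<And>j. j < R \<Longrightarrow> clm g pc t j = 1 / 2 ^ \<rho> j"
    using r by (auto simp: represents_def cf)
  have pc: "pc < N" using n by (simp add: node_def)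
  let ?I = "P ! pc"
  have le: "2 * (1 - phi 0 (iop ?I) (1 / 2 ^ \<rho> (isrc ?I))) \<le> 1"
    using node_step_le_1[OF n, of "idst ?I"] instr_ok[OF pc] cl by (simp add: reg_op_def src_reg_def)
  have "\<rho> (isrc ?I) \<noteq> 0" if "iop ?I = Dec" using le that by (cases "\<rho> (isrc ?I)") auto
  moreover have "\<rho> (isrc ?I) = 0" if "iop ?I = AssertZ"
  proof (rule ccontr)
    assume "\<rho> (isrc ?I) \<noteq> 0"
    then have "(1::real) / 2 ^ \<rho> (isrc ?I) < 1" by simp
    then show False using le that by simp
  qed
  ultimately show ?thesis using pc by (simp add: legal_def cf)
qed

text \<open>The branch is pure by \<open>node_pure\<close>, and the test at the chosen target shows
  that it is correct: \<open>Dec\<close> bounds the claim of the tested register by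
  \<open>1 / 2\<close>, while \<open>AssertZ\<close> forces it to be at least 1.\<close>

lemma represents_exec1:
  assumes r: "represents g t cf"
  shows "\<exists>g'. represents g' (1 - t) (exec1 P cf)"
proof -
  obtain pc \<rho> where cf: "cf = (pc, \<rho>)" by (cases cf)
  have n: "node g pc t" and cl: "\<And>j. j < R \<Longrightarrow> clm g pc t j = 1 / 2 ^ \<rho> j"
    using r by (auto simp: represents_def cf)
  have pc: "pc < N" using n by (simp add: node_def)
  let ?I = "P ! pc"
  define \<rho>' where "\<rho>' = \<rho>(idst ?I := app_op (iop ?I) (\<rho> (isrc ?I)))"
  define q where "q = branch_prob g pc t"
  note nb = node_branch[OF n, folded q_def]
  let ?h = "after_br g pc t" and ?lz = "lz pc" and ?lnz = "lnz pc" and ?b = "ibr (P ! pc)"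
  have b: "?b < R" using instr_ok[OF pc] by simp
  have leg: "legal P (pc, \<rho>)" using represents_legal[OF r] by (simp add: cf)
  have st: "q * clm ?h ?lz (1 - t) i + (1 - q) * clm ?h ?lnz (1 - t) i = 1 / 2 ^ \<rho>' i" if i: "i < R" for i
  proof -
    have "2 * (1 - phi 0 (reg_op ?I i) (clm g pc t (src_reg ?I i))) = 1 / 2 ^ \<rho>' i"
      using exec1_phi[OF leg, of i] cl[OF src_reg_less[OF pc i]] by (simp add: exec1_def Let_def \<rho>'_def)
    then show ?thesis using node_step[OF n i, folded q_def] by simp
  qed
  define l where "l = (if \<rho>' ?b = 0 then ?lz else ?lnz)"
  have ex: "exec1 P cf = (l, \<rho>')" by (simp add: exec1_def cf Let_def l_def \<rho>'_def)
  have "node ?h l (1 - t) \<and> (\<forall>i<R. clm ?h l (1 - t) i = 1 / 2 ^ \<rho>' i)"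
  proof (cases "?lz = ?lnz")
    case True
    then have "q = 1" "l = ?lz" using nb(7) by (auto simp: l_def)
    then show ?thesis using nb(3) st by simp
  next
    case False
    note t = instr_ok(8)[OF pc False]
    consider "q = 0" | "q = 1" using node_pure[OF n] by (auto simp: q_def)
    then show ?thesis
    proof cases
      case 1
      then have nd: "node ?h ?lnz (1 - t)" and c: "\<And>i. i < R \<Longrightarrow> clm ?h ?lnz (1 - t) i = 1 / 2 ^ \<rho>' i"
        using nb(4) st by auto
      have "1 / 2 ^ \<rho>' ?b \<le> (1 / 2 :: real)" using node_dec[OF nd, of ?b] t c[OF b] by simp
      then have "\<rho>' ?b \<noteq> 0" by (cases "\<rho>' ?b") auto
      then show ?thesis using nd c by (simp add: l_def)
    next
      case 2
      then have nd: "node ?h ?lz (1 - t)" and c: "\<And>i. i < R \<Longrightarrow> clm ?h ?lz (1 - t) i = 1 / 2 ^ \<rho>' i"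
        using nb(3) st by auto
      have "1 \<le> (1 / 2 ^ \<rho>' ?b :: real)" using node_assert[OF nd, of ?b] t c[OF b] by simp
      moreover have "1 / 2 ^ \<rho>' ?b < (1::real)" if "\<rho>' ?b \<noteq> 0" using that by simp
      ultimately have "\<rho>' ?b = 0" by linarith
      then show ?thesis using nd c by (simp add: l_def)
    qed
  qed
  then show ?thesis unfolding ex represents_def by auto
qed

lemma run_legal: "legal P (run P inp k)"
proof -
  have "\<exists>g t. represents g t (run P inp k)"
  proof (induction k)
    case 0
    have "represents [] 0 (run P inp 0)"
      using node_init by (auto simp: represents_def run_def claim_init)
    then show ?case by blast
  next
    case (Suc k)
    then show ?case using represents_exec1 by (metis run_Suc)
  qed
  then show ?thesis using represents_legal by blast
qed

end

section \<open>The equilibrium of a successful run\<close>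

lemma player_mod_2: "t < 2 \<Longrightarrow> player i s t mod 2 = t"
proof -
  assume "t < 2"
  moreover have "player i s t = t + 2 * (1 + 2 * i + s)" by (simp add: player_def)
  ultimately show ?thesis by (simp only: mod_mult_self2 mod_less)
qed

locale arena_run = arena +
  fixes K gl :: nat
  assumes legal_run: "\<And>k. legal P (run P inp k)"
    and loop_instr: "P ! gl = mov 0 0 Keep gl"
    and loop: "\<And>k. K \<le> k \<Longrightarrow> fst (run P inp k) = gl"
    and loop_zero: "\<And>k r. K \<le> k \<Longrightarrow> r < R \<Longrightarrow> snd (run P inp k) r = 0"
begin

abbreviation "pcs k \<equiv> fst (run P inp k)"
abbreviation "rg k \<equiv> snd (run P inp k)"
abbreviation "par k \<equiv> k mod 2"

lemma pcs_less: "pcs k < N"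
  using legal_run[of k] by (simp add: legal_def)

lemma par_Suc: "par (Suc k) = 1 - par k"
  by presburger

lemma pcs_Suc: "pcs (Suc k) = (if rg (Suc k) (ibr (P ! pcs k)) = 0 then lz (pcs k) else lnz (pcs k))"
  by (simp add: run_Suc exec1_def Let_def)

lemma pcs_pos: "0 < k \<Longrightarrow> 0 < pcs k"
  using instr_ok[OF pcs_less] by (cases k) (auto simp: pcs_Suc)

section \<open>The true run as a history and the strategy that follows it\<close>

primrec pre :: "nat \<Rightarrow> nat list" where
  "pre 0 = []"
| "pre (Suc k) = after_br (pre k) (pcs k) (par k)"

abbreviation "prec k \<equiv> before_chain (pre k) (pcs k) (par k)"
abbreviation "ch k \<equiv> Ch (pcs k) (par k)"
abbreviation "chn k \<equiv> chain R (pcs k) (par k)"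
abbreviation "br k \<equiv> Br (pcs k) (par k)"
abbreviation "gd k \<equiv> Gd (pcs k) (par k)"
abbreviation "hf k \<equiv> Hf (pcs k) (par k)"
abbreviation "preb k \<equiv> before_br (pre k) (pcs k) (par k)"

lemma length_pre: "length (pre k) = k * (2 * R + 2)"
  by (induction k) (auto simp: after_br_def before_br_def before_chain_def)

lemma pre_inj: "pre k = pre k' \<longleftrightarrow> k = k'"
  by (metis length_pre add_is_0 mult_cancel2 zero_neq_numeral)

lemma pre_prefix: "k < k' \<Longrightarrow> \<exists>l. preb k' = pre (Suc k) @ l"
proof (induction k')
  case (Suc k')
  have "\<exists>l. pre (Suc k') = pre (Suc k) @ l"
  proof (cases "k = k'")
    case False
    then have "\<exists>l. preb k' = pre (Suc k) @ l" using Suc by auto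
    then show ?thesis by (auto simp: after_br_def)
  qed simp
  then show ?case unfolding before_br_def[of "pre (Suc k')"] before_chain_def by (auto simp del: pre.simps)
qed simp

definition halves :: "nat \<Rightarrow> nat \<Rightarrow> nat \<Rightarrow> nat list" where
  "halves k j n = preb k @ concat (replicate n [ix (gd k j), ix (hf k j)])"

lemma halves_Suc: "halves k j (Suc n) = halves k j n @ [ix (gd k j), ix (hf k j)]"
proof -
  have "concat (replicate n xs) @ xs = xs @ concat (replicate n xs)" for xs :: "nat list"
    by (induction n) auto
  then show ?thesis by (simp add: halves_def)
qed

definition cont_hists :: "nat list set" where
  "cont_hists = {prec k (Suc m) | k m. m < 2 * R}"

definition br_hists :: "nat list set" where
  "br_hists = {pre (Suc k) | k. pcs (Suc k) \<noteq> lz (pcs k)}"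

definition half_hists :: "nat list set" where
  "half_hists = {halves k j n @ [ix (gd k j)] | k j n. j < R \<and> n < rg k j}"

text \<open>Chosen so that the run obeys it from some step on: at \<open>gl\<close> nobody exits,
  jumps take the zero side, and gadgets give result 1, that is, contents 0. Only finitely many
  histories then require another move. Continuing at \<open>gl\<close> lets no wrong branch pass,
  because such a branch lands on \<open>AssertZ\<close> or \<open>Dec\<close>, whereas
  \<open>gl\<close> carries \<open>Keep\<close>.\<close>

fun default_vert :: "vert \<Rightarrow> vert" where
  "default_vert (Ch pc t m) = (if pc = gl then chain R pc t (Suc m) else Ex (m div 2) (m mod 2) t)"
| "default_vert (Br pc t) = Ch (ilz (P ! pc)) (1 - t) 0"
| "default_vert (Gd pc t j) = Rs pc t j 1"
| "default_vert v = v"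

fun next_vert :: "nat list \<Rightarrow> vert \<Rightarrow> vert" where
  "next_vert h (Ch pc t m) = (if h \<in> cont_hists then chain R pc t (Suc m) else default_vert (Ch pc t m))"
| "next_vert h (Br pc t) = (if h \<in> br_hists then Ch (ilnz (P ! pc)) (1 - t) 0 else default_vert (Br pc t))"
| "next_vert h (Gd pc t j) = (if h \<in> half_hists then Hf pc t j else default_vert (Gd pc t j))"
| "next_vert h v = v"

text \<open>One function serves all environment players, each of whom consults it at her own
  vertices.\<close>

definition sig :: strat where
  "sig h = return_pmf (ix (next_vert h (verts N R ! last h)))"

lemma last_halves: "isv v \<Longrightarrow> halves k j n @ [ix (gd k j)] = h @ [ix v] \<Longrightarrow> j < R \<Longrightarrow>
  v = gd k j"
  using ix_inj[of v "gd k j"] pcs_less[of k] by auto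

definition override_hists :: "nat list set" where
  "override_hists = (\<lambda>(k, m). prec k (Suc m)) ` ({..<K} \<times> {..<2 * R}) \<union>
    (\<lambda>k. pre (Suc k)) ` {..<K} \<union>
    (\<lambda>(k, j, n). halves k j n @ [ix (gd k j)]) ` (SIGMA k : {..<K}. SIGMA j : {..<R}. {..<rg k j})"

lemma default_override:
  assumes "last h < nv G"
    and "next_vert h (verts N R ! last h) \<noteq> default_vert (verts N R ! last h)"
  shows "h \<in> override_hists"
proof -
  let ?v = "verts N R ! last h"
  have v: "isv ?v" using assms(1) nth_mem[of "last h" "verts N R"] set_verts by (auto simp: game_sel)
  have ixv: "ix ?v = last h"
    using nth_ix[OF v] ix_less[OF v] assms(1) distinct_verts by (simp add: nth_eq_iff_index_eq game_sel)
  show ?thesis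
  proof (cases ?v)
    case (Ch pc t m)
    then have "h \<in> cont_hists" "pc \<noteq> gl" using assms(2) by (auto split: if_splits)
    then obtain k m' where k: "h = prec k (Suc m')" "m' < 2 * R"
      by (auto simp: cont_hists_def)
    then have "ix (ch k m') = ix ?v" using ixv by (simp add: before_chain_Suc)
    then have "?v = ch k m'" using ix_inj[OF _ v] k(2) pcs_less[of k] by auto
    then have "k < K" using loop[of k] \<open>pc \<noteq> gl\<close> Ch by (metis not_le vert.inject(1))
    then show ?thesis unfolding override_hists_def using k by force
  next
    case (Br pc t)
    then have "h \<in> br_hists" using assms(2) by (auto split: if_splits)
    then obtain k where k: "h = pre (Suc k)" "pcs (Suc k) \<noteq> lz (pcs k)"
      by (auto simp: br_hists_def)
    have "k < K"
    proof (rule ccontr)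
      assume "\<not> k < K"
      then show False using k(2) loop[of k] loop[of "Suc k"] loop_instr by simp
    qed
    then show ?thesis unfolding override_hists_def using k by blast
  next
    case (Gd pc t j)
    then have "h \<in> half_hists" using assms(2) by (auto split: if_splits)
    then obtain k j n where k: "h = halves k j n @ [ix (gd k j)]" "j < R" "n < rg k j"
      by (auto simp: half_hists_def)
    have "k < K" using loop_zero[of k j] k by (metis not_le not_less0)
    then show ?thesis unfolding override_hists_def using k by force
  qed (use assms(2) in simp_all)
qed

lemma sig_finstate: "is_finstate G i sig"
proof -
  define d where "d = (\<lambda>n. return_pmf (ix (default_vert (verts N R ! n))))"
  \<comment> \<open>Outside the vertex range \<open>verts N R ! n\<close> has no known value; there
    \<open>sig'\<close> takes the default, and it agrees with \<open>sig\<close> wherever a player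
    moves.\<close>
  define sig' where "sig' = (\<lambda>h. if last h < nv G then sig h else d (last h))"
  have "finite {h. sig' h \<noteq> d (last h)}"
  proof (rule finite_subset)
    show "{h. sig' h \<noteq> d (last h)} \<subseteq> override_hists"
    proof
      fix h assume "h \<in> {h. sig' h \<noteq> d (last h)}"
      then have "last h < nv G" "next_vert h (verts N R ! last h) \<noteq> default_vert (verts N R ! last h)"
        by (auto simp: sig'_def sig_def d_def split: if_splits)
      then show "h \<in> override_hists"
        by (rule default_override)
    qed
    show "finite override_hists"
      unfolding override_hists_def by (intro finite_UnI finite_imageI finite_SigmaI) auto
  qed
  then have fs: "is_finstate G i sig'" by (rule is_finstate_if_finite_diff)
  have "at_player G i h \<Longrightarrow> sig h = sig' h" for h by (simp add: sig'_def at_player_def)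
  then show ?thesis using fs unfolding is_finstate_def by (simp cong: imp_cong)
qed

lemma sig_in_class: "in_class G i c sig"
  using sig_finstate by (cases c) (auto simp: is_pure_def sig_def)

lemma next_vert_psucc: "isv v \<Longrightarrow> owner P v \<noteq> 0 \<Longrightarrow> next_vert h v \<in> set (psucc P R v)"
  by (cases v) (auto split: if_splits)

lemma sig_valid: "valid_strat G i sig"
  unfolding valid_strat_def
proof (intro allI impI)
  fix h assume h: "at_player G i h"
  then obtain v where v: "isv v" "last h = ix v" using less_ix by (auto simp: at_player_def game_sel)
  then have "owner P v \<noteq> 0" using h own_ix[OF v(1)] by (simp add: at_player_def)
  then show "set_pmf (sig h) \<subseteq> nxt G (last h)"
    using next_vert_psucc[OF v(1)] nxt_player[OF v(1)] v nth_ix[OF v(1)] by (simp add: sig_def)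
qed

end

section \<open>Values when at most one environment player leaves the profile\<close>

locale arena_run_play = arena_run P R inp K gl + arena_play P R inp \<sigma>
  for P R inp K gl \<sigma>
begin

lemma val_sig:
  assumes v: "isv v" and i: "owner P v = Suc i" "\<sigma> i = sig" and F: "ix v \<notin> F"
  shows "val F h v = val F (h @ [ix v]) (next_vert (h @ [ix v]) v)"
proof -
  let ?h = "h @ [ix v]" and ?w = "next_vert (h @ [ix v]) v"
  have w: "isv ?w" using next_vert_psucc[OF v] i isv_psucc[OF v] by simp
  have st: "step G \<sigma> ?h u = (if u = ix ?w then 1 else 0)" for u
    using own_ix[OF v] i nth_ix[OF v] by (simp add: step_def sig_def)
  have "val F h v = (\<Sum>u<nv G. step G \<sigma> ?h u * reach_val G \<sigma> F (?h @ [u]))"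
    unfolding val_def using F ix_nv[OF v] by (subst reach_val_unfold[OF vp]) auto
  also have "\<dots> = (\<Sum>u<nv G. if u = ix ?w then reach_val G \<sigma> F (?h @ [u]) else 0)"
    by (intro sum.cong) (auto simp: st)
  also have "\<dots> = val F ?h ?w" using ix_nv[OF w] by (simp add: val_def)
  finally show ?thesis .
qed

text \<open>A history at a gadget determines step, register and round: where this step enters a
  gadget, a history of a later step has \<open>Br\<close>, and within one step the length gives the
  round.\<close>

lemma half_hists_iff:
  assumes "j < R"
  shows "halves k j n @ [ix (gd k j)] \<in> half_hists \<longleftrightarrow> n < rg k j"
proof
  assume "halves k j n @ [ix (gd k j)] \<in> half_hists"
  then obtain k' j' n' where e: "halves k j n @ [ix (gd k j)] = halves k' j' n' @ [ix (gd k' j')]"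
    "j' < R" "n' < rg k' j'" by (auto simp: half_hists_def)
  have v: "isv (gd k j)" using assms pcs_less by simp
  have gd: "gd k j = gd k' j'" using last_halves[OF v _ e(2)] e(1) by metis
  have starts: "\<exists>l. halves a i m @ [ix (gd a i)] = preb a @ ix (gd a i) # l" for a i m
    by (cases m) (auto simp: halves_def)
  have no: False if ab: "a < b" and i: "i < R"
    and eq: "halves a i m @ [ix (gd a i)] = halves b i' m' @ [ix (gd b i')]" for a b i m i' m'
  proof -
    obtain l where l: "preb b = pre (Suc a) @ l" using pre_prefix[OF ab] by blast
    obtain l1 where "halves a i m @ [ix (gd a i)] = preb a @ ix (gd a i) # l1"
      using starts by blast
    moreover obtain l2 where "halves b i' m' @ [ix (gd b i')] = preb b @ ix (gd b i') # l2"
      using starts by blast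
    ultimately have "ix (gd a i) = ix (Br (pcs a) (par a))"
      using eq l by (simp add: after_br_def)
    then show False using ix_inj[of "gd a i" "Br (pcs a) (par a)"] i pcs_less by simp
  qed
  have "k = k'" using no[of k k' j n j' n'] no[of k' k j' n' j n] e assms by (metis linorder_neqE_nat)
  moreover have "j = j'" using gd by simp
  moreover have "length (halves k j n) = length (preb k) + 2 * n" for k n
    by (simp add: halves_def length_concat sum_list_replicate o_def)
  ultimately have "n = n'" using arg_cong[OF e(1), of length] by simp
  then show "n < rg k j" using e \<open>k = k'\<close> \<open>j = j'\<close> by simp
next
  assume "n < rg k j"
  then show "halves k j n @ [ix (gd k j)] \<in> half_hists" using assms by (auto simp: half_hists_def)
qed

lemma claim_run:
  assumes s1: "\<sigma> 1 = sig" and j: "j < R"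
  shows "claim (preb k) (pcs k) (par k) j = 1 / 2 ^ rg k j"
proof (cases "k = 0")
  case True
  then show ?thesis using claim_init[OF j] by (simp add: run_def)
next
  case False
  let ?v = "gd k j" and ?F = "{ix (Rs (pcs k) (par k) j 1)}"
  have pos: "pcs k \<noteq> 0" using pcs_pos[of k] False by simp
  have v: "isv ?v" "isv (hf k j)" "isv (Rs (pcs k) (par k) j 1)" using j pcs_less by auto
  have ow: "owner P ?v = Suc 1" using pos by simp
  have nF: "ix ?v \<notin> ?F" "ix (hf k j) \<notin> ?F" using ix_inj[OF v(1,3)] ix_inj[OF v(2,3)] by auto
  \<comment> \<open>Downward from round \<open>rg k j\<close>, where result 1 is taken; each earlier
    round contributes a factor \<open>1 / 2\<close>.\<close>
  have "val ?F (halves k j n) ?v = 1 / 2 ^ (rg k j - n)" if "n \<le> rg k j" for n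
    using that
  proof (induction "rg k j - n" arbitrary: n)
    case 0
    then have "\<not> n < rg k j" by simp
    then have "val ?F (halves k j n) ?v = val ?F (halves k j n @ [ix ?v]) (Rs (pcs k) (par k) j 1)"
      using val_sig[OF v(1) ow s1 nF(1), of "halves k j n"] half_hists_iff[OF j, of k n] by simp
    then show ?case using 0 by (simp add: val_in)
  next
    case (Suc d)
    then have "n < rg k j" by simp
    then have "val ?F (halves k j n) ?v = val ?F (halves k j n @ [ix ?v]) (hf k j)"
      using val_sig[OF v(1) ow s1 nF(1), of "halves k j n"] half_hists_iff[OF j, of k n] by simp
    also have "\<dots> = val ?F (halves k j (Suc n)) ?v / 2"
      using v(2) nF(2) val_Rs0[OF v(1)] by (subst val_nature) (simp_all add: halves_Suc)
    also have "val ?F (halves k j (Suc n)) ?v = 1 / 2 ^ (rg k j - Suc n)"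
      using Suc by (intro Suc.hyps(1)) auto
    finally have "val ?F (halves k j n) ?v = 1 / 2 ^ Suc (rg k j - Suc n)" by simp
    then show ?case using Suc_diff_Suc[OF \<open>n < rg k j\<close>] by simp
  qed
  from this[of 0] show ?thesis by (simp add: claim_def halves_def)
qed

abbreviation "node_val Q k \<equiv> val (tset Q) (pre k) (ch k 0)"
abbreviation "body_val Q k \<equiv> val (tset Q) (prec k (2 * R)) (Bd (pcs k) (par k))"
abbreviation "br_val Q k \<equiv> val (tset Q) (preb k) (br k)"

lemma chain_step_sig:
  assumes Q: "sinks_only Q" and m: "m < 2 * R" and s: "\<sigma> (player (m div 2) (m mod 2) (par k)) = sig"
  shows "val (tset Q) (prec k m) (chn k m)
    = val (tset Q) (prec k (Suc m)) (chn k (Suc m))"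
proof -
  have v: "isv (ch k m)" using m pcs_less by simp
  have "prec k m @ [ix (ch k m)] \<in> cont_hists"
    using m by (auto simp: cont_hists_def before_chain_Suc)
  then show ?thesis
    using val_sig[OF v _ s notin_tset[OF Q v], of "prec k m"] m
    by (simp add: before_chain_Suc chain_def)
qed

lemma chain_sig:
  assumes Q: "sinks_only Q" and s: "\<And>m. m < 2 * R \<Longrightarrow> \<sigma> (player (m div 2) (m mod 2) (par k)) = sig"
  shows "node_val Q k = body_val Q k"
proof -
  have "m \<le> 2 * R \<Longrightarrow> node_val Q k
      = val (tset Q) (prec k m) (chn k m)" for m
  proof (induction m)
    case 0
    then show ?case using R_pos by (simp add: chain_def before_chain_0)
  next
    case (Suc m)
    then show ?case using chain_step_sig[OF Q _ s, of m] by simp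
  qed
  from this[of "2 * R"] show ?thesis by (simp add: chain_def)
qed

text \<open>The others continue along the run, so the deviator can only cash in her own reward or go
  on, and a mixture is at most the maximum.\<close>

lemma chain_deviate:
  assumes s: "\<And>i. 1 \<le> i \<Longrightarrow> i \<noteq> player a b \<tau> \<Longrightarrow> \<sigma> i = sig" and a: "a < R" "b < 2" "\<tau> < 2"
  shows "node_val (pays P a b \<tau>) k \<le> max (real (2 - b) / (3 * R)) (body_val (pays P a b \<tau>) k)"
proof -
  let ?Q = "pays P a b \<tau>"
  let ?c = "\<lambda>m. val (tset ?Q) (prec k m) (chn k m)"
  let ?B = "max (real (2 - b) / (3 * R)) (body_val ?Q k)"
  have "?c (2 * R - d) \<le> ?B" if "d \<le> 2 * R" for d
    using that
  proof (induction d)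
    case 0
    then show ?case by (simp add: chain_def)
  next
    case (Suc d)
    define m where "m = 2 * R - Suc d"
    have m: "m < 2 * R" "2 * R - d = Suc m" using Suc.prems by (auto simp: m_def)
    have IH: "?c (Suc m) \<le> ?B" using Suc m by simp
    have "?c m \<le> ?B"
    proof (cases "player (m div 2) (m mod 2) (par k) = player a b \<tau>")
      case False
      then have "\<sigma> (player (m div 2) (m mod 2) (par k)) = sig" by (intro s) (auto simp: player_def)
      then show ?thesis using chain_step_sig[OF sinks_only_pays m(1)] IH by simp
    next
      case True
      let ?g = "prec k m"
      have v: "isv (ch k m)" "isv (Ex (m div 2) (m mod 2) (par k))" using m pcs_less by auto
      have ps: "psucc P R (ch k m)
        = [Ex (m div 2) (m mod 2) (par k), chn k (Suc m)]" by simp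
      define q where "q = step G \<sigma> (?g @ [ix (ch k m)]) (ix (Ex (m div 2) (m mod 2) (par k)))"
      have nT: "ix (ch k m) \<notin> Tp a b \<tau>" by (rule notin_tset[OF sinks_only_pays v(1)]) simp
      note vpl = val_player[OF v(1) ps nT, of ?g, folded q_def]
      have "val (Tp a b \<tau>) h (Ex (m div 2) (m mod 2) (par k)) \<le> ?B" for h
        using exit_value_pays[OF v(2), of a b \<tau> h] by (auto simp: of_bool_def le_max_iff_disj)
      moreover have "?c m = q * val (Tp a b \<tau>) (?g @ [ix (ch k m)]) (Ex (m div 2) (m mod 2) (par k))
          + (1 - q) * ?c (Suc m)"
        using vpl(1) m by (simp add: chain_def before_chain_Suc)
      ultimately have "?c m \<le> q * ?B + (1 - q) * ?B"
        using vpl(2,3) IH by (auto intro!: add_mono mult_left_mono)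
      then show ?thesis by (simp add: algebra_simps)
    qed
    then show ?case by (simp add: m_def)
  qed
  from this[of "2 * R"] show ?thesis using R_pos by (simp add: chain_def before_chain_0)
qed

lemma br_hists_iff: "pre (Suc k) \<in> br_hists \<longleftrightarrow> pcs (Suc k) \<noteq> lz (pcs k)"
  unfolding br_hists_def using pre_inj by (auto simp del: pre.simps)

lemma br_sig:
  assumes Q: "sinks_only Q" and s: "\<sigma> (player (ibr (P ! pcs k)) 0 (par k)) = sig"
  shows "br_val Q k = node_val Q (Suc k)"
proof -
  have v: "isv (br k)" using pcs_less by simp
  have "preb k @ [ix (br k)] = pre (Suc k)" by (simp add: after_br_def)
  moreover have "next_vert (pre (Suc k)) (br k) = ch (Suc k) 0"
    unfolding next_vert.simps br_hists_iff par_Suc using pcs_Suc[of k] by simp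
  ultimately show ?thesis
    using val_sig[OF v _ s notin_tset[OF Q v], of "preb k"] by (simp del: pre.simps next_vert.simps)
qed

text \<open>After a wrong jump the first player of the next chain exits. Her parity differs from
  that of the player who branched, and the latter gains nothing from somebody else's exit.\<close>

lemma wrong_branch:
  assumes s: "\<sigma> (player 0 0 (par (Suc k))) = sig" and \<tau>: "\<tau> = par k"
    and l: "l \<in> {lz (pcs k), lnz (pcs k)}" "l \<noteq> pcs (Suc k)"
  shows "val (Tp a b \<tau>) (pre (Suc k)) (Ch l (par (Suc k)) 0) = 0"
proof -
  note ok = instr_ok[OF pcs_less, of k]
  have diff: "lz (pcs k) \<noteq> lnz (pcs k)" using l unfolding pcs_Suc by (auto split: if_splits)
  have "l \<noteq> gl" using ok(8)[OF diff] l(1) loop_instr by (auto simp: tests_def)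
  have lN: "l < N" using l ok by auto
  have v: "isv (Ch l (par (Suc k)) 0)" "isv (Ex 0 0 (par (Suc k)))" using lN R_pos by auto
  have "pre (Suc k) @ [ix (Ch l (par (Suc k)) 0)] \<notin> cont_hists"
  proof
    assume "pre (Suc k) @ [ix (Ch l (par (Suc k)) 0)] \<in> cont_hists"
    then obtain k' m where e: "m < 2 * R"
      "pre (Suc k) @ [ix (Ch l (par (Suc k)) 0)] = prec k' (Suc m)"
      by (auto simp: cont_hists_def)
    then have e2: "pre (Suc k) = prec k' m"
      "ix (Ch l (par (Suc k)) 0) = ix (ch k' m)" by (auto simp: before_chain_Suc)
    then have "Ch l (par (Suc k)) 0 = ch k' m" using ix_inj[OF v(1)] e(1) pcs_less by simp
    then have "m = 0" "l = pcs k'" by auto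
    then have "pre (Suc k) = pre k'" using e2(1) by (simp add: before_chain_0)
    then have "Suc k = k'" using pre_inj by blast
    then show False using l(2) \<open>l = pcs k'\<close> by blast
  qed
  then have "next_vert (pre (Suc k) @ [ix (Ch l (par (Suc k)) 0)]) (Ch l (par (Suc k)) 0) = Ex 0 0 (par (Suc k))"
    using \<open>l \<noteq> gl\<close> by simp
  moreover have "owner P (Ch l (par (Suc k)) 0) = Suc (player 0 0 (par (Suc k)))" by simp
  ultimately have "val (Tp a b \<tau>) (pre (Suc k)) (Ch l (par (Suc k)) 0)
     = val (Tp a b \<tau>) (pre (Suc k) @ [ix (Ch l (par (Suc k)) 0)]) (Ex 0 0 (par (Suc k)))"
    using val_sig[OF v(1) _ s notin_tset[OF sinks_only_pays v(1)], of a b \<tau> "pre (Suc k)"] not_sink(1) by metis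
  moreover have "par (Suc k) \<noteq> \<tau>" using \<tau> by presburger
  ultimately show ?thesis using exit_value_pays[OF v(2)] by simp
qed

lemma br_deviate:
  assumes s: "\<And>i. 1 \<le> i \<Longrightarrow> i \<noteq> player a b \<tau> \<Longrightarrow> \<sigma> i = sig" and \<tau>: "\<tau> = par k"
  shows "br_val (pays P a b \<tau>) k \<le> node_val (pays P a b \<tau>) (Suc k)"
proof -
  let ?Q = "pays P a b \<tau>"
  have v: "isv (br k)" "isv (ch (Suc k) 0)" using pcs_less R_pos by auto
  have ps: "psucc P R (br k)
    = [Ch (lz (pcs k)) (par (Suc k)) 0, Ch (lnz (pcs k)) (par (Suc k)) 0]" by (simp add: par_Suc)
  define q where "q = step G \<sigma> (preb k @ [ix (br k)]) (ix (Ch (lz (pcs k)) (par (Suc k)) 0))"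
  have nT: "ix (br k) \<notin> Tp a b \<tau>" by (rule notin_tset[OF sinks_only_pays v(1)]) simp
  note vpl = val_player[OF v(1) ps nT, of "preb k", folded q_def]
  have pre: "preb k @ [ix (br k)] = pre (Suc k)" by (simp add: after_br_def)
  have "par (Suc k) \<noteq> \<tau>" using \<tau> by presburger
  then have "player 0 0 (par (Suc k)) \<noteq> player a b \<tau>"
    using \<tau> player_mod_2[of "par (Suc k)" 0 0] player_mod_2[of \<tau> a b] by (metis mod_less_divisor pos2)
  then have s0: "\<sigma> (player 0 0 (par (Suc k))) = sig" by (intro s) (auto simp: player_def)
  have "val (tset ?Q) (pre (Suc k)) (Ch l (par (Suc k)) 0) \<le> node_val ?Q (Suc k)"
    if "l \<in> {lz (pcs k), lnz (pcs k)}" for l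
    using wrong_branch[OF s0 \<tau> that] val_nonneg[OF v(2)] by (cases "l = pcs (Suc k)") auto
  then have "br_val ?Q k \<le> q * node_val ?Q (Suc k) + (1 - q) * node_val ?Q (Suc k)"
    unfolding vpl(1) pre using vpl(2,3) by (intro add_mono mult_left_mono) auto
  then show ?thesis by (simp add: algebra_simps)
qed

definition run_gain :: "nat \<Rightarrow> nat \<Rightarrow> nat \<Rightarrow> nat \<Rightarrow> real" where
  "run_gain a b \<tau> k = (if par k = \<tau> then phi b (reg_op (P ! pcs k) a) (1 / 2 ^ rg k (src_reg (P ! pcs k) a))
     else if b = 0 then 1 / 2 ^ rg k a else 1 - 1 / 2 ^ rg k a)"

lemma body_run:
  assumes s1: "\<sigma> 1 = sig" and a: "a < R"
  shows "body_val (pays P a b \<tau>) k = br_val (pays P a b \<tau>) k / 2 + run_gain a b \<tau> k / (2 * R)"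
proof -
  have "gain a b \<tau> (preb k) (pcs k) (par k) = run_gain a b \<tau> k"
    unfolding gain_def run_gain_def claim_run[OF s1 a, of k]
      claim_run[OF s1 src_reg_less[OF pcs_less[of k] a], of k] ..
  then show ?thesis
    using body_player[OF pcs_less[of k], of "par k" a b \<tau> "prec k (2 * R)"] a
    by (simp add: before_br_def[symmetric])
qed

text \<open>With y the encoded new contents, the guard with \<open>b = 0\<close> is paid 1 - y / 2
  at her own step and y at the next, the latter with half weight: 1 in total, and 1 / 2 for her
  complement. Two further steps thus pay the same whatever the registers contain.\<close>

lemma run_gain_two_steps:
  assumes "par k = \<tau>" "b < 2"
  shows "run_gain a b \<tau> k + run_gain a b \<tau> (Suc k) / 2 = real (2 - b) / 2"
proof -
  let ?f = "phi 0 (reg_op (P ! pcs k) a) (1 / 2 ^ rg k (src_reg (P ! pcs k) a))"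
  have f: "2 * (1 - ?f) = 1 / 2 ^ rg (Suc k) a"
    using exec1_phi[OF legal_run, of k a] by (simp add: run_Suc)
  have "par (Suc k) \<noteq> \<tau>" using assms by presburger
  moreover have "phi b o' x = (if b = 0 then phi 0 o' x else 1 - phi 0 o' x)" for o' x
    by (simp add: phi_def Let_def)
  moreover have "b = 0 \<or> b = 1" using assms by auto
  ultimately show ?thesis using assms f by (auto simp: run_gain_def)
qed

lemma node_sig:
  assumes s: "\<And>i. 1 \<le> i \<Longrightarrow> i \<noteq> player a b \<tau> \<Longrightarrow> \<sigma> i = sig" and a: "a < R" "b < 2" "\<tau> < 2"
    and k: "par k \<noteq> \<tau> \<or> \<sigma> (player a b \<tau>) = sig"
  shows "node_val (pays P a b \<tau>) k = node_val (pays P a b \<tau>) (Suc k) / 2 + run_gain a b \<tau> k / (2 * R)"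
proof -
  have p: "\<sigma> (player i b' (par k)) = sig" for i b'
  proof (cases "player i b' (par k) = player a b \<tau>")
    case True
    then have "par k = \<tau>" using player_mod_2[of "par k" i b'] player_mod_2[of \<tau> a b] a by simp
    then show ?thesis using k True by simp
  next
    case False
    then show ?thesis by (intro s) (auto simp: player_def)
  qed
  have s1: "\<sigma> 1 = sig" by (intro s) (auto simp: player_def)
  show ?thesis
    using chain_sig[OF sinks_only_pays p] body_run[OF s1 a(1)] br_sig[OF sinks_only_pays p] by simp
qed

lemma exit_rate_le_1: "real (2 - b) / (3 * R) \<le> 1"
  using R_pos by (simp add: divide_le_eq)

text \<open>With c the exit reward, going on for two steps turns a later value V into at most V / 4
  + 3 * c / 4, a map with fixed point c. So neither exiting nor continuing yields more than
  c.\<close>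

lemma node_upper:
  assumes s: "\<And>i. 1 \<le> i \<Longrightarrow> i \<noteq> player a b \<tau> \<Longrightarrow> \<sigma> i = sig" and a: "a < R" "b < 2" "\<tau> < 2"
    and k: "par k = \<tau>"
  shows "node_val (pays P a b \<tau>) k \<le> real (2 - b) / (3 * R)"
proof -
  let ?Q = "pays P a b \<tau>" and ?c = "real (2 - b) / (3 * R)"
  have s1: "\<sigma> 1 = sig" by (intro s) (auto simp: player_def)
  have rec: "node_val ?Q k \<le> max ?c (node_val ?Q (Suc (Suc k)) / 4 + 3 * ?c / 4)" if k: "par k = \<tau>" for k
  proof -
    have "par (Suc k) \<noteq> \<tau>" using k by presburger
    then have n: "node_val ?Q (Suc k) = node_val ?Q (Suc (Suc k)) / 2 + run_gain a b \<tau> (Suc k) / (2 * R)"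
      using node_sig[OF s a, of "Suc k"] by blast
    have "body_val ?Q k \<le> node_val ?Q (Suc k) / 2 + run_gain a b \<tau> k / (2 * R)"
      using body_run[OF s1 a(1), of b \<tau> k] br_deviate[OF s k[symmetric]] by simp
    also have "\<dots> = node_val ?Q (Suc (Suc k)) / 4 + (run_gain a b \<tau> k + run_gain a b \<tau> (Suc k) / 2) / (2 * R)"
      unfolding n by (simp add: add_divide_distrib)
    also have "\<dots> = node_val ?Q (Suc (Suc k)) / 4 + 3 * ?c / 4"
      unfolding run_gain_two_steps[OF k a(2)] using R_pos by (simp add: field_simps)
    finally show ?thesis using chain_deviate[OF s a, of k] by linarith
  qed
  have "node_val ?Q k \<le> ?c + 1 * (1 / 2) ^ n" if "par k = \<tau>" for n k
    using that
  proof (induction n arbitrary: k)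
    case 0
    have "node_val ?Q k \<le> 1" using pcs_less R_pos by (intro val_le_1) simp
    moreover have "0 \<le> ?c" by simp
    ultimately have "node_val ?Q k \<le> ?c + 1" by linarith
    then show ?case by (simp only: power_0 mult_1)
  next
    case (Suc n)
    have p: "par (Suc (Suc k)) = \<tau>" using Suc.prems by presburger
    have "0 \<le> (1 / 2 :: real) ^ n" "(1 / 2 :: real) ^ Suc n = (1 / 2) ^ n / 2" by simp_all
    then show ?case using rec[OF Suc.prems] Suc.IH[OF p] by linarith
  qed
  from this[OF k] show ?thesis by (rule le_if_le_add_half_power)
qed

lemma node_lower_sig:
  assumes s: "\<And>i. 1 \<le> i \<Longrightarrow> \<sigma> i = sig" and a: "a < R" "b < 2" "\<tau> < 2" and k: "par k = \<tau>"
  shows "real (2 - b) / (3 * R) \<le> node_val (pays P a b \<tau>) k"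
proof -
  let ?Q = "pays P a b \<tau>" and ?c = "real (2 - b) / (3 * R)"
  have sk: "\<sigma> (player a b \<tau>) = sig" by (intro s) (simp add: player_def)
  have rec: "node_val ?Q k = node_val ?Q (Suc (Suc k)) / 4 + 3 * ?c / 4" if k: "par k = \<tau>" for k
  proof -
    have "node_val ?Q k = node_val ?Q (Suc (Suc k)) / 4 + (run_gain a b \<tau> k + run_gain a b \<tau> (Suc k) / 2) / (2 * R)"
      using node_sig[OF s a, of k] node_sig[OF s a, of "Suc k"] sk by (simp add: add_divide_distrib)
    also have "\<dots> = node_val ?Q (Suc (Suc k)) / 4 + 3 * ?c / 4"
      unfolding run_gain_two_steps[OF k a(2)] using R_pos by (simp add: field_simps)
    finally show ?thesis .
  qed
  have "?c \<le> node_val ?Q k + 1 * (1 / 2) ^ n" if "par k = \<tau>" for n k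
    using that
  proof (induction n arbitrary: k)
    case 0
    have "0 \<le> node_val ?Q k" using pcs_less R_pos by (intro val_nonneg) simp
    then show ?case using exit_rate_le_1[of b] by simp
  next
    case (Suc n)
    have p: "par (Suc (Suc k)) = \<tau>" using Suc.prems by presburger
    have key: "c \<le> v + 1 * q'" if "v = y / 4 + 3 * c / 4" "c \<le> y + 1 * q" "0 \<le> q" "q' = q / 2"
      for c v y q q' :: real using that by linarith
    show ?case by (rule key[OF rec[OF Suc.prems] Suc.IH[OF p]]) simp_all
  qed
  from this[OF k] show ?thesis by (rule le_if_le_add_half_power)
qed

lemma node_exit_sig:
  assumes s: "\<And>i. 1 \<le> i \<Longrightarrow> \<sigma> i = sig"
  shows "node_val is_exit 0 \<le> 0"
proof -
  have p: "\<sigma> (player i b t) = sig" for i b t by (intro s) (simp add: player_def)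
  have rec: "node_val is_exit k = node_val is_exit (Suc k) / 2" for k
    using chain_sig[OF sinks_only_exit p] body_exit[OF pcs_less, of "par k"] br_sig[OF sinks_only_exit p]
    by (simp add: before_br_def[symmetric])
  have "node_val is_exit k \<le> 0 + 1 * (1 / 2) ^ n" for n k
  proof (induction n arbitrary: k)
    case 0
    have "node_val is_exit k \<le> 1" using pcs_less R_pos by (intro val_le_1) simp
    then show ?case by simp
  next
    case (Suc n)
    then show ?case using rec[of k] Suc[of "Suc k"] by simp
  qed
  then show ?thesis by (rule le_if_le_add_half_power)
qed

end

section \<open>Undecidability\<close>

context arena
begin

lemma not_at_player_0: "\<not> at_player G 0 h"
proof
  assume h: "at_player G 0 h"
  then obtain v where v: "isv v" "last h = ix v" using less_ix by (auto simp: at_player_def game_sel)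
  then show False using h own_ix[OF v(1)] by (cases v) (auto simp: at_player_def player_def split: if_splits)
qed

text \<open>An equilibrium of system payoff 0 would force a legal run, so there is none, and any
  strategy of the system, which owns no vertex, wins.\<close>

lemma ncrsp_if_stuck:
  assumes "\<not> legal P (run P inp k)"
  shows "ncrsp G c"
  unfolding ncrsp_def
proof (intro exI conjI allI impI)
  define \<sigma>0 :: strat where "\<sigma>0 = (\<lambda>_. return_pmf 0)"
  show v0: "valid_strat G 0 \<sigma>0" using not_at_player_0 by (simp add: valid_strat_def)
  have "is_finstate G 0 \<sigma>0" by (rule is_finstate_if_finite_diff[of _ "\<lambda>_. return_pmf 0"]) (simp add: \<sigma>0_def)
  then show "in_class G 0 c \<sigma>0" by (cases c) (auto simp: is_pure_def \<sigma>0_def)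
  fix \<sigma>s assume s: "\<sigma>s 0 = \<sigma>0 \<and> (\<forall>i\<in>{1..np G}. valid_strat G i (\<sigma>s i) \<and> in_class G i c (\<sigma>s i)) \<and> is_0NE G c \<sigma>s"
  have "valid_strat G i (\<sigma>s i)" if "i \<le> np G" for i using s v0 that by (cases "i = 0") auto
  then have vp: "valid_profile G \<sigma>s" using wf_game by (simp add: valid_profile_def)
  show "real (mu_num G) / real (mu_den G) < Pay G \<sigma>s 0"
  proof (rule ccontr)
    assume "\<not> ?thesis"
    then have "Pay G \<sigma>s 0 \<le> 0" by (simp add: game_sel)
    then interpret arena_NE P R inp \<sigma>s c using vp s by unfold_locales auto
    show False using run_legal assms by blast
  qed
qed

end

lemma reach_val_empty: "reach_val x \<sigma>s {} h = 0"
proof -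
  have "reach_within x \<sigma>s {} n h = 0" for n by (induction n arbitrary: h) auto
  then show ?thesis by (simp add: reach_val_def)
qed

context arena_run
begin

lemma pcs_0: "pcs 0 = 0"
  by (simp add: run_def)

text \<open>The system moves nowhere, so the same environment strategies refute each choice of
  \<open>\<sigma>0\<close>. Stability against arbitrary strategies, together with membership of
  \<open>sig\<close> in every class, gives an equilibrium for each \<open>c\<close>.\<close>

lemma not_ncrsp: "\<not> ncrsp G c"
proof
  assume "ncrsp G c"
  then obtain \<sigma>0 where s0: "valid_strat G 0 \<sigma>0" and all: "\<And>\<sigma>s. \<sigma>s 0 = \<sigma>0 \<Longrightarrow>
      \<forall>i\<in>{1..np G}. valid_strat G i (\<sigma>s i) \<and> in_class G i c (\<sigma>s i) \<Longrightarrow> is_0NE G c \<sigma>s \<Longrightarrow>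
      Pay G \<sigma>s 0 > real (mu_num G) / real (mu_den G)"
    unfolding ncrsp_def by blast
  define \<sigma> :: profile where "\<sigma> = (\<lambda>_. sig)(0 := \<sigma>0)"
  have sg: "\<sigma> i = sig" if "1 \<le> i" for i using that by (simp add: \<sigma>_def)
  have vp: "valid_profile G \<sigma>" using wf_game s0 sig_valid by (simp add: valid_profile_def \<sigma>_def)
  interpret S: arena_run_play P R inp K gl \<sigma> using vp by unfold_locales
  have "is_0NE G c \<sigma>"
    unfolding is_0NE_def
  proof (intro ballI allI impI, elim conjE)
    fix i \<tau> assume i: "i \<in> {1..np G}" and v: "valid_strat G i \<tau>"
    let ?\<sigma> = "\<sigma>(i := \<tau>)"
    have vp': "valid_profile G ?\<sigma>" using vp v by (simp add: valid_profile_def)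
    interpret D: arena_run_play P R inp K gl ?\<sigma> using vp' by unfold_locales
    have "i \<le> np G" using i by simp
    then show "Pay G ?\<sigma> i \<le> Pay G \<sigma> i"
    proof (cases rule: player_cases)
      case 1
      then show ?thesis using i by simp
    next
      case 2
      then show ?thesis using Pay_eq_reach_val[OF vp] Pay_eq_reach_val[OF vp'] target_1 by (simp add: reach_val_empty)
    next
      case (3 a b t)
      let ?Q = "pays P a b t"
      have T: "target G i = S.tset ?Q" unfolding 3(1) target_player[OF 3(2-4)] by (simp add: S.tset_def)
      have pay: "Pay G \<sigma> i = S.node_val ?Q 0" "Pay G ?\<sigma> i = D.node_val ?Q 0"
        unfolding Pay_eq_reach_val[OF vp] Pay_eq_reach_val[OF vp'] T
        by (simp_all add: S.val_def D.val_def pcs_0 game_sel)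
      have sd: "?\<sigma> j = sig" if "1 \<le> j" "j \<noteq> player a b t" for j using that 3(1) sg by simp
      have le: "D.node_val ?Q k \<le> S.node_val ?Q k" if "par k = t" for k
        using D.node_upper[OF sd 3(2-4) that] S.node_lower_sig[OF sg 3(2-4) that] by linarith
      show ?thesis
      proof (cases "t = 0")
        case True
        then show ?thesis using le[of 0] pay by simp
      next
        case False
        then have t: "par 0 \<noteq> t" "par (Suc 0) = t" using 3(4) by auto
        \<comment> \<open>A player of parity 1 first moves at step 1; step 0 adds the same gain
          under both profiles, so the comparison at step 1 carries over.\<close>
        have "D.node_val ?Q 0 = D.node_val ?Q (Suc 0) / 2 + D.run_gain a b t 0 / (2 * R)"
          using D.node_sig[OF sd 3(2-4)] t by blast
        moreover have "S.node_val ?Q 0 = S.node_val ?Q (Suc 0) / 2 + S.run_gain a b t 0 / (2 * R)"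
          using S.node_sig[OF sg 3(2-4)] t by blast
        ultimately show ?thesis using le[OF t(2)] pay by simp
      qed
    qed
  qed
  moreover have "\<forall>i\<in>{1..np G}. valid_strat G i (\<sigma> i) \<and> in_class G i c (\<sigma> i)"
    using sig_valid sig_in_class sg by auto
  ultimately have "0 < Pay G \<sigma> 0" using all[of \<sigma>] by (simp add: \<sigma>_def game_sel)
  moreover have "Pay G \<sigma> 0 = S.node_val is_exit 0"
    unfolding Pay_eq_reach_val[OF vp] target_0 by (simp add: S.val_def S.tset_def pcs_0 game_sel)
  ultimately show False using S.node_exit_sig[OF sg] by simp
qed

end

theorem theorem3:
  fixes c :: sclass
  shows "\<not> (\<exists>f. decides f (\<lambda>x. ncrsp x c))"
proof
  assume "\<exists>f. decides f (\<lambda>x. ncrsp x c)"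
  then obtain f where f: "decides f (\<lambda>x. ncrsp x c)" by blast
  obtain D where D: "\<And>zs. length zs = 6 \<Longrightarrow> eval D [template_code zs] (enc_inst_with zs (template_code zs))"
    using self_application_computable by blast
  obtain P R where ok: "machine_ok P R"
    and good: "\<forall>t. eval (Cn f [D]) [t] 0 \<longrightarrow> (\<forall>k. legal P (run P t k)) \<and>
      (\<exists>K G. P ! G = mov 0 0 Keep G \<and> (\<forall>k\<ge>K. fst (run P t k) = G \<and> (\<forall>r<R. snd (run P t k) r = 0)))"
    and bad: "\<forall>t y. eval (Cn f [D]) [t] y \<longrightarrow> y \<noteq> 0 \<longrightarrow> (\<exists>k. \<not> legal P (run P t k))"
    using program_exists[of "Cn f [D]"] by blast
  obtain zs where zs: "length zs = 6" "\<And>inp. enc_inst (game P R inp) = enc_inst_with zs inp"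
    using enc_game[OF ok] by blast
  define t where "t = template_code zs"
  interpret arena P R t using ok by unfold_locales
  have "eval D [t] (enc_inst G)" using D[OF zs(1)] zs(2) by (simp add: t_def)
  then have run: "eval (Cn f [D]) [t] y" if "eval f [enc_inst G] y" for y
    using that by (intro eval_Cn[of _ _ "[enc_inst G]"]) auto
  have dec: "\<exists>y. eval f [enc_inst G] y" "eval f [enc_inst G] 0 \<longleftrightarrow> ncrsp G c"
    using f wf_game by (auto simp: decides_def)
  show False
  proof (cases "eval f [enc_inst G] 0")
    case True
    from good run[OF True] obtain K gl where
      "\<forall>k. legal P (run P t k)" "P ! gl = mov 0 0 Keep gl"
      "\<forall>k\<ge>K. fst (run P t k) = gl \<and> (\<forall>r<R. snd (run P t k) r = 0)" by blast
    then interpret arena_run P R t K gl by unfold_locales auto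
    show False using not_ncrsp True dec(2) by blast
  next
    case False
    obtain y where "eval f [enc_inst G] y" "y \<noteq> 0" using dec(1) False by metis
    then obtain k where "\<not> legal P (run P t k)" using bad run by blast
    then show False using ncrsp_if_stuck False dec(2) by blast
  qed
qed

end
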